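(* Let $R$ be a measurable function on the unit circle $\mathbb T$ with $|R(t)|\le 1$ a.e. and $\log(1-|R|)\in L^1(\mathbb T)$. With the space $L^R$, the operator $U_R$ of multiplication by $t$, and the vectors $\check K_{n,m},\widetilde{\check K}_{n,m}$ defined in the context, the sequence of vectors $$\ldots,\ \check K_{n-1,n-1},\ \widetilde{\check K}_{n,n-1},\ \check K_{n,n},\ \widetilde{\check K}_{n+1,n},\ \check K_{n+1,n+1},\ \widetilde{\check K}_{n+2,n+1},\ \ldots\qquad (n\in\mathbb Z)$$ is an orthonormal basis of $L^R$, and the matrix of $U_R$ in this basis is a (two-sided) CMV matrix: for every $n\in\mathbb Z$, $$\begin{bmatrix} U_R\check K_{n,n} & U_R\widetilde{\check K}_{n+1,n}\end{bmatrix}=\begin{bmatrix}\widetilde{\check K}_{n,n-1} & \check K_{n,n} & \widetilde{\check K}_{n+1,n} & \check K_{n+1,n+1}\end{bmatrix}\begin{bmatrix}\check\rho_{2n-1}&0\\ -\overline{\check\alpha}_{2n-1}&0\\ 0&\check\alpha_{2n+1}\\ 0&\check\rho_{2n+1}\end{bmatrix}\begin{bmatrix}\check\alpha_{2n}&\check\rho_{2n}\\ \check\rho_{2n}&-\overline{\check\alpha}_{2n}\end{bmatrix},$$ where the numbers $\check\alpha_j,\check\rho_j$ ($j\in\mathbb Z$) are defined in the context and satisfy $|\check\alpha_j|<1$, $\check\rho_j>0$.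
   Context: $L^R$ is the Hilbert space of (classes of) measurable functions $f=\begin{bmatrix}f_1\\ f_2\end{bmatrix}:\mathbb T\to\mathbb C^2$ with finite norm for the inner product $\langle f,g\rangle=\int_{\mathbb T} g(t)^*\begin{bmatrix}1&\overline{R(t)}\\R(t)&1\end{bmatrix}^{-1}f(t)\,dm(t)$, $m$ the normalized Lebesgue measure. $U_R$ is the unitary operator of multiplication by the independent variable $t$ on $L^R$. $L^2=L^2(\mathbb T)$, $H^2_+$ is the Hardy space of the disk, $H^2_-=L^2\ominus H^2_+$. For $n,m\in\mathbb Z$ let $\check{\mathcal H}_{n,m}$ be the closure in $L^R$ of $\left\{\begin{bmatrix}1&\overline R\\R&1\end{bmatrix}\begin{bmatrix}t^n h_+\\ \overline t^{\,m}h_-\end{bmatrix}: h_+\in H^2_+,\ h_-\in H^2_-\right\}$ (understood as closure of those vectors, which lie in $L^R$). The subspaces $\check{\mathcal H}_{n+1,m}$ and $\check{\mathcal H}_{n,m+1}$ have codimension one in $\check{\mathcal H}_{n,m}$. Let $\check K_{n,m}$ be the unit vector in $\check{\mathcal H}_{n,m}\ominus\check{\mathcal H}_{n+1,m}$ normalized by $\left\langle\begin{bmatrix}1\\R\end{bmatrix}t^n,\check K_{n,m}\right\rangle>0$, and let $\widetilde{\check K}_{n,m}$ be the unit vector in $\check{\mathcal H}_{n,m}\ominus\check{\mathcal H}_{n,m+1}$ normalized by $\left\langle\widetilde{\check K}_{n,m},\begin{bmatrix}\overline R\\1\end{bmatrix}\overline t^{\,m+1}\right\rangle>0$. The number $\check\alpha_{n+m}:=\langle\check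 K_{n,m},\widetilde{\check K}_{n,m}\rangle$ depends only on $n+m$; $\check\rho_j:=\sqrt{1-|\check\alpha_j|^2}$. An equality of row matrices of vectors multiplied by scalar matrices is understood by the usual matrix multiplication rule. *)

theory Defs
  imports "HOL-Analysis.Analysis" "HOL-Library.Complex_Order"
begin

text \<open>
  Elements of function spaces on the unit circle are represented by functions, two of which stand
  for the same element iff they agree almost everywhere. Functions on the circle are functions
  on \<^typ>\<open>complex\<close>; the measure below is carried by the unit circle, so values elsewhere are
  irrelevant. Because of the completion, measurable means Lebesgue measurable. Inner products are
  linear in the first argument. The order on \<^typ>\<open>complex\<close> is the one under which \<open>0 < z\<close> says that
  \<open>z\<close> is real and positive.
\<close>

definition circle_measure :: "complex measure" where
  "circle_measure = completion (distr (uniform_measure lborel {0..<2 * pi}) borel cis)"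

text \<open>In HOL \<open>ln 0 = 0\<close>, hence the first conjunct: \<open>log w\<close> has to be finite almost everywhere for a
  nonnegative \<open>w\<close> with integrable logarithm.\<close>

definition log_integrable :: "(complex \<Rightarrow> real) \<Rightarrow> bool" where
  "log_integrable w \<longleftrightarrow>
    (AE t in circle_measure. 0 < w t) \<and> integrable circle_measure (\<lambda>t. ln (w t))"


subsection \<open>Scalar spaces\<close>

definition L2 :: "(complex \<Rightarrow> complex) set" where
  "L2 = {h \<in> borel_measurable circle_measure. integrable circle_measure (\<lambda>t. (norm (h t))\<^sup>2)}"

definition L2_inner :: "(complex \<Rightarrow> complex) \<Rightarrow> (complex \<Rightarrow> complex) \<Rightarrow> complex" where
  "L2_inner f g = (LINT t|circle_measure. cnj (g t) * f t)"

text \<open>The Hardy space of the disk as a space of boundary functions: the square integrable functions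
  whose Fourier coefficients of negative index vanish.\<close>

definition H2_plus :: "(complex \<Rightarrow> complex) set" where
  "H2_plus = {h \<in> L2. \<forall>k<0. L2_inner h (\<lambda>t. t powi k) = 0}"

definition H2_minus :: "(complex \<Rightarrow> complex) set" where
  "H2_minus = {h \<in> L2. \<forall>g\<in>H2_plus. L2_inner h g = 0}"


subsection \<open>The space $L^R$\<close>

definition weight :: "(complex \<Rightarrow> complex) \<Rightarrow> complex \<Rightarrow> complex^2^2" where
  "weight R t = vector [vector [1, cnj (R t)], vector [R t, 1]]"

text \<open>The integrand \<open>g(t)\<^sup>* W(t)\<^sup>-\<^sup>1 f(t)\<close> of the inner product.\<close>

definition LR_form ::
    "(complex \<Rightarrow> complex) \<Rightarrow> (complex \<Rightarrow> complex^2) \<Rightarrow> (complex \<Rightarrow> complex^2) \<Rightarrow> complex \<Rightarrow> complex" where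
  "LR_form R f g t = (\<Sum>i\<in>UNIV. cnj (g t $ i) * (matrix_inv (weight R t) *v f t) $ i)"

definition LR_inner ::
    "(complex \<Rightarrow> complex) \<Rightarrow> (complex \<Rightarrow> complex^2) \<Rightarrow> (complex \<Rightarrow> complex^2) \<Rightarrow> complex" where
  "LR_inner R f g = (LINT t|circle_measure. LR_form R f g t)"

definition LR_norm :: "(complex \<Rightarrow> complex) \<Rightarrow> (complex \<Rightarrow> complex^2) \<Rightarrow> real" where
  "LR_norm R f = sqrt (Re (LR_inner R f f))"

definition LR :: "(complex \<Rightarrow> complex) \<Rightarrow> (complex \<Rightarrow> complex^2) set" where
  "LR R = {f \<in> borel_measurable circle_measure. integrable circle_measure (LR_form R f f)}"

definition LR_closure ::
    "(complex \<Rightarrow> complex) \<Rightarrow> (complex \<Rightarrow> complex^2) set \<Rightarrow> (complex \<Rightarrow> complex^2) set" where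
  "LR_closure R S = {f \<in> LR R. \<forall>e>0. \<exists>g \<in> S \<inter> LR R. LR_norm R (\<lambda>t. f t - g t) < e}"

definition LR_ominus :: "(complex \<Rightarrow> complex) \<Rightarrow>
    (complex \<Rightarrow> complex^2) set \<Rightarrow> (complex \<Rightarrow> complex^2) set \<Rightarrow> (complex \<Rightarrow> complex^2) set" where
  "LR_ominus R A B = {f \<in> A. \<forall>g\<in>B. LR_inner R f g = 0}"

definition U_R :: "(complex \<Rightarrow> complex^2) \<Rightarrow> complex \<Rightarrow> complex^2" where
  "U_R f = (\<lambda>t. t *s f t)"

definition LR_span :: "(int \<Rightarrow> complex \<Rightarrow> complex^2) \<Rightarrow> (complex \<Rightarrow> complex^2) set" where
  "LR_span b = {(\<lambda>t. \<Sum>j\<in>F. c j *s b j t) | F c. finite F}"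

definition LR_orthonormal_basis ::
    "(complex \<Rightarrow> complex) \<Rightarrow> (int \<Rightarrow> complex \<Rightarrow> complex^2) \<Rightarrow> bool" where
  "LR_orthonormal_basis R b \<longleftrightarrow>
    (\<forall>j. b j \<in> LR R) \<and>
    (\<forall>i j. LR_inner R (b i) (b j) = (if i = j then 1 else 0)) \<and>
    LR_closure R (LR_span b) = LR R"


subsection \<open>The subspaces and the CMV basis\<close>

definition H_check :: "(complex \<Rightarrow> complex) \<Rightarrow> int \<Rightarrow> int \<Rightarrow> (complex \<Rightarrow> complex^2) set" where
  "H_check R n m = LR_closure R
    {(\<lambda>t. weight R t *v vector [t powi n * hp t, cnj t powi m * hm t]) | hp hm.
      hp \<in> H2_plus \<and> hm \<in> H2_minus}"

text \<open>The conditions below determine a vector up to null sets; \<open>SOME\<close> picks a representative.\<close>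

definition K_check :: "(complex \<Rightarrow> complex) \<Rightarrow> int \<Rightarrow> int \<Rightarrow> complex \<Rightarrow> complex^2" where
  "K_check R n m = (SOME k.
    k \<in> LR_ominus R (H_check R n m) (H_check R (n + 1) m) \<and>
    LR_norm R k = 1 \<and>
    LR_inner R (\<lambda>t. (t powi n) *s vector [1, R t]) k > 0)"

definition K_check_tilde :: "(complex \<Rightarrow> complex) \<Rightarrow> int \<Rightarrow> int \<Rightarrow> complex \<Rightarrow> complex^2" where
  "K_check_tilde R n m = (SOME k.
    k \<in> LR_ominus R (H_check R n m) (H_check R n (m + 1)) \<and>
    LR_norm R k = 1 \<and>
    LR_inner R k (\<lambda>t. (cnj t powi (m + 1)) *s vector [cnj (R t), 1]) > 0)"

text \<open>The common value of the inner products over all \<open>n + m = j\<close>.\<close>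

definition alpha_check :: "(complex \<Rightarrow> complex) \<Rightarrow> int \<Rightarrow> complex" where
  "alpha_check R j = (THE a. \<forall>n m. n + m = j \<longrightarrow>
    LR_inner R (K_check R n m) (K_check_tilde R n m) = a)"

definition rho_check :: "(complex \<Rightarrow> complex) \<Rightarrow> int \<Rightarrow> real" where
  "rho_check R j = sqrt (1 - (norm (alpha_check R j))\<^sup>2)"

text \<open>The sequence \<open>\<dots>, K\<^sub>n\<^sub>,\<^sub>n, K~\<^sub>n\<^sub>+\<^sub>1\<^sub>,\<^sub>n, K\<^sub>n\<^sub>+\<^sub>1\<^sub>,\<^sub>n\<^sub>+\<^sub>1, \<dots>\<close>, with \<open>K\<^sub>n\<^sub>,\<^sub>n\<close> at position \<open>2n\<close> and
  \<open>K~\<^sub>n\<^sub>+\<^sub>1\<^sub>,\<^sub>n\<close> at position \<open>2n + 1\<close>.\<close>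

definition cmv_sequence :: "(complex \<Rightarrow> complex) \<Rightarrow> int \<Rightarrow> complex \<Rightarrow> complex^2" where
  "cmv_sequence R j =
    (let n = j div 2 in if even j then K_check R n n else K_check_tilde R (n + 1) n)"

text \<open>A row of vectors times a scalar matrix. Rows of elements of $L^R$ are multiplied pointwise.\<close>

definition row_times_matrix :: "(complex^2)^'n \<Rightarrow> complex^'m^'n \<Rightarrow> (complex^2)^'m" where
  "row_times_matrix v A = (\<chi> j. \<Sum>i\<in>UNIV. A $ i $ j *s v $ i)"

definition cmv_left :: "(complex \<Rightarrow> complex) \<Rightarrow> int \<Rightarrow> complex^2^4" where
  "cmv_left R n = vector
    [vector [of_real (rho_check R (2 * n - 1)), 0],
     vector [- cnj (alpha_check R (2 * n - 1)), 0],
     vector [0, alpha_check R (2 * n + 1)],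
     vector [0, of_real (rho_check R (2 * n + 1))]]"

definition cmv_right :: "(complex \<Rightarrow> complex) \<Rightarrow> int \<Rightarrow> complex^2^2" where
  "cmv_right R n = vector
    [vector [alpha_check R (2 * n), of_real (rho_check R (2 * n))],
     vector [of_real (rho_check R (2 * n)), - cnj (alpha_check R (2 * n))]]"

end

theory Submission
  imports
    Defs
    "HOL-Library.Function_Algebras"
    "HOL-Computational_Algebra.Fundamental_Theorem_Algebra"
    "HOL-Real_Asymp.Real_Asymp"
begin

text \<open>The vectors \<open>e\<^sub>n = [1; R] t\<^sup>n\<close> and \<open>f\<^sub>m = [cnj R; 1] cnj t\<^sup>m\<^sup>+\<^sup>1\<close> span $L^R$, and
  \<open>H\<^sub>n\<^sub>,\<^sub>m\<close> is the closed span of the \<open>e\<^sub>k\<close> with \<open>k \<ge> n\<close> and the \<open>f\<^sub>l\<close> with \<open>l \<ge> m\<close>. The orthogonal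
  complement of \<open>H\<^sub>n\<^sub>+\<^sub>1\<^sub>,\<^sub>m\<^sub>+\<^sub>1\<close> in \<open>H\<^sub>n\<^sub>,\<^sub>m\<close> is two-dimensional, with the orthonormal bases
  \<open>K\<^sub>n\<^sub>,\<^sub>m, K~\<^sub>n\<^sub>+\<^sub>1\<^sub>,\<^sub>m\<close> and \<open>K~\<^sub>n\<^sub>,\<^sub>m, K\<^sub>n\<^sub>,\<^sub>m\<^sub>+\<^sub>1\<close>; the change of basis is the factor with \<open>\<alpha>\<^sub>n\<^sub>+\<^sub>m\<close> and
  \<open>\<rho>\<^sub>n\<^sub>+\<^sub>m\<close>. As multiplication by \<open>t\<close> maps \<open>H\<^sub>n\<^sub>,\<^sub>m\<close> onto \<open>H\<^sub>n\<^sub>+\<^sub>1\<^sub>,\<^sub>m\<^sub>-\<^sub>1\<close>, it takes \<open>K\<^sub>n\<^sub>,\<^sub>m\<close> to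
  \<open>K\<^sub>n\<^sub>+\<^sub>1\<^sub>,\<^sub>m\<^sub>-\<^sub>1\<close>, and the matrix is a product of such factors.

  That the \<open>H\<^sub>n\<^sub>,\<^sub>m\<close> decrease strictly and to zero is the analytic part. It rests on a function \<open>\<phi>\<close>
  of the Hardy space with \<open>|\<phi>|\<^sup>2 = 1 - |R|\<close> and \<open>\<phi>(0) \<noteq> 0\<close>: the vectors \<open>[cnj \<phi>; 0] t\<^sup>k\<close> and
  \<open>[0; \<phi>] cnj t\<^sup>k\<^sup>+\<^sup>1\<close> lie in $L^R$, are triangularly dual to the \<open>e\<^sub>n\<close> and \<open>f\<^sub>n\<close>, and are total.
  No boundary behaviour of analytic functions is needed to find \<open>\<phi>\<close>, since it comes from the
  extremal problem of Szego.\<close>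


section \<open>Semi-inner product spaces\<close>

text \<open>The obstacle is that the inverse weight is unbounded where |R| comes close to 1, so that
  even [t^k; 0] need not lie in L^R. The factor \<phi> repairs this. The choice |\<phi>|^2 = 1 - |R|
  is natural: the logarithm of the right side is integrable by assumption, and 1 - |R| \<le> 1 -
  |R|^2 bounds \<phi> / sqrt (1 - |R|^2) by 1. Pairing a dual vector with a generator cancels the
  weight and leaves a Fourier coefficient of \<phi>, so analyticity and \<phi>(0) \<noteq> 0 are
  exactly triangularity and a nonzero diagonal.

  Triangular duality suffices in place of biorthogonality: a dual vector annihilates all later
  generators, which keeps its own generator away from their closed span, and a vector in every
  subspace of the filtration is annihilated by all dual vectors.

  The existence of \<phi> reduces to a positive distance of sqrt w from the closed span of t sqrt w,
  t^2 sqrt w, ... This is only the lower bound in Szego's theorem, for polynomials, where Jensen's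
  inequality and a factorization into linear factors are enough.\<close>

text \<open>Vectors at distance zero are not identified, so that the elements can be functions that
  represent almost everywhere classes.\<close>

locale semi_hilbert = vector_space scale
  for scale :: "complex \<Rightarrow> 'v::ab_group_add \<Rightarrow> 'v" (infixr \<open>*h\<close> 75) +
  fixes V :: "'v set" and ip :: "'v \<Rightarrow> 'v \<Rightarrow> complex"
  assumes subspace_V: "subspace V"
    and ip_add_left: "\<lbrakk>x \<in> V; y \<in> V; z \<in> V\<rbrakk> \<Longrightarrow> ip (x + y) z = ip x z + ip y z"
    and ip_scale_left: "\<lbrakk>x \<in> V; y \<in> V\<rbrakk> \<Longrightarrow> ip (c *h x) y = c * ip x y"
    and ip_cnj: "\<lbrakk>x \<in> V; y \<in> V\<rbrakk> \<Longrightarrow> ip y x = cnj (ip x y)"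
    and ip_self_nonneg: "x \<in> V \<Longrightarrow> 0 \<le> Re (ip x x)"
    and complete_sqrt: "\<lbrakk>\<And>n::nat. X n \<in> V;
      \<And>\<epsilon>. \<epsilon> > 0 \<Longrightarrow> \<exists>N. \<forall>i\<ge>N. \<forall>j\<ge>N. sqrt (Re (ip (X i - X j) (X i - X j))) < \<epsilon>\<rbrakk>
      \<Longrightarrow> \<exists>x\<in>V. \<forall>\<epsilon>>0. \<exists>N. \<forall>i\<ge>N. sqrt (Re (ip (X i - x) (X i - x))) < \<epsilon>"
begin

definition nrm :: "'v \<Rightarrow> real" where
  "nrm x = sqrt (Re (ip x x))"

definition cl :: "'v set \<Rightarrow> 'v set" where
  "cl S = {x \<in> V. \<forall>\<epsilon>>0. \<exists>g\<in>S \<inter> V. nrm (x - g) < \<epsilon>}"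

lemma V_add [simp, intro]: "x \<in> V \<Longrightarrow> y \<in> V \<Longrightarrow> x + y \<in> V"
  using subspace_V subspace_add by blast

lemma V_scale [simp, intro]: "x \<in> V \<Longrightarrow> c *h x \<in> V"
  using subspace_V subspace_scale by blast

lemma V_diff [simp, intro]: "x \<in> V \<Longrightarrow> y \<in> V \<Longrightarrow> x - y \<in> V"
  using subspace_V subspace_diff by blast

lemma V_zero [simp, intro]: "0 \<in> V"
  using subspace_V subspace_0 by blast

lemma ip_diff_left: "\<lbrakk>x \<in> V; y \<in> V; z \<in> V\<rbrakk> \<Longrightarrow> ip (x - y) z = ip x z - ip y z"
  using ip_add_left[of "x - y" y z] by simp

lemma ip_add_right: "\<lbrakk>x \<in> V; y \<in> V; z \<in> V\<rbrakk> \<Longrightarrow> ip x (y + z) = ip x y + ip x z"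
  using ip_add_left[of y z x] by (simp add: ip_cnj[of _ x] complex_eq_iff)

lemma ip_diff_right: "\<lbrakk>x \<in> V; y \<in> V; z \<in> V\<rbrakk> \<Longrightarrow> ip x (y - z) = ip x y - ip x z"
  using ip_add_right[of x "y - z" z] by simp

lemma ip_scale_right: "\<lbrakk>x \<in> V; y \<in> V\<rbrakk> \<Longrightarrow> ip x (c *h y) = cnj c * ip x y"
  using ip_scale_left[of y x c] ip_cnj[of "c *h y" x] ip_cnj[of y x] by simp

lemma ip_zero_left [simp]: "x \<in> V \<Longrightarrow> ip 0 x = 0"
  using ip_diff_left[of x x x] by simp

lemma ip_zero_right [simp]: "x \<in> V \<Longrightarrow> ip x 0 = 0"
  using ip_diff_right[of x x x] by simp

lemmas ip_simps = ip_add_left ip_diff_left ip_scale_left ip_add_right ip_diff_right ip_scale_right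

lemma ip_eq_0_sym: "\<lbrakk>x \<in> V; y \<in> V; ip x y = 0\<rbrakk> \<Longrightarrow> ip y x = 0"
  using ip_cnj[of x y] by simp

lemma nrm_nonneg [simp]: "x \<in> V \<Longrightarrow> 0 \<le> nrm x"
  by (simp add: nrm_def ip_self_nonneg)

lemma nrm_sq: "x \<in> V \<Longrightarrow> (nrm x)\<^sup>2 = Re (ip x x)"
  by (simp add: nrm_def ip_self_nonneg)

lemma ip_self: "x \<in> V \<Longrightarrow> ip x x = of_real ((nrm x)\<^sup>2)"
  using ip_cnj[of x x] by (simp add: nrm_sq complex_eq_iff)

lemma nrm_zero [simp]: "nrm 0 = 0"
  by (simp add: nrm_def)

lemma nrm_scale: "x \<in> V \<Longrightarrow> nrm (c *h x) = norm c * nrm x"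
proof -
  assume x: "x \<in> V"
  have "ip (c *h x) (c *h x) = (c * cnj c) * ip x x"
    using x by (simp add: ip_simps)
  also have "\<dots> = of_real ((norm c)\<^sup>2 * (nrm x)\<^sup>2)"
    using x by (simp add: ip_self complex_norm_square[symmetric])
  finally have "(nrm (c *h x))\<^sup>2 = (norm c * nrm x)\<^sup>2"
    using x by (simp add: nrm_sq power_mult_distrib)
  then show ?thesis
    using x by (simp add: power2_eq_iff_nonneg)
qed

lemma nrm_minus_commute: "\<lbrakk>x \<in> V; y \<in> V\<rbrakk> \<Longrightarrow> nrm (x - y) = nrm (y - x)"
  by (simp add: nrm_def ip_simps algebra_simps)

lemma Re_ip_commute: "\<lbrakk>x \<in> V; y \<in> V\<rbrakk> \<Longrightarrow> Re (ip y x) = Re (ip x y)"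
  using ip_cnj[of x y] by simp

lemma nrm_sq_add: "\<lbrakk>x \<in> V; y \<in> V\<rbrakk> \<Longrightarrow> (nrm (x + y))\<^sup>2 = (nrm x)\<^sup>2 + 2 * Re (ip x y) + (nrm y)\<^sup>2"
  using Re_ip_commute[of x y] by (simp add: nrm_sq ip_simps)

lemma nrm_sq_diff: "\<lbrakk>x \<in> V; y \<in> V\<rbrakk> \<Longrightarrow> (nrm (x - y))\<^sup>2 = (nrm x)\<^sup>2 - 2 * Re (ip x y) + (nrm y)\<^sup>2"
  using Re_ip_commute[of x y] by (simp add: nrm_sq ip_simps)

text \<open>Cauchy-Schwarz for the real part, from expanding the squared norm of a combination of
  \<open>x\<close> and \<open>y\<close>. A vector of norm zero need not be \<open>0\<close>, so the
  degenerate case has its own argument.\<close>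

lemma Re_ip_le:
  assumes x: "x \<in> V" and y: "y \<in> V"
  shows "Re (ip x y) \<le> nrm x * nrm y"
proof -
  have *: "2 * (s * t * Re (ip x y)) \<le> s\<^sup>2 * (nrm x)\<^sup>2 + t\<^sup>2 * (nrm y)\<^sup>2" for s t :: real
  proof -
    have "0 \<le> (nrm (of_real s *h x - of_real t *h y))\<^sup>2" by simp
    also have "\<dots> = s\<^sup>2 * (nrm x)\<^sup>2 - 2 * (s * t * Re (ip x y)) + t\<^sup>2 * (nrm y)\<^sup>2"
      using x y by (simp add: nrm_sq_diff ip_simps nrm_scale power_mult_distrib)
    finally show ?thesis by simp
  qed
  show ?thesis
  proof (cases "nrm x = 0 \<or> nrm y = 0")
    case False
    then have pos: "nrm x * nrm y > 0" using x y by (simp add: less_le)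
    have "(nrm x * nrm y) * Re (ip x y) \<le> (nrm x * nrm y) * (nrm x * nrm y)"
      using *[of "nrm y" "nrm x"] by (simp add: power2_eq_square algebra_simps)
    then show ?thesis using pos by (rule mult_left_le_imp_le)
  next
    case True
    show ?thesis
    proof (rule ccontr)
      assume "\<not> ?thesis"
      then have a: "Re (ip x y) > 0" using True by auto
      \<comment> \<open>When one norm vanishes, its coefficient is free in the estimate;
        \<open>r\<close> is large enough for the left side to exceed the squared norm that
        remains.\<close>
      define r where "r = ((nrm x)\<^sup>2 + (nrm y)\<^sup>2 + 1) / Re (ip x y)"
      have r: "r * Re (ip x y) = (nrm x)\<^sup>2 + (nrm y)\<^sup>2 + 1" using a by (simp add: r_def)
      have nn: "0 \<le> (nrm x)\<^sup>2" "0 \<le> (nrm y)\<^sup>2" by auto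
      from True consider "nrm x = 0" | "nrm y = 0" by blast
      then show False
        using *[of r 1] *[of 1 r] r nn by cases auto
    qed
  qed
qed

lemma norm_ip_le:
  assumes x: "x \<in> V" and y: "y \<in> V"
  shows "norm (ip x y) \<le> nrm x * nrm y"
proof (cases "ip x y = 0")
  case False
  \<comment> \<open>The phase that turns \<open>ip x y\<close> into its modulus, so that the bound
    on the real part applies.\<close>
  define c where "c = cnj (ip x y) / norm (ip x y)"
  have c: "norm c = 1" using False by (simp add: c_def norm_divide)
  have "c * ip x y = of_real (norm (ip x y))"
    using False complex_norm_square[of "ip x y"]
    by (simp add: c_def field_simps power2_eq_square)
  then have "norm (ip x y) = Re (ip (c *h x) y)"
    using x y by (simp add: ip_simps)
  also have "\<dots> \<le> nrm (c *h x) * nrm y" using x y by (intro Re_ip_le) auto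
  finally show ?thesis using x c by (simp add: nrm_scale)
qed (use x y in auto)

lemma nrm_triangle:
  assumes "x \<in> V" "y \<in> V"
  shows "nrm (x + y) \<le> nrm x + nrm y"
proof (rule power2_le_imp_le)
  show "(nrm (x + y))\<^sup>2 \<le> (nrm x + nrm y)\<^sup>2"
    using Re_ip_le[of x y] assms by (simp add: nrm_sq_add power2_sum)
qed (use assms in simp)

lemma nrm_triangle_diff: "\<lbrakk>x \<in> V; y \<in> V; z \<in> V\<rbrakk> \<Longrightarrow> nrm (x - z) \<le> nrm (x - y) + nrm (y - z)"
  using nrm_triangle[of "x - y" "y - z"] by simp

lemma ip_null_left: "\<lbrakk>x \<in> V; y \<in> V; nrm x = 0\<rbrakk> \<Longrightarrow> ip x y = 0"
  using norm_ip_le[of x y] by simp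

lemma complete:
  assumes "\<And>n::nat. X n \<in> V" "\<And>\<epsilon>. \<epsilon> > 0 \<Longrightarrow> \<exists>N. \<forall>i\<ge>N. \<forall>j\<ge>N. nrm (X i - X j) < \<epsilon>"
  obtains x where "x \<in> V" "\<And>\<epsilon>. \<epsilon> > 0 \<Longrightarrow> \<exists>N. \<forall>i\<ge>N. nrm (X i - x) < \<epsilon>"
  using complete_sqrt[of X] assms unfolding nrm_def by blast

section \<open>Closures and closed spans\<close>

lemma cl_V: "x \<in> cl S \<Longrightarrow> x \<in> V"
  by (simp add: cl_def)

lemma cl_obtain:
  assumes "x \<in> cl S" "\<epsilon> > 0"
  obtains g where "g \<in> S" "g \<in> V" "nrm (x - g) < \<epsilon>"
  using assms by (auto simp: cl_def)

lemma clI: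
  assumes "x \<in> V" "\<And>\<epsilon>. \<epsilon> > 0 \<Longrightarrow> \<exists>g. g \<in> S \<and> g \<in> V \<and> nrm (x - g) < \<epsilon>"
  shows "x \<in> cl S"
  using assms by (fastforce simp: cl_def)

lemma cl_subset: "S \<subseteq> V \<Longrightarrow> S \<subseteq> cl S"
  by (rule subsetI, rule clI) (auto intro!: exI)

lemma cl_mono: "S \<subseteq> T \<Longrightarrow> cl S \<subseteq> cl T"
  by (fastforce simp: cl_def)

lemma cl_cl: "cl (cl S) \<subseteq> cl S"
proof
  fix x assume x: "x \<in> cl (cl S)"
  show "x \<in> cl S"
  proof (rule clI)
    show "x \<in> V" using x by (rule cl_V)
    fix \<epsilon> :: real assume e: "\<epsilon> > 0"
    obtain g where g: "g \<in> cl S" "g \<in> V" "nrm (x - g) < \<epsilon>/2"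
      using cl_obtain[OF x, of "\<epsilon>/2"] e by auto
    obtain h where h: "h \<in> S" "h \<in> V" "nrm (g - h) < \<epsilon>/2"
      using cl_obtain[OF g(1), of "\<epsilon>/2"] e by auto
    show "\<exists>g. g \<in> S \<and> g \<in> V \<and> nrm (x - g) < \<epsilon>"
      using nrm_triangle_diff[of x g h] g h \<open>x \<in> V\<close> by (intro exI[of _ h]) auto
  qed
qed

lemma subspace_cl:
  assumes S: "subspace S"
  shows "subspace (cl S)"
proof (rule subspaceI)
  show "0 \<in> cl S"
    using subspace_0[OF S] by (intro clI) (auto intro!: exI[of _ 0])
next
  fix x y assume x: "x \<in> cl S" and y: "y \<in> cl S"
  note xy = cl_V[OF x] cl_V[OF y]
  show "x + y \<in> cl S"
  proof (rule clI)
    show "x + y \<in> V" using xy by auto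
    fix \<epsilon> :: real assume e: "\<epsilon> > 0"
    obtain g where g: "g \<in> S" "g \<in> V" "nrm (x - g) < \<epsilon>/2"
      using cl_obtain[OF x, of "\<epsilon>/2"] e by auto
    obtain h where h: "h \<in> S" "h \<in> V" "nrm (y - h) < \<epsilon>/2"
      using cl_obtain[OF y, of "\<epsilon>/2"] e by auto
    have "x + y - (g + h) = (x - g) + (y - h)" by simp
    then have "nrm (x + y - (g + h)) = nrm ((x - g) + (y - h))" by metis
    also have "\<dots> \<le> nrm (x - g) + nrm (y - h)"
      using g h xy by (intro nrm_triangle) auto
    also have "\<dots> < \<epsilon>" using g h by simp
    finally have "nrm (x + y - (g + h)) < \<epsilon>" .
    then show "\<exists>g. g \<in> S \<and> g \<in> V \<and> nrm (x + y - g) < \<epsilon>"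
      using g h subspace_add[OF S] by (intro exI[of _ "g + h"]) auto
  qed
next
  fix x c assume x: "x \<in> cl S"
  note xV = cl_V[OF x]
  show "c *h x \<in> cl S"
  proof (rule clI)
    show "c *h x \<in> V" using xV by auto
    fix \<epsilon> :: real assume e: "\<epsilon> > 0"
    then have "\<epsilon> / (norm c + 1) > 0" by (simp add: add_nonneg_pos)
    then obtain g where g: "g \<in> S" "g \<in> V" "nrm (x - g) < \<epsilon> / (norm c + 1)"
      using cl_obtain[OF x] by metis
    have "nrm (c *h x - c *h g) = norm c * nrm (x - g)"
      using nrm_scale[of "x - g" c] xV g by (simp add: scale_right_diff_distrib)
    also have "\<dots> \<le> (norm c + 1) * nrm (x - g)"
      using xV g by (intro mult_right_mono) auto
    also have "\<dots> < \<epsilon>"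
      using g(3) by (simp add: pos_less_divide_eq add_nonneg_pos mult.commute)
    finally show "\<exists>g. g \<in> S \<and> g \<in> V \<and> nrm (c *h x - g) < \<epsilon>"
      using g subspace_scale[OF S] by (intro exI[of _ "c *h g"]) auto
  qed
qed

text \<open>Closures are saturated under null differences. This replaces the identification of
  almost everywhere equal functions: a vector may be exchanged for another representative.\<close>

lemma cl_add_null:
  assumes x: "x \<in> cl S" and y: "y \<in> V" "nrm (y - x) = 0"
  shows "y \<in> cl S"
proof (rule clI)
  fix \<epsilon> :: real assume "\<epsilon> > 0"
  then obtain g where g: "g \<in> S" "g \<in> V" "nrm (x - g) < \<epsilon>"
    using cl_obtain[OF x] by metis
  then show "\<exists>g. g \<in> S \<and> g \<in> V \<and> nrm (y - g) < \<epsilon>"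
    using nrm_triangle_diff[of y x g] cl_V[OF x] y by (intro exI[of _ g]) auto
qed (use y in auto)

lemma span_subset_V: "S \<subseteq> V \<Longrightarrow> span S \<subseteq> V"
  using subspace_V span_minimal by blast

lemma span_subset_cl: "S \<subseteq> V \<Longrightarrow> span S \<subseteq> cl (span S)"
  using cl_subset span_subset_V by blast

lemma subset_cl_span: "S \<subseteq> V \<Longrightarrow> S \<subseteq> cl (span S)"
  using span_subset_cl span_superset by blast

lemma subspace_cl_span [simp]: "subspace (cl (span S))"
  by (intro subspace_cl subspace_span)

lemma cl_span_subset: "\<lbrakk>S \<subseteq> cl (span T)\<rbrakk> \<Longrightarrow> cl (span S) \<subseteq> cl (span T)"
  using cl_mono[of "span S" "cl (span T)"] cl_cl[of "span T"] span_minimal[of S "cl (span T)"] by auto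

lemma cl_span_mono: "S \<subseteq> T \<Longrightarrow> cl (span S) \<subseteq> cl (span T)"
  by (intro cl_mono span_mono)

lemma orthogonal_cl:
  assumes x: "x \<in> V" and S: "\<And>g. g \<in> S \<Longrightarrow> g \<in> V \<Longrightarrow> ip x g = 0" and g: "g \<in> cl S"
  shows "ip x g = 0"
proof (rule ccontr)
  assume n: "ip x g \<noteq> 0"
  then have pos: "nrm x > 0"
    using ip_null_left[OF x cl_V[OF g]] nrm_nonneg[OF x] by linarith
  obtain h where h: "h \<in> S" "h \<in> V" "nrm (g - h) < norm (ip x g) / nrm x"
    using cl_obtain[OF g, of "norm (ip x g) / nrm x"] n pos by auto
  have "norm (ip x g) = norm (ip x (g - h))"
    using S h x cl_V[OF g] by (simp add: ip_simps)
  also have "\<dots> \<le> nrm x * nrm (g - h)"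
    using h x cl_V[OF g] by (intro norm_ip_le) auto
  also have "\<dots> < norm (ip x g)"
    using h(3) pos by (simp add: field_simps)
  finally show False by simp
qed

lemma orthogonal_span:
  assumes x: "x \<in> V" and S: "S \<subseteq> V" "\<And>g. g \<in> S \<Longrightarrow> ip x g = 0" and g: "g \<in> span S"
  shows "ip x g = 0"
proof -
  have "subspace {g \<in> V. ip x g = 0}"
    using x by (intro subspaceI) (auto simp: ip_simps)
  then have "span S \<subseteq> {g \<in> V. ip x g = 0}"
    using S by (intro span_minimal) auto
  then show ?thesis using g by auto
qed

lemma orthogonal_cl_span:
  assumes "x \<in> V" "S \<subseteq> V" "\<And>g. g \<in> S \<Longrightarrow> ip x g = 0" "g \<in> cl (span S)"
  shows "ip x g = 0"
  using orthogonal_cl[of x "span S" g] orthogonal_span[of x S] assms by blast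

section \<open>Orthogonal projection\<close>

lemma minimal_orthogonal:
  assumes y: "y \<in> V" and g: "g \<in> V" and min: "\<And>c. nrm y \<le> nrm (y - c *h g)"
  shows "ip y g = 0"
proof (rule ccontr)
  assume n: "ip y g \<noteq> 0"
  define a where "a = (norm (ip y g))\<^sup>2"
  have a: "a > 0" using n by (simp add: a_def)
  define G where "G = (nrm g)\<^sup>2"
  have G: "G \<ge> 0" by (simp add: G_def)
  \<comment> \<open>A small step along \<open>ip y g\<close> would shorten \<open>y\<close>: the
    squared norm changes by \<open>- 2 * (s * a) + s * a * (s * G)\<close>. The \<open>+ 1\<close>
    gives \<open>s * G < 1\<close> without a case distinction on \<open>G = 0\<close>.\<close>
  define s where "s = 1 / (G + 1)"
  define c where "c = of_real s * ip y g"
  have s: "s > 0" "s * G < 1" using G by (auto simp: s_def)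
  have 1: "Re (ip y (c *h g)) = s * a"
    using y g unfolding a_def cmod_power2
    by (simp add: ip_simps c_def power2_eq_square algebra_simps)
  have 2: "(nrm (c *h g))\<^sup>2 = s * a * (s * G)"
    using g by (simp add: nrm_scale c_def norm_mult a_def G_def power_mult_distrib power2_eq_square)
  have "(nrm y)\<^sup>2 \<le> (nrm (y - c *h g))\<^sup>2"
    using min[of c] y by (intro power_mono) auto
  also have "\<dots> = (nrm y)\<^sup>2 - 2 * (s * a) + s * a * (s * G)"
    using y g by (simp add: nrm_sq_diff 1 2)
  finally have "2 * (s * a) \<le> s * a * (s * G)" by simp
  also have "\<dots> < s * a * 1" using a s by (intro mult_strict_left_mono) auto
  finally show False using mult_pos_pos[OF s(1) a] by linarith
qed

text \<open>\<open>S\<close> need not be closed: a minimizing sequence in \<open>S\<close> converges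
  by completeness to a point of \<open>cl S\<close>, whose minimality extends to all competitors in
  \<open>cl S\<close>.\<close>

theorem projection:
  assumes S: "subspace S" "S \<subseteq> V" and x: "x \<in> V"
  obtains p where "p \<in> cl S" "\<And>g. g \<in> cl S \<Longrightarrow> ip (x - p) g = 0"
proof -
  define D where "D = (\<lambda>g. (nrm (x - g))\<^sup>2) ` S"
  have Dne: "D \<noteq> {}" using subspace_0[OF S(1)] by (auto simp: D_def)
  have bdd: "bdd_below D" by (auto simp: D_def intro!: bdd_belowI[of _ 0])
  define d where "d = Inf D"
  have d_le: "d \<le> (nrm (x - g))\<^sup>2" if "g \<in> S" for g
    using that bdd by (auto simp: d_def D_def intro!: cInf_lower)
  have d_nn: "d \<ge> 0" unfolding d_def using Dne by (intro cInf_greatest) (auto simp: D_def)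
  have "\<exists>g\<in>S. (nrm (x - g))\<^sup>2 < d + 1 / (real n + 1)" for n :: nat
  proof -
    have "Inf D < d + 1 / (real n + 1)" by (simp add: d_def)
    then show ?thesis using cInf_lessD[OF Dne] by (auto simp: D_def)
  qed
  then obtain X where X: "\<And>n. X n \<in> S" "\<And>n::nat. (nrm (x - X n))\<^sup>2 < d + 1 / (real n + 1)"
    by metis
  have XV: "X n \<in> V" for n using X S by auto
  \<comment> \<open>Parallelogram law for \<open>x - X i\<close> and \<open>x - X j\<close>: the
    midpoint \<open>m\<close> lies in \<open>S\<close> and is no closer to \<open>x\<close> than
    \<open>sqrt d\<close>, so nearly minimal points are close to each other.\<close>
  have par: "(nrm (X i - X j))\<^sup>2 \<le> 2 / (real i + 1) + 2 / (real j + 1)" for i j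
  proof -
    define m where "m = (1/2) *h (X i + X j)"
    have m: "m \<in> S" unfolding m_def using X S by (intro subspace_scale subspace_add) auto
    define a b where "a = x - X i" and "b = x - X j"
    have ab: "a \<in> V" "b \<in> V" using x XV by (auto simp: a_def b_def)
    have 1: "(nrm (a + b))\<^sup>2 + (nrm (a - b))\<^sup>2 = 2 * (nrm a)\<^sup>2 + 2 * (nrm b)\<^sup>2"
      using ab by (simp add: nrm_sq_add nrm_sq_diff)
    have "2 *h (x - m) = a + b"
    proof -
      have "2 *h x = x + x"
        using scale_left_distrib[of 1 1 x] by simp
      moreover have "2 *h m = X i + X j" by (simp add: m_def)
      ultimately show ?thesis
        by (simp add: scale_right_diff_distrib a_def b_def)
    qed
    then have 2: "nrm (a + b) = 2 * nrm (x - m)"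
      using nrm_scale[of "x - m" 2] x m S by auto
    have "a - b = X j - X i" by (simp add: a_def b_def)
    then have 3: "nrm (a - b) = nrm (X i - X j)" using XV nrm_minus_commute by auto
    have "4 * (nrm (x - m))\<^sup>2 + (nrm (X i - X j))\<^sup>2 = 2 * (nrm a)\<^sup>2 + 2 * (nrm b)\<^sup>2"
      using 1 unfolding 2 3 by (simp add: power_mult_distrib)
    then show ?thesis using X(2)[of i] X(2)[of j] d_le[OF m] by (simp add: a_def b_def)
  qed
  have cau: "\<exists>N. \<forall>i\<ge>N. \<forall>j\<ge>N. nrm (X i - X j) < \<epsilon>" if e: "\<epsilon> > 0" for \<epsilon> :: real
  proof -
    obtain N :: nat where N: "4 / \<epsilon>\<^sup>2 < real N" using reals_Archimedean2 by blast
    have "0 < 4 / \<epsilon>\<^sup>2" using e by simp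
    then have Np: "real N > 0" using N by linarith
    have "nrm (X i - X j) < \<epsilon>" if "i \<ge> N" "j \<ge> N" for i j
    proof -
      have "2 / (real i + 1) \<le> 2 / (real N + 1)" "2 / (real j + 1) \<le> 2 / (real N + 1)"
        using that by (auto intro!: divide_left_mono)
      then have "(nrm (X i - X j))\<^sup>2 \<le> 4 / (real N + 1)" using par[of i j] by simp
      also have "\<dots> < 4 / real N" using Np by (simp add: field_simps)
      also have "\<dots> < \<epsilon>\<^sup>2" using N e Np by (simp add: field_simps)
      finally show ?thesis using e by (simp add: power_less_imp_less_base)
    qed
    then show ?thesis by blast
  qed
  obtain p where p: "p \<in> V" "\<And>\<epsilon>. \<epsilon> > 0 \<Longrightarrow> \<exists>N. \<forall>i\<ge>N. nrm (X i - p) < \<epsilon>"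
    using complete[of X] XV cau by blast
  have p_cl: "p \<in> cl S"
  proof (rule clI)
    fix \<epsilon> :: real assume "\<epsilon> > 0"
    then obtain N where "nrm (X N - p) < \<epsilon>" using p(2) by blast
    then show "\<exists>g. g \<in> S \<and> g \<in> V \<and> nrm (p - g) < \<epsilon>"
      using X(1) XV p(1) nrm_minus_commute by (intro exI[of _ "X N"]) auto
  qed (rule p(1))
  have up: "(nrm (x - p))\<^sup>2 \<le> d"
  proof -
    have "nrm (x - p) \<le> sqrt d + \<epsilon>" if e: "\<epsilon> > 0" for \<epsilon>
    proof -
      obtain N where N: "\<And>i. i \<ge> N \<Longrightarrow> nrm (X i - p) < \<epsilon>/2" using p(2)[of "\<epsilon>/2"] e by auto
      obtain M :: nat where M: "4 / \<epsilon>\<^sup>2 < real M" using reals_Archimedean2 by blast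
      define i where "i = max N M"
      have "4 / \<epsilon>\<^sup>2 < real i + 1" using M by (simp add: i_def)
      then have "1 / (real i + 1) < \<epsilon>\<^sup>2 / 4" using e by (simp add: field_simps)
      then have "(nrm (x - X i))\<^sup>2 < d + (\<epsilon>/2)\<^sup>2" using X(2)[of i] by (simp add: power_divide)
      also have "\<dots> \<le> (sqrt d + \<epsilon>/2)\<^sup>2" using d_nn e by (simp add: power2_sum)
      finally have "nrm (x - X i) < sqrt d + \<epsilon>/2"
        by (rule power_less_imp_less_base) (use d_nn e in simp)
      moreover have "nrm (X i - p) < \<epsilon>/2" using N by (simp add: i_def)
      moreover have "nrm (x - p) \<le> nrm (x - X i) + nrm (X i - p)"
        using x XV p(1) by (intro nrm_triangle_diff)
      ultimately show ?thesis by linarith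
    qed
    then have "nrm (x - p) \<le> sqrt d" by (rule field_le_epsilon)
    then have "(nrm (x - p))\<^sup>2 \<le> (sqrt d)\<^sup>2" using x p(1) by (intro power_mono) auto
    then show ?thesis using d_nn by simp
  qed
  \<comment> \<open>The perturbations \<open>p + c *h g\<close> used for orthogonality stay in
    \<open>cl S\<close> but not in \<open>S\<close>, so minimality is needed there.\<close>
  have low: "d \<le> (nrm (x - q))\<^sup>2" if q: "q \<in> cl S" for q
  proof -
    have qV: "q \<in> V" using q by (rule cl_V)
    have "sqrt d \<le> nrm (x - q) + \<epsilon>" if "\<epsilon> > 0" for \<epsilon>
    proof -
      obtain g where g: "g \<in> S" "g \<in> V" "nrm (q - g) < \<epsilon>" using cl_obtain[OF q \<open>\<epsilon> > 0\<close>] by metis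
      have "sqrt d \<le> nrm (x - g)" using d_le[OF g(1)] x g by (simp add: real_le_lsqrt)
      then show ?thesis using nrm_triangle_diff[of x q g] x qV g by simp
    qed
    then have "sqrt d \<le> nrm (x - q)" by (rule field_le_epsilon)
    then show ?thesis by (rule sqrt_le_D)
  qed
  have orth: "ip (x - p) g = 0" if g: "g \<in> cl S" for g
  proof (rule minimal_orthogonal)
    fix c
    have "p + c *h g \<in> cl S"
      using subspace_cl[OF S(1)] g p_cl by (intro subspace_add subspace_scale) auto
    then have "(nrm (x - p))\<^sup>2 \<le> (nrm (x - (p + c *h g)))\<^sup>2" using up low by (meson order_trans)
    moreover have "x - (p + c *h g) = x - p - c *h g" by simp
    ultimately have "(nrm (x - p))\<^sup>2 \<le> (nrm (x - p - c *h g))\<^sup>2" by simp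
    then show "nrm (x - p) \<le> nrm (x - p - c *h g)"
      by (rule power2_le_imp_le) (use x p(1) cl_V[OF g] in auto)
  qed (use x p(1) cl_V[OF g] in auto)
  show ?thesis using that p_cl orth by blast
qed

lemma cl_span_eq_V:
  assumes S: "S \<subseteq> V" and tot: "\<And>y. y \<in> V \<Longrightarrow> (\<And>g. g \<in> S \<Longrightarrow> ip y g = 0) \<Longrightarrow> nrm y = 0"
  shows "cl (span S) = V"
proof
  show "cl (span S) \<subseteq> V" using cl_V by blast
  show "V \<subseteq> cl (span S)"
  proof
    fix x assume x: "x \<in> V"
    obtain p where p: "p \<in> cl (span S)" "\<And>g. g \<in> cl (span S) \<Longrightarrow> ip (x - p) g = 0"
      using projection[of "span S" x] span_subset_V[OF S] x by auto
    then have "nrm (x - p) = 0"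
      using tot[of "x - p"] x cl_V subset_cl_span[OF S] by blast
    then show "x \<in> cl (span S)" using cl_add_null[OF p(1) x] by blast
  qed
qed

end

section \<open>Unit vectors orthogonal to a subspace of codimension one\<close>

context semi_hilbert
begin

text \<open>The common shape of both families of CMV vectors: \<open>e\<close> is the one generator
  by which the larger closed span exceeds the smaller, and the positivity condition fixes the
  phase.\<close>

definition unit_defect :: "'v \<Rightarrow> 'v set \<Rightarrow> 'v \<Rightarrow> bool" where
  "unit_defect e S k \<longleftrightarrow> k \<in> cl (span (insert e S)) \<and> (\<forall>g\<in>cl (span S). ip k g = 0) \<and>
     nrm k = 1 \<and> 0 < ip e k"

lemma complex_pos_iff: "0 < (z::complex) \<longleftrightarrow> Im z = 0 \<and> 0 < Re z"
  by (auto simp: less_complex_def)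

text \<open>\<open>v\<close> annihilates \<open>S\<close> but not \<open>e\<close>, so the residual
  of \<open>e\<close> over the closed span of \<open>S\<close> has positive norm; normalized, it is
  the required vector.\<close>

lemma unit_defect_ex:
  assumes S: "S \<subseteq> V" and e: "e \<in> V" and v: "v \<in> V"
    and vS: "\<And>s. s \<in> S \<Longrightarrow> ip s v = 0" and ve: "ip e v \<noteq> 0"
  shows "\<exists>k. unit_defect e S k"
proof -
  obtain q where q: "q \<in> cl (span S)" and orth: "\<And>g. g \<in> cl (span S) \<Longrightarrow> ip (e - q) g = 0"
    using projection[of "span S" e] span_subset_V[OF S] e by auto
  have qV: "q \<in> V" using q by (rule cl_V)
  define d where "d = e - q"
  have dV: "d \<in> V" using e qV by (simp add: d_def)
  have "ip v g = 0" if "g \<in> S" for g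
    using ip_eq_0_sym[of g v] vS[OF that] S v that by auto
  then have "ip v q = 0" using orthogonal_cl_span[OF v S] q by blast
  then have "ip d v = ip e v" using ip_eq_0_sym[OF v qV] e v qV by (simp add: d_def ip_simps)
  then have "nrm d \<noteq> 0" using ip_null_left[OF dV v] ve by auto
  then have pos: "nrm d > 0" using nrm_nonneg[OF dV] by linarith
  have d_cl: "d \<in> cl (span (insert e S))"
  proof -
    have "q \<in> cl (span (insert e S))" using q cl_span_mono[of S "insert e S"] by auto
    moreover have "e \<in> cl (span (insert e S))" using subset_cl_span[of "insert e S"] S e by auto
    ultimately show ?thesis unfolding d_def by (intro subspace_diff) auto
  qed
  define k where "k = of_real (1 / nrm d) *h d"
  \<comment> \<open>The residual is orthogonal to \<open>q\<close>, so \<open>ip e d\<close> is a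
    squared norm; this gives the positivity of \<open>ip e k\<close>.\<close>
  have "ip e d = ip d d" using orth[OF q] ip_eq_0_sym[OF dV qV] e qV dV
    by (metis d_def diff_0_right ip_diff_left ip_diff_right orth q)
  then have "ip e k = of_real (nrm d)"
    using e dV pos ip_self[OF dV] by (simp add: k_def ip_simps power2_eq_square)
  moreover have "k \<in> cl (span (insert e S))"
    unfolding k_def using d_cl by (intro subspace_scale) auto
  moreover have "ip k g = 0" if "g \<in> cl (span S)" for g
    using orth[OF that] cl_V[OF that] dV by (simp add: k_def ip_simps d_def[symmetric])
  moreover have "nrm k = 1" using dV pos by (simp add: k_def nrm_scale norm_divide)
  ultimately show ?thesis
    using pos by (intro exI[of _ k]) (auto simp: unit_defect_def complex_pos_iff)
qed

context
  fixes e S k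
  assumes S: "S \<subseteq> V" and e: "e \<in> V" and k: "unit_defect e S k"
begin

lemma unit_defect_V: "k \<in> V"
  using k cl_V by (auto simp: unit_defect_def)

lemma unit_defect_ip_self: "ip k k = 1"
  using k ip_self[OF unit_defect_V] by (simp add: unit_defect_def)

lemma defect_null:
  assumes y: "y \<in> cl (span (insert e S))" and orth: "\<And>g. g \<in> S \<Longrightarrow> ip y g = 0" and ye: "ip y e = 0"
  shows "nrm y = 0"
proof -
  have yV: "y \<in> V" using y by (rule cl_V)
  have "ip y y = 0"
    using orthogonal_cl_span[OF yV, of "insert e S" y] S e y orth ye by auto
  then show ?thesis using ip_self[OF yV] by simp
qed

text \<open>Codimension one: subtracting the multiple of \<open>k\<close> that cancels the pairing
  with \<open>e\<close> leaves a vector orthogonal to everything that spans it.\<close>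

lemma defect_multiple:
  assumes y: "y \<in> cl (span (insert e S))" and orth: "\<And>g. g \<in> S \<Longrightarrow> ip y g = 0"
  shows "nrm (y - (ip y e / ip k e) *h k) = 0"
proof (rule defect_null)
  note kV = unit_defect_V
  have yV: "y \<in> V" using y by (rule cl_V)
  have ke: "ip k e \<noteq> 0"
    using k ip_cnj[OF e kV] by (auto simp: unit_defect_def complex_pos_iff)
  show "y - (ip y e / ip k e) *h k \<in> cl (span (insert e S))"
    using k y by (intro subspace_diff subspace_scale) (auto simp: unit_defect_def)
  show "ip (y - (ip y e / ip k e) *h k) g = 0" if g: "g \<in> S" for g
  proof -
    have "g \<in> cl (span S)" using g subset_cl_span[OF S] by auto
    then have "ip k g = 0" using k by (auto simp: unit_defect_def)
    then show ?thesis using orth[OF g] g S yV kV by (simp add: ip_simps subsetD)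
  qed
  show "ip (y - (ip y e / ip k e) *h k) e = 0"
    using yV kV e ke by (simp add: ip_simps)
qed

text \<open>Up to a null vector \<open>k'\<close> is a multiple of \<open>k\<close>. The factor is a
  quotient of positive numbers and has modulus one, hence is 1.\<close>

lemma defect_unique:
  assumes k': "unit_defect e S k'"
  shows "nrm (k' - k) = 0"
proof -
  define c where "c = ip k' e / ip k e"
  note kV = unit_defect_V
  have k'V: "k' \<in> V" using k' cl_V by (auto simp: unit_defect_def)
  have "ip k' g = 0" if "g \<in> S" for g
    using k' that subset_cl_span[OF S] by (auto simp: unit_defect_def)
  then have n: "nrm (k' - c *h k) = 0"
    using defect_multiple[of k'] k' by (auto simp: unit_defect_def c_def)
  have pos: "0 < ip k' e" "0 < ip k e"
    using k k' ip_cnj[OF e kV] ip_cnj[OF e k'V] by (auto simp: unit_defect_def complex_pos_iff)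
  define r where "r = Re (ip k' e) / Re (ip k e)"
  have "ip k' e = of_real (Re (ip k' e))" "ip k e = of_real (Re (ip k e))"
    using pos by (auto simp: complex_pos_iff complex_eq_iff)
  then have "c = of_real r" unfolding c_def r_def by (metis of_real_divide)
  moreover have "r > 0" using pos by (simp add: r_def complex_pos_iff)
  ultimately have c: "c = of_real r" "r > 0" .
  have "nrm k' \<le> norm c * nrm k" "norm c * nrm k \<le> nrm k'"
    using nrm_triangle_diff[of k' "c *h k" 0] nrm_triangle_diff[of "c *h k" k' 0]
      nrm_minus_commute[of k' "c *h k"] n kV k'V by (auto simp: nrm_scale)
  then have "norm c = 1" using k k' by (simp add: unit_defect_def)
  then have "c = 1" using c by simp
  then show ?thesis using n by simp
qed

text \<open>Projecting \<open>x\<close> onto the closed span of \<open>S\<close> leaves a multiple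
  of \<open>k\<close>, and pairing with \<open>k\<close>, which is orthogonal to the projection,
  determines the factor.\<close>

lemma defect_remainder:
  assumes x: "x \<in> cl (span (insert e S))"
  shows "x - ip x k *h k \<in> cl (span S)"
proof -
  note kV = unit_defect_V
  have xV: "x \<in> V" using x by (rule cl_V)
  obtain p where p: "p \<in> cl (span S)" and orth: "\<And>g. g \<in> cl (span S) \<Longrightarrow> ip (x - p) g = 0"
    using projection[of "span S" x] span_subset_V[OF S] xV by auto
  have pV: "p \<in> V" using p by (rule cl_V)
  have kS: "ip k g = 0" if "g \<in> cl (span S)" for g
    using k that by (auto simp: unit_defect_def)
  define y where "y = x - p - ip x k *h k"
  have yV: "y \<in> V" using xV pV kV by (simp add: y_def)
  have ys: "y \<in> cl (span (insert e S))"
    unfolding y_def using x k p cl_span_mono[of S "insert e S"]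
    by (intro subspace_diff subspace_scale) (auto simp: unit_defect_def)
  have "ip y g = 0" if "g \<in> S" for g
  proof -
    have "g \<in> cl (span S)" "g \<in> V" using that S subset_cl_span[OF S] by auto
    then show ?thesis using orth[of g] kS[of g] xV pV kV
      by (simp add: y_def ip_diff_left[of "x - p"] ip_scale_left)
  qed
  then have n: "nrm (y - (ip y e / ip k e) *h k) = 0" using ys by (intro defect_multiple)
  have "ip y k = 0"
    using ip_eq_0_sym[OF kV pV kS[OF p]] xV pV kV unit_defect_ip_self by (simp add: y_def ip_simps)
  moreover have "ip (y - (ip y e / ip k e) *h k) k = 0"
    using n yV kV by (intro ip_null_left) auto
  ultimately have "ip y e / ip k e = 0"
    using yV kV unit_defect_ip_self by (simp add: ip_diff_left ip_scale_left)
  then have "nrm y = 0" using n by (simp only: scale_zero_left diff_0_right)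
  moreover have "x - ip x k *h k - p = y" by (simp add: y_def algebra_simps)
  ultimately show ?thesis using cl_add_null[OF p] xV kV by auto
qed

end

text \<open>Both pairs \<open>b, c\<close> and \<open>a, c'\<close> span the two-dimensional complement of \<open>S\<close> in the span of
  \<open>S, e, f\<close>, where \<open>c'\<close> is the unit vector for \<open>e\<close> over \<open>S\<close>; exchanging \<open>e\<close> and \<open>f\<close> gives the
  expansion of \<open>b\<close>.\<close>

lemma defect_exchange:
  assumes S: "S \<subseteq> V" and e: "e \<in> V" and f: "f \<in> V"
    and a: "unit_defect f (insert e S) a" and b: "unit_defect e (insert f S) b"
    and c: "unit_defect f S c"
  shows "norm (ip a b) < 1"
    and "nrm (a - (ip a b *h b + of_real (sqrt (1 - (norm (ip a b))\<^sup>2)) *h c)) = 0"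
proof -
  have eS: "insert e S \<subseteq> V" and fS: "insert f S \<subseteq> V" using S e f by auto
  note aV = unit_defect_V[OF eS f a] and bV = unit_defect_V[OF fS e b] and cV = unit_defect_V[OF S f c]
  have aa: "ip a a = 1" by (rule unit_defect_ip_self[OF eS f a])
  have bb: "ip b b = 1" by (rule unit_defect_ip_self[OF fS e b])
  have cc: "ip c c = 1" by (rule unit_defect_ip_self[OF S f c])
  have c_mem: "c \<in> cl (span (insert f S))" using c by (simp add: unit_defect_def)
  have bc: "ip b c = 0" using b c_mem by (auto simp: unit_defect_def)
  have cb: "ip c b = 0" by (rule ip_eq_0_sym[OF bV cV bc])
  define y where "y = a - ip a b *h b"
  have yV: "y \<in> V" using aV bV by (simp add: y_def)
  have "a \<in> cl (span (insert e (insert f S)))"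
    using a by (simp add: unit_defect_def insert_commute)
  then have y: "y \<in> cl (span (insert f S))"
    unfolding y_def by (rule defect_remainder[OF fS e b])
  define z where "z = y - ip y c *h c"
  have z: "z \<in> cl (span S)" unfolding z_def by (rule defect_remainder[OF S f c y])
  have zV: "z \<in> V" using z by (rule cl_V)
  have az: "ip a z = 0" using a z cl_span_mono[of S "insert e S"] by (auto simp: unit_defect_def)
  have bz: "ip b z = 0" using b z cl_span_mono[of S "insert f S"] by (auto simp: unit_defect_def)
  have cz: "ip c z = 0" using c z by (auto simp: unit_defect_def)
  \<comment> \<open>\<open>z\<close> lies in the closed span of \<open>S\<close>, to which
    \<open>a\<close>, \<open>b\<close> and \<open>c\<close> are orthogonal, but it is also a
    combination of them; so it is orthogonal to itself.\<close>
  have "ip z z = 0"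
    using az bz cz aV bV cV zV yV by (subst z_def) (simp add: ip_diff_left ip_scale_left y_def)
  then have nz: "nrm z = 0" using ip_self[OF zV] by simp
  have yc: "ip y c = ip a c" using aV bV cV bc by (simp add: y_def ip_simps)
  \<comment> \<open>The coefficient \<open>ip a c\<close> is positive: \<open>a\<close> is
    orthogonal to the part of \<open>f\<close> in the closed span of \<open>S\<close>, so
    \<open>ip a f\<close> is \<open>ip a c\<close> times the positive number
    \<open>ip f c\<close>.\<close>
  have fc: "f - ip f c *h c \<in> cl (span S)"
    using defect_remainder[OF S f c] subset_cl_span[OF fS] by auto
  then have "f - ip f c *h c \<in> cl (span (insert e S))" using cl_span_mono[of S "insert e S"] by auto
  then have "ip a (f - ip f c *h c) = 0" using a by (auto simp: unit_defect_def)
  then have af: "ip a f = cnj (ip f c) * ip a c" using aV cV f by (simp add: ip_simps)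
  have pos: "0 < ip f c" "0 < ip a f"
    using a c ip_cnj[OF f aV] by (auto simp: unit_defect_def complex_pos_iff)
  define \<sigma> where "\<sigma> = Re (ip a c)"
  have \<sigma>: "ip a c = of_real \<sigma>" "\<sigma> > 0"
    using pos af unfolding \<sigma>_def complex_pos_iff
    by (auto simp: complex_eq_iff zero_less_mult_iff)
  have ca: "ip c a = of_real \<sigma>" using ip_cnj[OF aV cV] \<sigma> by simp
  \<comment> \<open>Pairing the expansion with \<open>a\<close> is Pythagoras, which identifies the
    positive coefficient \<open>\<sigma>\<close> with the square root in the claim.\<close>
  have "ip z a = 0" by (rule ip_eq_0_sym[OF aV zV az])
  moreover have "ip z a = 1 - ip a b * ip b a - of_real \<sigma> * of_real \<sigma>"
    using aV bV cV yV unfolding z_def yc by (simp add: y_def ip_diff_left ip_scale_left aa \<sigma> ca)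
  moreover have "ip a b * ip b a = of_real ((norm (ip a b))\<^sup>2)"
    using ip_cnj[OF aV bV] complex_norm_square[of "ip a b"] by simp
  ultimately have "of_real ((norm (ip a b))\<^sup>2 + \<sigma>\<^sup>2) = (1::complex)"
    by (simp add: power2_eq_square algebra_simps)
  then have n: "(norm (ip a b))\<^sup>2 + \<sigma>\<^sup>2 = 1" by (metis of_real_eq_1_iff)
  have "0 < \<sigma>\<^sup>2" using \<sigma>(2) by simp
  then have "(norm (ip a b))\<^sup>2 < 1\<^sup>2" using n unfolding one_power2 by linarith
  then show "norm (ip a b) < 1" by (rule power_less_imp_less_base) simp
  have "sqrt (1 - (norm (ip a b))\<^sup>2) = \<sigma>" using n \<sigma>(2) by (intro real_sqrt_unique) auto
  then have "a - (ip a b *h b + of_real (sqrt (1 - (norm (ip a b))\<^sup>2)) *h c) = z"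
    by (simp only: z_def yc \<sigma>(1)) (simp add: y_def diff_diff_eq)
  then show "nrm (a - (ip a b *h b + of_real (sqrt (1 - (norm (ip a b))\<^sup>2)) *h c)) = 0"
    using nz by simp
qed

end

section \<open>The CMV structure in an abstract Hilbert space\<close>

text \<open>The vectors \<open>v\<close> and \<open>w\<close> are triangularly dual to \<open>e\<close> and \<open>f\<close>: this makes every step of the
  filtration \<open>H\<close> a proper one, and, with totality, makes its intersection trivial.\<close>

locale cmv_system = semi_hilbert scale V ip
  for scale :: "complex \<Rightarrow> 'v::ab_group_add \<Rightarrow> 'v" (infixr \<open>*h\<close> 75) and V ip +
  fixes e f v w :: "int \<Rightarrow> 'v" and U :: "'v \<Rightarrow> 'v"
  assumes e_V [simp]: "e n \<in> V" and f_V [simp]: "f n \<in> V"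
    and v_V [simp]: "v n \<in> V" and w_V [simp]: "w n \<in> V"
    and e_v: "l > n \<Longrightarrow> ip (e l) (v n) = 0" and e_v_ne: "ip (e n) (v n) \<noteq> 0"
    and f_v: "ip (f l) (v n) = 0"
    and f_w: "l > n \<Longrightarrow> ip (f l) (w n) = 0" and f_w_ne: "ip (f n) (w n) \<noteq> 0"
    and e_w: "ip (e l) (w n) = 0"
    and vw_total: "\<lbrakk>x \<in> V; \<And>n. ip x (v n) = 0; \<And>n. ip x (w n) = 0\<rbrakk> \<Longrightarrow> nrm x = 0"
    and ef_total: "\<lbrakk>x \<in> V; \<And>n. ip x (e n) = 0; \<And>n. ip x (f n) = 0\<rbrakk> \<Longrightarrow> nrm x = 0"
    and U_V: "x \<in> V \<Longrightarrow> U x \<in> V"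
    and U_add: "U (x + y) = U x + U y" and U_scale: "U (c *h x) = c *h U x"
    and U_ip: "\<lbrakk>x \<in> V; y \<in> V\<rbrakk> \<Longrightarrow> ip (U x) (U y) = ip x y"
    and U_e: "nrm (U (e n) - e (n + 1)) = 0" and U_f: "nrm (U (f n) - f (n - 1)) = 0"
begin

definition G :: "int \<Rightarrow> int \<Rightarrow> 'v set" where
  "G n m = e ` {n..} \<union> f ` {m..}"

definition H :: "int \<Rightarrow> int \<Rightarrow> 'v set" where
  "H n m = cl (span (G n m))"

lemma G_V: "G n m \<subseteq> V"
  by (auto simp: G_def)

lemma atLeast_int_insert: "{n..} = insert n {n + 1..}" for n :: int
  by auto

lemma G_e: "G n m = insert (e n) (G (n + 1) m)"
  unfolding G_def by (subst atLeast_int_insert) auto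

lemma G_f: "G n m = insert (f m) (G n (m + 1))"
  unfolding G_def by (subst (2) atLeast_int_insert) auto

lemma H_V: "x \<in> H n m \<Longrightarrow> x \<in> V"
  unfolding H_def by (rule cl_V)

lemma H_mono: "\<lbrakk>n \<le> n'; m \<le> m'\<rbrakk> \<Longrightarrow> H n' m' \<subseteq> H n m"
  unfolding H_def by (intro cl_span_mono) (auto simp: G_def)

lemma subspace_H [simp]: "subspace (H n m)"
  by (simp add: H_def)

text \<open>\<open>v n\<close> annihilates all generators of \<open>H (n + 1) m\<close> but not
  \<open>e n\<close>, so it witnesses that the step up to \<open>H n m\<close> is proper.\<close>

lemma e_ex: "\<exists>k. unit_defect (e n) (G (n + 1) m) k"
proof (rule unit_defect_ex[OF G_V, of _ "v n"])
  show "ip s (v n) = 0" if "s \<in> G (n + 1) m" for s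
    using that by (auto simp: G_def e_v f_v)
qed (auto simp: e_v_ne)

lemma f_ex: "\<exists>k. unit_defect (f m) (G n (m + 1)) k"
proof (rule unit_defect_ex[OF G_V, of _ "w m"])
  show "ip s (w m) = 0" if "s \<in> G n (m + 1)" for s
    using that by (auto simp: G_def f_w e_w)
qed (auto simp: f_w_ne)

section \<open>The isometry shifts the filtration\<close>

lemma U_diff: "U (x - y) = U x - U y"
  using U_add[of "x - y" y] by (simp add: algebra_simps)

lemma U_nrm: "x \<in> V \<Longrightarrow> nrm (U x) = nrm x"
  by (simp add: nrm_def U_ip)

lemma subspace_vimage_U:
  assumes "subspace W"
  shows "subspace {x. U x \<in> W}"
proof (rule subspaceI)
  have "U 0 = 0" using U_diff[of 0 0] by simp
  then show "0 \<in> {x. U x \<in> W}" using subspace_0[OF assms] by simp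
qed (use assms in \<open>auto simp: U_add U_scale subspace_add subspace_scale\<close>)

lemma U_G: "g \<in> G n m \<Longrightarrow> U g \<in> H (n + 1) (m - 1)"
proof -
  assume "g \<in> G n m"
  then consider i where "g = e i" "i \<ge> n" | i where "g = f i" "i \<ge> m" by (auto simp: G_def)
  then show ?thesis
  proof cases
    case 1
    have "e (i + 1) \<in> H (n + 1) (m - 1)"
      using subset_cl_span[OF G_V, of "n + 1" "m - 1"] 1 by (auto simp: H_def G_def)
    then show ?thesis
      using cl_add_null U_e[of i] U_V[of "e i"] 1 unfolding H_def by auto
  next
    case 2
    have "f (i - 1) \<in> H (n + 1) (m - 1)"
      using subset_cl_span[OF G_V, of "n + 1" "m - 1"] 2 by (auto simp: H_def G_def)
    then show ?thesis
      using cl_add_null U_f[of i] U_V[of "f i"] 2 unfolding H_def by auto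
  qed
qed

lemma U_H:
  assumes x: "x \<in> H n m"
  shows "U x \<in> H (n + 1) (m - 1)"
proof -
  have sp: "span (G n m) \<subseteq> {x. U x \<in> H (n + 1) (m - 1)}"
    using U_G by (intro span_minimal subspace_vimage_U) auto
  have xV: "x \<in> V" using x by (rule H_V)
  have "U x \<in> cl (H (n + 1) (m - 1))"
  proof (rule clI)
    show "U x \<in> V" using xV by (rule U_V)
    fix \<epsilon> :: real assume "\<epsilon> > 0"
    then obtain g where g: "g \<in> span (G n m)" "g \<in> V" "nrm (x - g) < \<epsilon>"
      using x cl_obtain unfolding H_def by metis
    then have "nrm (U x - U g) < \<epsilon>" using U_nrm[of "x - g"] xV by (simp add: U_diff)
    then show "\<exists>g. g \<in> H (n + 1) (m - 1) \<and> g \<in> V \<and> nrm (U x - g) < \<epsilon>"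
      using g sp U_V by (intro exI[of _ "U g"]) auto
  qed
  then show ?thesis using cl_cl unfolding H_def by auto
qed

lemma ip_e_eq: "x \<in> V \<Longrightarrow> ip (U (e n)) x = ip (e (n + 1)) x"
  using ip_null_left[OF _ _ U_e[of n], of x] U_V[of "e n"] by (simp add: ip_simps)

lemma ip_f_eq: "x \<in> V \<Longrightarrow> ip (U (f n)) x = ip (f (n - 1)) x"
  using ip_null_left[OF _ _ U_f[of n], of x] U_V[of "f n"] by (simp add: ip_simps)

text \<open>With no inverse of \<open>U\<close> at hand, orthogonality is tested on the generators
  of the target, each of which is the image of a generator of \<open>H n m\<close> up to a null
  vector.\<close>

lemma U_orthogonal:
  assumes x: "x \<in> V" and orth: "\<And>g. g \<in> H n m \<Longrightarrow> ip x g = 0" and y: "y \<in> H (n + 1) (m - 1)"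
  shows "ip (U x) y = 0"
proof (rule orthogonal_cl_span[OF _ G_V])
  show "y \<in> cl (span (G (n + 1) (m - 1)))" using y by (simp add: H_def)
  show UV: "U x \<in> V" using x by (rule U_V)
  fix g assume "g \<in> G (n + 1) (m - 1)"
  then consider i where "g = e (i + 1)" "i \<ge> n" | i where "g = f (i - 1)" "i \<ge> m"
    unfolding G_def by (auto, metis add_le_cancel_right diff_add_cancel, smt (verit))
  then show "ip (U x) g = 0"
  proof cases
    case 1
    have "e i \<in> H n m" using subset_cl_span[OF G_V, of n m] 1 by (auto simp: H_def G_def)
    then have "ip (U x) (U (e i)) = 0" using orth x by (simp add: U_ip)
    then have "ip (U (e i)) (U x) = 0" using UV U_V[of "e i"] ip_eq_0_sym by auto
    then show ?thesis using ip_e_eq[OF UV] 1 UV ip_eq_0_sym by auto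
  next
    case 2
    have "f i \<in> H n m" using subset_cl_span[OF G_V, of n m] 2 by (auto simp: H_def G_def)
    then have "ip (U x) (U (f i)) = 0" using orth x by (simp add: U_ip)
    then have "ip (U (f i)) (U x) = 0" using UV U_V[of "f i"] ip_eq_0_sym by auto
    then show ?thesis using ip_f_eq[OF UV] 2 UV ip_eq_0_sym by auto
  qed
qed

end

text \<open>\<open>K\<close> and \<open>L\<close>, the latter for the family with a tilde, are
  arbitrary vectors with the defining properties, so the results hold for whatever representatives a
  choice operator returns.\<close>

locale cmv_basis = cmv_system scale V ip e f v w U
  for scale :: "complex \<Rightarrow> 'v::ab_group_add \<Rightarrow> 'v" (infixr \<open>*h\<close> 75) and V ip e f v w U +
  fixes K L :: "int \<Rightarrow> int \<Rightarrow> 'v"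
  assumes K: "unit_defect (e n) (G (n + 1) m) (K n m)"
    and L: "unit_defect (f m) (G n (m + 1)) (L n m)"
begin

lemma K_H: "K n m \<in> H n m"
  using K[of n m] G_e[of n m] by (simp add: unit_defect_def H_def)

lemma L_H: "L n m \<in> H n m"
  using L[of m n] G_f[of n m] by (simp add: unit_defect_def H_def)

lemma K_V [simp]: "K n m \<in> V" and L_V [simp]: "L n m \<in> V"
  using K_H L_H H_V by blast+

lemma K_orth: "g \<in> H (n + 1) m \<Longrightarrow> ip (K n m) g = 0"
  using K[of n m] by (simp add: unit_defect_def H_def)

lemma L_orth: "g \<in> H n (m + 1) \<Longrightarrow> ip (L n m) g = 0"
  using L[of m n] by (simp add: unit_defect_def H_def)

text \<open>\<open>U\<close> carries over all conditions that characterize \<open>K n m\<close>;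
  uniqueness up to null vectors does the rest.\<close>

lemma U_K: "nrm (U (K n m) - K (n + 1) (m - 1)) = 0"
proof (rule defect_unique[OF G_V _ K])
  have "ip (e (n + 1)) (U (K n m)) = ip (e n) (K n m)"
    using ip_e_eq[of "U (K n m)" n] U_V by (simp add: U_ip)
  moreover have "nrm (U (K n m)) = 1" using K[of n m] by (simp add: U_nrm unit_defect_def)
  moreover have "ip (U (K n m)) g = 0" if "g \<in> H (n + 1 + 1) (m - 1)" for g
    using U_orthogonal[OF K_V _ that] K_orth by blast
  ultimately show "unit_defect (e (n + 1)) (G (n + 1 + 1) (m - 1)) (U (K n m))"
    using K[of n m] U_H[OF K_H, of n m] G_e[of "n + 1" "m - 1"]
    by (auto simp: unit_defect_def H_def)
qed simp

lemma U_L: "nrm (U (L n m) - L (n + 1) (m - 1)) = 0"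
proof (rule defect_unique[OF G_V _ L])
  have "ip (f (m - 1)) (U (L n m)) = ip (f m) (L n m)"
    using ip_f_eq[of "U (L n m)" m] U_V by (simp add: U_ip)
  moreover have "nrm (U (L n m)) = 1" using L[of m n] by (simp add: U_nrm unit_defect_def)
  moreover have "ip (U (L n m)) g = 0" if "g \<in> H (n + 1) (m - 1 + 1)" for g
    using U_orthogonal[OF L_V, of n "m + 1"] L_orth that by auto
  ultimately show "unit_defect (f (m - 1)) (G (n + 1) (m - 1 + 1)) (U (L n m))"
    using L[of m n] U_H[OF L_H, of n m] G_f[of "n + 1" "m - 1"]
    by (auto simp: unit_defect_def H_def)
qed simp

definition \<alpha> :: "int \<Rightarrow> complex" where
  "\<alpha> j = ip (K j 0) (L j 0)"

lemma ip_K_L_Suc: "ip (K (n + 1) (m - 1)) (L (n + 1) (m - 1)) = ip (K n m) (L n m)"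
proof -
  have UV: "U (K n m) \<in> V" "U (L n m) \<in> V" by (auto intro: U_V)
  have "ip (K n m) (L n m) = ip (U (K n m)) (U (L n m))" by (simp add: U_ip)
  also have "\<dots> = ip (K (n + 1) (m - 1)) (U (L n m))"
    using ip_null_left[OF _ UV(2) U_K[of n m]] UV by (simp add: ip_simps)
  also have "\<dots> = ip (K (n + 1) (m - 1)) (L (n + 1) (m - 1))"
  proof -
    have "ip (U (L n m) - L (n + 1) (m - 1)) (K (n + 1) (m - 1)) = 0"
      using ip_null_left[OF _ K_V U_L[of n m]] UV by auto
    then have "ip (K (n + 1) (m - 1)) (U (L n m) - L (n + 1) (m - 1)) = 0"
      by (rule ip_eq_0_sym[rotated 2]) (use UV in auto)
    then show ?thesis using UV by (simp add: ip_simps)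
  qed
  finally show ?thesis by simp
qed

lemma ip_K_L: "ip (K n m) (L n m) = \<alpha> (n + m)"
proof -
  have "ip (K (j - i) i) (L (j - i) i) = \<alpha> j" for i j
  proof (induction i rule: int_induct[of _ 0])
    case base
    show ?case by (simp add: \<alpha>_def)
  next
    case (step1 i)
    have "j - (i + 1) + 1 = j - i" "i + 1 - 1 = i" by auto
    then show ?case using ip_K_L_Suc[of "j - (i + 1)" "i + 1"] step1(2) by (simp only:)
  next
    case (step2 i)
    have "j - i + 1 = j - (i - 1)" by auto
    then show ?case using ip_K_L_Suc[of "j - i" i] step2(2) by (simp only:)
  qed
  from this[of "n + m" m] show ?thesis by simp
qed

section \<open>The recurrences between the two families\<close>

definition \<rho> :: "int \<Rightarrow> real" where
  "\<rho> j = sqrt (1 - (norm (\<alpha> j))\<^sup>2)"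

lemma ip_L_K: "ip (L n m) (K n m) = cnj (\<alpha> (n + m))"
  using ip_cnj[OF K_V L_V, of n m n m] by (simp add: ip_K_L)

text \<open>The exchange lemma over \<open>G (n + 1) (m + 1)\<close>, with \<open>L n m\<close>,
  \<open>K n m\<close> and \<open>L (n + 1) m\<close> in the roles of \<open>a\<close>,
  \<open>b\<close> and \<open>c\<close>.\<close>

lemma norm_\<alpha>: "norm (\<alpha> j) < 1"
  and L_rec: "nrm (L n m - (cnj (\<alpha> (n + m)) *h K n m + of_real (\<rho> (n + m)) *h L (n + 1) m)) = 0"
proof -
  have 1: "unit_defect (f m) (insert (e n) (G (n + 1) (m + 1))) (L n m)"
    and 2: "unit_defect (e n) (insert (f m) (G (n + 1) (m + 1))) (K n m)" for n m
    using L[of m n] K[of n m] by (simp_all flip: G_e G_f)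
  from defect_exchange[OF G_V e_V f_V 1 2 L]
  show "nrm (L n m - (cnj (\<alpha> (n + m)) *h K n m + of_real (\<rho> (n + m)) *h L (n + 1) m)) = 0"
    by (simp add: ip_L_K \<rho>_def)
  from defect_exchange(1)[OF G_V e_V f_V 1 2 L, of j 0] show "norm (\<alpha> j) < 1"
    by (simp add: ip_L_K)
qed

text \<open>The same exchange with \<open>e\<close> and \<open>f\<close> interchanged, which
  conjugates the first coefficient.\<close>

lemma K_rec: "nrm (K n m - (\<alpha> (n + m) *h L n m + of_real (\<rho> (n + m)) *h K n (m + 1))) = 0"
proof -
  have 1: "unit_defect (f m) (insert (e n) (G (n + 1) (m + 1))) (L n m)"
    and 2: "unit_defect (e n) (insert (f m) (G (n + 1) (m + 1))) (K n m)"
    using L[of m n] K[of n m] by (simp_all flip: G_e G_f)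
  from defect_exchange(2)[OF G_V f_V e_V 2 1 K] show ?thesis
    by (simp add: ip_K_L \<rho>_def)
qed

lemma \<rho>_pos: "\<rho> j > 0"
  using norm_\<alpha>[of j] by (simp add: \<rho>_def power_less_one_iff abs_square_less_1)

section \<open>Orthonormality and completeness of the basis\<close>

definition b :: "int \<Rightarrow> 'v" where
  "b j = (if even j then K (j div 2) (j div 2) else L (j div 2 + 1) (j div 2))"

text \<open>A staircase that raises the first and the second index alternately; \<open>b j\<close>
  spans what is lost from \<open>F j\<close> to \<open>F (j + 1)\<close>.\<close>

definition F :: "int \<Rightarrow> 'v set" where
  "F j = H ((j + 1) div 2) (j div 2)"

lemma b_F: "b j \<in> F j"
  by (cases "even j") (auto simp: b_def F_def K_H L_H elim!: evenE oddE)

lemma F_mono: "i \<le> j \<Longrightarrow> F j \<subseteq> F i"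
  unfolding F_def by (intro H_mono zdiv_mono1) auto

lemma F_V: "x \<in> F j \<Longrightarrow> x \<in> V"
  unfolding F_def by (rule H_V)

lemma b_V [simp]: "b j \<in> V"
  using b_F F_V by blast

lemma b_orth: "g \<in> F (j + 1) \<Longrightarrow> ip (b j) g = 0"
  by (cases "even j") (auto simp: b_def F_def K_orth L_orth add.commute[of 1] elim!: evenE oddE)

lemma b_orthonormal: "ip (b i) (b j) = (if i = j then 1 else 0)"
proof -
  have "ip (b j) (b j) = 1" for j
    using unit_defect_ip_self[OF G_V e_V K] unit_defect_ip_self[OF G_V f_V L] by (simp add: b_def)
  moreover have *: "ip (b i) (b j) = 0" if "i < j" for i j
    using b_orth b_F[of j] F_mono[of "i + 1" j] that by auto
  moreover have "ip (b i) (b j) = 0" if "i > j" for i j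
    using ip_eq_0_sym[OF _ _ *[OF that]] by simp
  ultimately show ?thesis by (cases i j rule: linorder_cases) auto
qed

lemma F_step:
  assumes x: "x \<in> F j" and orth: "ip x (b j) = 0"
  shows "x \<in> F (j + 1)"
proof (cases "even j")
  case True
  then obtain n where j: "j = 2 * n" by (elim evenE)
  then have "x \<in> cl (span (insert (e n) (G (n + 1) n)))" using x G_e[of n n] by (simp add: F_def H_def)
  from defect_remainder[OF G_V e_V K this] orth show ?thesis
    by (simp add: j b_def F_def H_def add.commute[of 1])
next
  case False
  then obtain n where j: "j = 2 * n + 1" by (elim oddE)
  then have "x \<in> cl (span (insert (f n) (G (n + 1) (n + 1))))"
    using x G_f[of "n + 1" n] by (simp add: F_def H_def add.commute[of 1])
  from defect_remainder[OF G_V f_V L this] orth show ?thesis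
    by (simp add: j b_def F_def H_def add.commute[of 1])
qed

text \<open>\<open>v n\<close> and \<open>w n\<close> annihilate all generators of
  \<open>H (n + 1) (n + 1)\<close>, so a vector lying arbitrarily deep in the filtration is
  orthogonal to all of them, and totality applies.\<close>

lemma Inter_F:
  assumes x: "\<And>j. j \<ge> i \<Longrightarrow> x \<in> F j"
  shows "nrm x = 0"
proof (rule vw_total)
  have xH: "x \<in> H (n + 1) (n + 1)" for n
  proof -
    \<comment> \<open>The modulus makes \<open>k\<close> nonnegative, whence
      \<open>i \<le> k \<le> 2 * k\<close>.\<close>
    define k where "k = max \<bar>i\<bar> (n + 1)"
    have "\<bar>i\<bar> \<le> k" "n + 1 \<le> k" unfolding k_def by auto
    then have "i \<le> 2 * k" "n + 1 \<le> k" by linarith+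
    then show ?thesis
      using x[of "2 * k"] H_mono[of "n + 1" k "n + 1" k] by (auto simp: F_def)
  qed
  show xV: "x \<in> V" using xH H_V by blast
  have x_cl: "x \<in> cl (span (G (n + 1) (n + 1)))" for n using xH by (simp add: H_def)
  show "ip x (v n) = 0" for n
  proof (rule ip_eq_0_sym[OF v_V xV], rule orthogonal_cl_span[OF v_V G_V _ x_cl])
    show "ip (v n) g = 0" if "g \<in> G (n + 1) (n + 1)" for g
      using that by (auto simp: G_def e_v f_v intro!: ip_eq_0_sym[OF _ v_V])
  qed
  show "ip x (w n) = 0" for n
  proof (rule ip_eq_0_sym[OF w_V xV], rule orthogonal_cl_span[OF w_V G_V _ x_cl])
    show "ip (w n) g = 0" if "g \<in> G (n + 1) (n + 1)" for g
      using that by (auto simp: G_def e_w f_w intro!: ip_eq_0_sym[OF _ w_V])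
  qed
qed

text \<open>The remainder of the projection onto the span of the later basis vectors is orthogonal to all
  of them, so it descends through the whole filtration.\<close>

lemma F_subset: "F i \<subseteq> cl (span (range b))"
proof
  fix h assume h: "h \<in> F i"
  have hV: "h \<in> V" using h by (rule F_V)
  have bV: "b ` {i..} \<subseteq> V" by auto
  obtain p where p: "p \<in> cl (span (b ` {i..}))" "\<And>g. g \<in> cl (span (b ` {i..})) \<Longrightarrow> ip (h - p) g = 0"
    using projection[of "span (b ` {i..})" h] span_subset_V[OF bV] hV by auto
  have pF: "p \<in> F i"
  proof -
    have "b ` {i..} \<subseteq> F i" using b_F F_mono by auto
    then have "cl (span (b ` {i..})) \<subseteq> F i" unfolding F_def H_def by (rule cl_span_subset)
    then show ?thesis using p by auto
  qed
  define z where "z = h - p"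
  have z: "z \<in> F j" if "j \<ge> i" for j
    using that
  proof (induction j rule: int_ge_induct)
    case base
    show ?case using h pF unfolding z_def F_def by (intro subspace_diff) auto
  next
    case (step j)
    have "b j \<in> cl (span (b ` {i..}))" using subset_cl_span[OF bV] step by auto
    then show ?case using F_step[of z j] step p by (simp add: z_def)
  qed
  then have "nrm (h - p) = 0" using Inter_F[of i z] by (simp add: z_def)
  moreover have "p \<in> cl (span (range b))"
    using p(1) cl_span_mono[of "b ` {i..}" "range b"] by auto
  ultimately show "h \<in> cl (span (range b))" using cl_add_null[OF _ hV] by blast
qed

text \<open>\<open>F_subset\<close> settles the descending end of the filtration. At the other end
  every generator lies in some \<open>F i\<close>, so a vector orthogonal to all \<open>b j\<close>
  is orthogonal to all generators.\<close>

theorem b_total: "cl (span (range b)) = V"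
proof (rule cl_span_eq_V)
  show "range b \<subseteq> V" by auto
  fix y assume y: "y \<in> V" and orth: "\<And>g. g \<in> range b \<Longrightarrow> ip y g = 0"
  have bV: "range b \<subseteq> V" by auto
  have *: "ip y g = 0" if "g \<in> F i" for g i
    using orthogonal_cl_span[OF y bV orth] F_subset that by blast
  have "e n \<in> F (2 * n)" "f n \<in> F (2 * n)" for n
    using subset_cl_span[OF G_V, of n n] by (auto simp: F_def H_def G_def)
  then show "nrm y = 0" using * by (intro ef_total[OF y]) auto
qed

end

section \<open>Fourier coefficients on the circle\<close>

abbreviation circle_mu :: "complex measure" (\<open>\<mu>\<close>) where
  "\<mu> \<equiv> circle_measure"

lemma space_circle_measure [simp]: "space \<mu> = UNIV"
  by (simp add: circle_measure_def)

lemma measurable_cis [measurable]: "cis \<in> borel_measurable borel"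
  by (intro borel_measurable_continuous_onI continuous_intros)

lemma borel_measurable_circle: "f \<in> borel_measurable borel \<Longrightarrow> f \<in> borel_measurable \<mu>"
  unfolding circle_measure_def by (rule measurable_completion) simp

lemma sets_borel_circle: "A \<in> sets borel \<Longrightarrow> A \<in> sets \<mu>"
  unfolding circle_measure_def by auto

lemma emeasure_circle_UNIV: "emeasure \<mu> UNIV = 1"
  unfolding circle_measure_def
  by (simp add: emeasure_distr emeasure_uniform_measure_1)

global_interpretation circle: finite_measure \<mu>
  by standard (simp add: emeasure_circle_UNIV)

lemma measure_circle_UNIV [simp]: "measure \<mu> UNIV = 1"
  by (simp add: measure_def emeasure_circle_UNIV)

lemma AE_circle_norm: "AE t in \<mu>. norm t = 1"
proof -
  have "AE t in distr (uniform_measure lborel {0..<2 * pi}) borel cis. norm t = 1"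
    by (subst AE_distr_iff) auto
  then show ?thesis unfolding circle_measure_def by (rule AE_completion)
qed

lemma integral_circle:
  fixes f :: "complex \<Rightarrow> complex"
  assumes [measurable]: "f \<in> borel_measurable borel"
  shows "(LINT t|\<mu>. f t) =
    (1 / (2 * pi)) *\<^sub>R (LINT \<theta>|lborel. indicator {0..2 * pi} \<theta> *\<^sub>R f (cis \<theta>))"
proof -
  have u: "uniform_measure lborel {0..<2 * pi} =
      density lborel (\<lambda>x. ennreal (indicator {0..<2 * pi} x / (2 * pi)))"
    unfolding uniform_measure_def
    using divide_ennreal[of 1 "2 * pi"]
    by (intro density_cong) (auto split: split_indicator)
  have "(LINT t|\<mu>. f t) = (LINT \<theta>|uniform_measure lborel {0..<2 * pi}. f (cis \<theta>))"
    unfolding circle_measure_def by (simp add: integral_completion integral_distr)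
  also have "\<dots> = (LINT \<theta>|lborel. (indicator {0..<2 * pi} \<theta> / (2 * pi)) *\<^sub>R f (cis \<theta>))"
    unfolding u by (rule integral_density) (auto split: split_indicator)
  \<comment> \<open>The closed interval, which differs by a null set, is the form that the
    fundamental theorem of calculus requires.\<close>
  also have "\<dots> = (LINT \<theta>|lborel. (1 / (2 * pi)) *\<^sub>R (indicator {0..2 * pi} \<theta> *\<^sub>R f (cis \<theta>)))"
    using AE_lborel_singleton[of "2 * pi"]
    by (intro integral_cong_AE) (auto split: split_indicator)
  also have "\<dots> = (1 / (2 * pi)) *\<^sub>R (LINT \<theta>|lborel. indicator {0..2 * pi} \<theta> *\<^sub>R f (cis \<theta>))"
    by (rule integral_scaleR_right)
  finally show ?thesis .
qed

lemma borel_measurable_powi [measurable]: "(\<lambda>t::complex. t powi k) \<in> borel_measurable borel"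
  by (cases "k \<ge> 0") (auto simp: power_int_def)

lemma integral_powi: "(LINT t|\<mu>. t powi k) = (if k = 0 then 1 else 0)"
proof (cases "k = 0")
  case True
  then show ?thesis by simp
next
  case False
  have "(LINT \<theta>|lborel. indicator {0..2 * pi} \<theta> *\<^sub>R cis (of_int k * \<theta>))
      = exp (\<i> * of_int k * of_real (2 * pi)) / (\<i> * of_int k) - exp (\<i> * of_int k * of_real 0) / (\<i> * of_int k)"
  proof (rule integral_FTC_Icc)
    fix x :: real
    have "((\<lambda>z. exp (\<i> * of_int k * z) / (\<i> * of_int k)) has_field_derivative exp (\<i> * of_int k * of_real x)) (at (of_real x))"
      using False by (auto intro!: derivative_eq_intros)
    from has_vector_derivative_real_field[OF this]
    show "((\<lambda>x. exp (\<i> * of_int k * of_real x) / (\<i> * of_int k)) has_vector_derivative cis (of_int k * x)) (at x within {0..2 * pi})"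
      by (auto simp: cis_conv_exp mult_ac intro: has_vector_derivative_at_within)
  qed (auto intro!: continuous_intros)
  also have "exp (\<i> * of_int k * of_real (2 * pi)) = (1::complex)"
    using exp_integer_2pi[of "of_int k"] by (simp add: mult_ac)
  finally show ?thesis
    using False by (simp add: integral_circle cis_power_int)
qed

lemma integrable_mult_bounded:
  fixes g h :: "'a \<Rightarrow> complex"
  assumes h: "integrable M h" and g [measurable]: "g \<in> borel_measurable M"
    and B: "AE t in M. norm (g t) \<le> B"
  shows "integrable M (\<lambda>t. g t * h t)"
proof (rule Bochner_Integration.integrable_bound)
  show "integrable M (\<lambda>t. B * norm (h t))" using h by auto
  show "AE t in M. norm (g t * h t) \<le> norm (B * norm (h t))"
    using B by eventually_elim (simp add: norm_mult mult_right_mono abs_mult order_trans[OF _ abs_ge_self])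
qed (use h in measurable)

lemma AE_circle_powi: "AE t in \<mu>. norm (t powi k) = 1"
  using AE_circle_norm by eventually_elim (simp add: norm_power_int)

lemma integrable_powi_mult:
  "integrable \<mu> h \<Longrightarrow> integrable \<mu> (\<lambda>t. t powi k * h t)"
  using AE_circle_powi[of k]
  by (intro integrable_mult_bounded[where B = 1] borel_measurable_circle) auto

lemma circle_inverse: "norm t = 1 \<Longrightarrow> inverse t = cnj t"
  using complex_norm_square[of t] by (intro inverse_unique) simp

lemma circle_cnj_powi: "norm t = 1 \<Longrightarrow> cnj t powi k = t powi (- k)"
  by (simp flip: circle_inverse add: power_int_inverse power_int_minus)

definition fourier_null :: "(complex \<Rightarrow> complex) \<Rightarrow> bool" where
  "fourier_null h \<longleftrightarrow> integrable \<mu> h \<and>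
     (\<forall>k. (LINT t|\<mu>. t powi k * h t) = 0)"

lemma fourier_null_powi: "fourier_null h \<Longrightarrow> fourier_null (\<lambda>t. t powi j * h t)"
proof -
  assume h: "fourier_null h"
  have "(LINT t|\<mu>. t powi k * (t powi j * h t)) = (LINT t|\<mu>. t powi (k + j) * h t)" for k
  proof (rule integral_cong_AE)
    show "AE t in \<mu>. t powi k * (t powi j * h t) = t powi (k + j) * h t"
      using AE_circle_norm
    proof eventually_elim
      case (elim t)
      then have "t \<noteq> 0" by auto
      then show ?case by (simp add: power_int_add)
    qed
  qed (use h borel_measurable_circle[OF borel_measurable_powi] in \<open>auto simp: fourier_null_def\<close>)
  then show ?thesis using h by (auto simp: fourier_null_def integrable_powi_mult)
qed

lemma fourier_null_lincomb:
  assumes "fourier_null g" "fourier_null h"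
  shows "fourier_null (\<lambda>t. a * g t + b * h t)"
proof -
  have i: "integrable \<mu> (\<lambda>t. t powi k * g t)" "integrable \<mu> (\<lambda>t. t powi k * h t)" for k
    using assms by (auto simp: fourier_null_def integrable_powi_mult)
  have "(\<lambda>t. t powi k * (a * g t + b * h t)) = (\<lambda>t. a * (t powi k * g t) + b * (t powi k * h t))" for k
    by (auto simp: algebra_simps)
  then show ?thesis using assms i by (simp add: fourier_null_def)
qed

lemma fourier_null_cong_AE:
  assumes h: "fourier_null h" and g: "g \<in> borel_measurable \<mu>"
    and eq: "AE t in \<mu>. g t = h t"
  shows "fourier_null g"
proof -
  have hm: "h \<in> borel_measurable \<mu>" using h by (auto simp: fourier_null_def)
  have "integrable \<mu> g"
    using h integrable_cong_AE[OF g hm eq] by (simp add: fourier_null_def)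
  moreover have "(LINT t|\<mu>. t powi k * g t) = (LINT t|\<mu>. t powi k * h t)" for k
    by (rule integral_cong_AE) (use g hm eq borel_measurable_circle[OF borel_measurable_powi] in auto)
  ultimately show ?thesis using h by (simp add: fourier_null_def)
qed

text \<open>On the circle a real linear form is a combination of \<open>t\<close> and its inverse,
  so multiplying by it keeps all Fourier coefficients zero; products follow by induction with
  \<open>h\<close> generalized.\<close>

lemma fourier_null_polynomial:
  assumes "real_polynomial_function p" "fourier_null h"
  shows "fourier_null (\<lambda>t. of_real (p t) * h t)"
  using assms
proof (induction arbitrary: h)
  case (linear f)
  interpret f: bounded_linear f by (rule linear)
  \<comment> \<open>The coefficients of \<open>t\<close> and \<open>cnj t\<close> in a real linear
    form, from \<open>Re t = (t + cnj t) / 2\<close> and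
    \<open>Im t = (t - cnj t) / (2 * \<i>)\<close>.\<close>
  define a where "a = complex_of_real (f 1) / 2 - \<i> * of_real (f \<i>) / 2"
  define b where "b = complex_of_real (f 1) / 2 + \<i> * of_real (f \<i>) / 2"
  have eq: "complex_of_real (f t) * h t = a * (t powi 1 * h t) + b * (t powi (-1) * h t)" if t: "norm t = 1" for t
  proof -
    have "t = Re t *\<^sub>R 1 + Im t *\<^sub>R \<i>" by (simp add: complex_eq_iff)
    then have "f t = Re t * f 1 + Im t * f \<i>"
      by (metis f.add f.scaleR real_scaleR_def)
    then have "complex_of_real (f t) = a * t + b * cnj t"
      by (simp add: a_def b_def complex_eq_iff algebra_simps)
    moreover have "t powi (-1) = cnj t" using circle_inverse[OF t] by (simp add: power_int_minus)
    ultimately show ?thesis by (simp add: algebra_simps)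
  qed
  show ?case
  proof (rule fourier_null_cong_AE)
    show "fourier_null (\<lambda>t. a * (t powi 1 * h t) + b * (t powi (-1) * h t))"
      using linear by (intro fourier_null_lincomb fourier_null_powi)
    show "AE t in \<mu>. complex_of_real (f t) * h t = a * (t powi 1 * h t) + b * (t powi (-1) * h t)"
      using AE_circle_norm by eventually_elim (rule eq)
    have "(\<lambda>t. complex_of_real (f t)) \<in> borel_measurable \<mu>"
      by (intro borel_measurable_circle borel_measurable_continuous_onI continuous_intros f.continuous_on)
    then show "(\<lambda>t. complex_of_real (f t) * h t) \<in> borel_measurable \<mu>"
      using linear by (intro borel_measurable_times) (auto simp: fourier_null_def)
  qed
next
  case (const c)
  then show ?case using fourier_null_lincomb[of h h c 0] by simp
next
  case (add f g)
  then show ?case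
    using fourier_null_lincomb[of "\<lambda>t. of_real (f t) * h t" "\<lambda>t. of_real (g t) * h t" 1 1]
    by (simp add: algebra_simps)
next
  case (mult f g)
  then show ?case by (simp add: mult.assoc)
qed

text \<open>Stone-Weierstrass on the circle: the error is at most the uniform distance times the
  integral of the modulus of \<open>h\<close>.\<close>

lemma fourier_null_continuous:
  fixes g :: "complex \<Rightarrow> real"
  assumes g: "continuous_on UNIV g" and h: "fourier_null h"
  shows "(LINT t|\<mu>. of_real (g t) * h t) = 0"
proof -
  have hi: "integrable \<mu> h" using h by (simp add: fourier_null_def)
  define B where "B = (LINT t|\<mu>. norm (h t))"
  have B: "B \<ge> 0" by (simp add: B_def)
  have "norm (LINT t|\<mu>. of_real (g t) * h t) \<le> \<epsilon>" if e: "\<epsilon> > 0" for \<epsilon>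
  proof -
    have pos: "\<epsilon> / (B + 1) > 0" using e B by simp
    obtain p where p: "real_polynomial_function p"
      "\<And>t. t \<in> sphere 0 1 \<Longrightarrow> \<bar>g t - p t\<bar> < \<epsilon> / (B + 1)"
      using Stone_Weierstrass_real_polynomial_function[OF compact_sphere continuous_on_subset[OF g] pos]
      by (metis subset_UNIV)
    have ph: "fourier_null (\<lambda>t. of_real (p t) * h t)" by (rule fourier_null_polynomial[OF p(1) h])
    then have "(LINT t|\<mu>. t powi 0 * (of_real (p t) * h t)) = 0"
      unfolding fourier_null_def by blast
    then have p0: "(LINT t|\<mu>. of_real (p t) * h t) = 0" by simp
    have pi: "integrable \<mu> (\<lambda>t. of_real (p t) * h t)" using ph by (simp add: fourier_null_def)
    have pc: "continuous_on UNIV p"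
      using continuous_on_polymonial_function p(1) real_polynomial_function_eq by blast
    have m: "(\<lambda>t. complex_of_real (g t - p t)) \<in> borel_measurable \<mu>"
      by (intro borel_measurable_circle borel_measurable_continuous_onI continuous_intros g pc)
    have bd: "AE t in \<mu>. norm (complex_of_real (g t - p t)) \<le> \<epsilon> / (B + 1)"
      using AE_circle_norm
    proof eventually_elim
      case (elim t)
      then show ?case using p(2)[of t] by (simp only: norm_of_real) simp
    qed
    have di: "integrable \<mu> (\<lambda>t. of_real (g t - p t) * h t)"
      by (rule integrable_mult_bounded[OF hi m bd])
    have "(LINT t|\<mu>. of_real (g t) * h t)
        = (LINT t|\<mu>. of_real (g t - p t) * h t + of_real (p t) * h t)"
      by (intro Bochner_Integration.integral_cong) (auto simp: algebra_simps)
    also have "\<dots> = (LINT t|\<mu>. of_real (g t - p t) * h t)"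
      using di pi p0 by simp
    also have "norm \<dots> \<le> (LINT t|\<mu>. (\<epsilon> / (B + 1)) * norm (h t))"
    proof (rule order_trans[OF integral_norm_bound])
      show "(LINT t|\<mu>. norm (of_real (g t - p t) * h t)) \<le> (LINT t|\<mu>. (\<epsilon> / (B + 1)) * norm (h t))"
      proof (rule integral_mono_AE)
        show "AE t in \<mu>. norm (of_real (g t - p t) * h t) \<le> \<epsilon> / (B + 1) * norm (h t)"
          using bd by eventually_elim (simp only: norm_mult mult_right_mono norm_ge_zero)
      qed (use di hi in auto)
    qed
    also have "\<dots> = \<epsilon> * (B / (B + 1))" by (simp add: B_def)
    also have "\<dots> \<le> \<epsilon> * 1" using B e by (intro mult_left_mono) auto
    finally show ?thesis by simp
  qed
  then have "norm (LINT t|\<mu>. of_real (g t) * h t) \<le> 0"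
    by (rule field_le_epsilon) simp
  then show ?thesis by simp
qed

lemma fourier_null_closed:
  assumes C: "closed C" and h: "fourier_null h"
  shows "(LINT t|\<mu>. of_real (indicator C t) * h t) = 0"
proof (cases "C = {}")
  case False
  have hi: "integrable \<mu> h" using h by (simp add: fourier_null_def)
  then have hm: "h \<in> borel_measurable \<mu>" by (rule borel_measurable_integrable)
  \<comment> \<open>Continuous functions that decrease to the indicator of \<open>C\<close>. The
    empty set is treated apart because \<open>infdist\<close> from it is 0 by convention.\<close>
  define g where "g n t = max 0 (1 - real n * infdist t C)" for n t
  have gc: "continuous_on UNIV (g n)" for n
    unfolding g_def by (intro continuous_intros)
  have g01: "0 \<le> g n t" "g n t \<le> 1" for n t
    using infdist_nonneg[of t C] by (auto simp: g_def)
  have lim: "(\<lambda>n. g n t) \<longlonglongrightarrow> indicator C t" for t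
  proof (cases "t \<in> C")
    case True
    then show ?thesis by (simp add: g_def)
  next
    case tC: False
    then have pos: "infdist t C > 0"
      using in_closed_iff_infdist_zero[OF C False] infdist_nonneg[of t C] by (simp add: less_le)
    obtain N :: nat where N: "1 / infdist t C < real N" using reals_Archimedean2 by blast
    have "g n t = 0" if "n \<ge> N" for n
    proof -
      have "1 / infdist t C < real n" using N that by linarith
      then have "1 < real n * infdist t C" using pos by (simp add: field_simps)
      then show ?thesis by (simp add: g_def)
    qed
    then have "eventually (\<lambda>n. g n t = indicator C t) sequentially"
      using tC by (auto simp: eventually_sequentially)
    then show ?thesis by (rule tendsto_eventually)
  qed
  have "(\<lambda>n. LINT t|\<mu>. of_real (g n t) * h t) \<longlonglongrightarrow> (LINT t|\<mu>. of_real (indicator C t) * h t)"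
  proof (rule integral_dominated_convergence[where w = "\<lambda>t. norm (h t)"])
    show "AE t in \<mu>. (\<lambda>n. of_real (g n t) * h t) \<longlonglongrightarrow> of_real (indicator C t) * h t"
      using lim by (intro AE_I2 tendsto_intros)
    show "AE t in \<mu>. norm (of_real (g n t) * h t) \<le> norm (h t)" for n
      using g01[of n] by (intro AE_I2) (simp add: norm_mult mult_left_le_one_le)
    show "(\<lambda>t. of_real (g n t) * h t) \<in> borel_measurable \<mu>" for n
      by (intro borel_measurable_times hm borel_measurable_circle borel_measurable_continuous_onI
          continuous_intros gc)
    have [measurable]: "C \<in> sets borel" using C by simp
    have "(\<lambda>t. complex_of_real (indicator C t)) \<in> borel_measurable borel"
      by measurable
    then show "(\<lambda>t. of_real (indicator C t) * h t) \<in> borel_measurable \<mu>"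
      by (intro borel_measurable_times hm borel_measurable_circle)
  qed (use hi in auto)
  moreover have "(LINT t|\<mu>. of_real (g n t) * h t) = 0" for n
    by (rule fourier_null_continuous[OF gc h])
  ultimately show ?thesis by (simp add: LIMSEQ_const_iff)
qed simp

text \<open>Closed sets are stable under intersection and generate the Borel sets, so Dynkin's
  argument applies; its complement step uses the coefficient of index 0.\<close>

lemma fourier_null_borel:
  assumes A: "A \<in> sets borel" and h: "fourier_null h"
  shows "(LINT t|\<mu>. of_real (indicator A t) * h t) = 0"
proof -
  have hi: "integrable \<mu> h" using h by (simp add: fourier_null_def)
  then have hm: "h \<in> borel_measurable \<mu>" by (rule borel_measurable_integrable)
  have int: "integrable \<mu> (\<lambda>t. complex_of_real (indicator A t) * h t)" if "A \<in> sets borel" for A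
  proof -
    note [measurable] = that
    have "(\<lambda>t. complex_of_real (indicator A t)) \<in> borel_measurable borel"
      by measurable
    then show ?thesis
      by (intro integrable_mult_bounded[where B = 1] hi borel_measurable_circle)
        (auto split: split_indicator)
  qed
  have bc: "sets (borel :: complex measure) = sigma_sets UNIV {C. closed C}"
    by (subst borel_eq_closed) simp
  have sub: "{C::complex set. closed C} \<subseteq> Pow UNIV" by auto
  have stable: "Int_stable {C::complex set. closed C}" by (auto simp: Int_stable_def)
  have "A \<in> sigma_sets UNIV {C. closed C}" using A bc by simp
  with stable sub show ?thesis
  proof (induction rule: sigma_sets_induct_disjoint)
    case (basic C)
    then show ?case using fourier_null_closed h by auto
  next
    case empty
    then show ?case by simp
  next
    case (compl A)
    have AB: "A \<in> sets borel" using compl bc by simp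
    have "(LINT t|\<mu>. h t - of_real (indicator A t) * h t) = (LINT t|\<mu>. t powi 0 * h t) - 0"
      using hi int[OF AB] compl by simp
    also have "\<dots> = 0" using h by (simp only: fourier_null_def diff_0_right)
    finally have "(LINT t|\<mu>. h t - of_real (indicator A t) * h t) = 0" .
    moreover have "(LINT t|\<mu>. of_real (indicator (UNIV - A) t) * h t) = (LINT t|\<mu>. h t - of_real (indicator A t) * h t)"
      by (intro Bochner_Integration.integral_cong) (auto split: split_indicator)
    ultimately show ?case by simp
  next
    case (union D)
    have DB: "D i \<in> sets borel" for i using union(2) bc by auto
    have "(\<lambda>n. LINT t|\<mu>. of_real (indicator (\<Union>i<n. D i) t) * h t) \<longlonglongrightarrow> (LINT t|\<mu>. of_real (indicator (\<Union>i. D i) t) * h t)"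
    proof (rule integral_dominated_convergence[where w = "\<lambda>t. norm (h t)"])
      show "AE t in \<mu>. (\<lambda>n. of_real (indicator (\<Union>i<n. D i) t) * h t) \<longlonglongrightarrow> of_real (indicator (\<Union>i. D i) t) * h t"
        by (intro AE_I2 tendsto_intros LIMSEQ_indicator_UN)
      show "AE t in \<mu>. norm (of_real (indicator (\<Union>i<n. D i) t) * h t) \<le> norm (h t)" for n
        by (intro AE_I2) (simp split: split_indicator)
    qed (use hi int DB in auto)
    moreover have "(LINT t|\<mu>. of_real (indicator (\<Union>i<n. D i) t) * h t) = 0" for n
    proof -
      have "(LINT t|\<mu>. of_real (indicator (\<Union>i<n. D i) t) * h t)
          = (LINT t|\<mu>. (\<Sum>i<n. of_real (indicator (D i) t) * h t))"
      proof (intro Bochner_Integration.integral_cong refl)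
        fix t
        have "indicator (\<Union>i<n. D i) t = (\<Sum>i<n. indicator (D i) t :: real)"
          using union(1) by (intro indicator_UN_disjoint) (auto simp: disjoint_family_on_def)
        then show "of_real (indicator (\<Union>i<n. D i) t) * h t = (\<Sum>i<n. of_real (indicator (D i) t) * h t)"
          by (simp add: sum_distrib_right)
      qed
      also have "\<dots> = 0" using int[OF DB] union(3) by simp
      finally show ?thesis .
    qed
    ultimately show ?case by (simp add: LIMSEQ_const_iff)
  qed
qed

text \<open>Uniqueness of Fourier coefficients. Sets measurable for the completion are Borel up to
  null sets, so the integral of \<open>h\<close> over each of them vanishes.\<close>

theorem fourier_null_AE:
  assumes h: "fourier_null h"
  shows "AE t in \<mu>. h t = 0"
proof -
  have hi: "integrable \<mu> h" using h by (simp add: fourier_null_def)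
  then have hm: "h \<in> borel_measurable \<mu>" by (rule borel_measurable_integrable)
  have z: "(LINT t|\<mu>. indicator A t *\<^sub>R h t) = 0" if A: "A \<in> sets \<mu>" for A
  proof -
    obtain S N N' where S: "A = S \<union> N" "N \<subseteq> N'"
        "N' \<in> null_sets (distr (uniform_measure lborel {0..<2 * pi}) borel cis)"
        "S \<in> sets (distr (uniform_measure lborel {0..<2 * pi}) borel cis)"
      using A unfolding circle_measure_def by (rule sets_completionE)
    have SB: "S \<in> sets borel" using S by simp
    have "AE t in \<mu>. t \<notin> N'"
      unfolding circle_measure_def using S(3) by (intro AE_not_in null_sets_completionI)
    then have "AE t in \<mu>. indicator A t *\<^sub>R h t = of_real (indicator S t) * h t"
      by eventually_elim (use S in \<open>auto split: split_indicator simp: scaleR_conv_of_real\<close>)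
    then have "(LINT t|\<mu>. indicator A t *\<^sub>R h t) = (LINT t|\<mu>. of_real (indicator S t) * h t)"
      using A sets_borel_circle[OF SB] hm by (intro integral_cong_AE) auto
    then show ?thesis using fourier_null_borel[OF SB h] by simp
  qed
  have i: "integrable \<mu> (\<lambda>t. indicator A t *\<^sub>R h t)" if "A \<in> sets \<mu>" for A
    using hi that by (intro integrable_mult_indicator)
  have "AE t in \<mu>. Re (h t) = 0"
  proof (rule density_unique_real)
    fix A assume A: "A \<in> sets \<mu>"
    show "(LINT t:A|\<mu>. Re (h t)) = (LINT t:A|\<mu>. 0)"
      using z[OF A] integral_Re[OF i[OF A]] by (simp add: set_lebesgue_integral_def)
  qed (use hi in auto)
  moreover have "AE t in \<mu>. Im (h t) = 0"
  proof (rule density_unique_real)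
    fix A assume A: "A \<in> sets \<mu>"
    show "(LINT t:A|\<mu>. Im (h t)) = (LINT t:A|\<mu>. 0)"
      using z[OF A] integral_Im[OF i[OF A]] by (simp add: set_lebesgue_integral_def)
  qed (use hi in auto)
  ultimately show ?thesis by eventually_elim (simp add: complex_eq_iff)
qed

section \<open>The Hilbert space of square integrable functions\<close>

lemma L2_measurable: "f \<in> L2 \<Longrightarrow> f \<in> borel_measurable \<mu>"
  by (simp add: L2_def)

lemma L2_integrable_sq: "f \<in> L2 \<Longrightarrow> integrable \<mu> (\<lambda>t. (norm (f t))\<^sup>2)"
  by (simp add: L2_def)

lemma L2I:
  assumes f: "f \<in> borel_measurable \<mu>" and g: "integrable \<mu> g"
    and le: "AE t in \<mu>. (norm (f t))\<^sup>2 \<le> g t"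
  shows "f \<in> L2"
proof -
  have "integrable \<mu> (\<lambda>t. (norm (f t))\<^sup>2)"
  proof (rule Bochner_Integration.integrable_bound[OF g])
    show "AE t in \<mu>. norm ((norm (f t))\<^sup>2) \<le> norm (g t)"
      using le by eventually_elim auto
  qed (use f in measurable)
  then show ?thesis using f by (simp add: L2_def)
qed

lemma L2_cong_AE:
  "\<lbrakk>f \<in> L2; g \<in> borel_measurable \<mu>; AE t in \<mu>. g t = f t\<rbrakk> \<Longrightarrow> g \<in> L2"
  by (rule L2I[of g "\<lambda>t. (norm (f t))\<^sup>2"]) (auto simp: L2_integrable_sq)

lemma L2_mult_bounded:
  assumes f: "f \<in> L2" and g: "g \<in> borel_measurable \<mu>"
    and B: "AE t in \<mu>. norm (g t) \<le> B"
  shows "(\<lambda>t. g t * f t) \<in> L2"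
proof (rule L2I)
  show "(\<lambda>t. g t * f t) \<in> borel_measurable \<mu>"
    using L2_measurable[OF f] g by measurable
  show "integrable \<mu> (\<lambda>t. B\<^sup>2 * (norm (f t))\<^sup>2)"
    using L2_integrable_sq[OF f] by simp
  show "AE t in \<mu>. (norm (g t * f t))\<^sup>2 \<le> B\<^sup>2 * (norm (f t))\<^sup>2"
    using B by eventually_elim
      (simp add: norm_mult power_mult_distrib mult_right_mono power_mono)
qed

lemma L2_bounded:
  assumes "g \<in> borel_measurable \<mu>" "AE t in \<mu>. norm (g t) \<le> B"
  shows "g \<in> L2"
proof -
  have "(\<lambda>_. 1) \<in> L2" by (simp add: L2_def)
  from L2_mult_bounded[OF this assms] show ?thesis by simp
qed

lemma L2_powi: "(\<lambda>t. t powi k) \<in> L2"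
  using AE_circle_powi[of k] by (intro L2_bounded[where B = 1] borel_measurable_circle) auto

lemma L2_powi_mult: "f \<in> L2 \<Longrightarrow> (\<lambda>t. t powi k * f t) \<in> L2"
  using AE_circle_powi[of k] by (intro L2_mult_bounded[where B = 1] borel_measurable_circle) auto

lemma L2_add: "f \<in> L2 \<Longrightarrow> g \<in> L2 \<Longrightarrow> (\<lambda>t. f t + g t) \<in> L2"
proof (rule L2I)
  assume f: "f \<in> L2" and g: "g \<in> L2"
  show "(\<lambda>t. f t + g t) \<in> borel_measurable \<mu>"
    using L2_measurable[OF f] L2_measurable[OF g] by measurable
  show "integrable \<mu> (\<lambda>t. 2 * (norm (f t))\<^sup>2 + 2 * (norm (g t))\<^sup>2)"
    using L2_integrable_sq[OF f] L2_integrable_sq[OF g] by simp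
  have "(norm (f t + g t))\<^sup>2 \<le> 2 * (norm (f t))\<^sup>2 + 2 * (norm (g t))\<^sup>2" for t
  proof -
    have "(norm (f t + g t))\<^sup>2 \<le> (norm (f t) + norm (g t))\<^sup>2"
      by (intro power_mono norm_triangle_ineq) simp
    also have "\<dots> \<le> 2 * (norm (f t))\<^sup>2 + 2 * (norm (g t))\<^sup>2"
      using sum_squares_bound[of "norm (f t)" "norm (g t)"] by (simp add: power2_sum)
    finally show ?thesis .
  qed
  then show "AE t in \<mu>. (norm (f t + g t))\<^sup>2 \<le> 2 * (norm (f t))\<^sup>2 + 2 * (norm (g t))\<^sup>2"
    by simp
qed

lemma L2_cmult: "f \<in> L2 \<Longrightarrow> (\<lambda>t. c * f t) \<in> L2"
  by (rule L2_mult_bounded[where B = "norm c"]) auto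

lemma L2_diff: "f \<in> L2 \<Longrightarrow> g \<in> L2 \<Longrightarrow> (\<lambda>t. f t - g t) \<in> L2"
  using L2_add[of f "\<lambda>t. (-1) * g t"] L2_cmult[of g "-1"] by simp

lemma L2_cnj: "f \<in> L2 \<Longrightarrow> (\<lambda>t. cnj (f t)) \<in> L2"
  using borel_measurable_continuous_onI[OF continuous_on_cnj[OF continuous_on_id]]
  by (auto simp: L2_def intro: measurable_compose[of _ _ borel cnj])

lemma borel_measurable_cnj [measurable]: "cnj \<in> borel_measurable borel"
  by (intro borel_measurable_continuous_onI continuous_intros)

lemma L2_integrable_inner:
  assumes f: "f \<in> L2" and g: "g \<in> L2"
  shows "integrable \<mu> (\<lambda>t. cnj (g t) * f t)"
proof (rule Bochner_Integration.integrable_bound)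
  show "integrable \<mu> (\<lambda>t. (norm (f t))\<^sup>2 + (norm (g t))\<^sup>2)"
    using L2_integrable_sq[OF f] L2_integrable_sq[OF g] by simp
  show "(\<lambda>t. cnj (g t) * f t) \<in> borel_measurable \<mu>"
    using L2_measurable[OF f] L2_measurable[OF g] by measurable
  have "norm (cnj (g t) * f t) \<le> (norm (f t))\<^sup>2 + (norm (g t))\<^sup>2" for t
  proof -
    have "norm (cnj (g t) * f t) = norm (f t) * norm (g t)" by (simp add: norm_mult)
    moreover have "0 \<le> norm (f t) * norm (g t)" by simp
    ultimately show ?thesis
      using sum_squares_bound[of "norm (f t)" "norm (g t)"] by linarith
  qed
  then show "AE t in \<mu>. norm (cnj (g t) * f t) \<le> norm ((norm (f t))\<^sup>2 + (norm (g t))\<^sup>2)"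
    by simp
qed

lemma L2_integrable_mult: "f \<in> L2 \<Longrightarrow> g \<in> L2 \<Longrightarrow> integrable \<mu> (\<lambda>t. g t * f t)"
  using L2_integrable_inner[of f "\<lambda>t. cnj (g t)"] L2_cnj[of g] by simp

lemma L2_integrable: "f \<in> L2 \<Longrightarrow> integrable \<mu> f"
  using L2_integrable_mult[of f "\<lambda>t. t powi 0"] L2_powi[of 0] by simp

lemma L2_inner_self: "L2_inner f f = of_real (LINT t|\<mu>. (norm (f t))\<^sup>2)"
proof -
  have "cnj (f t) * f t = of_real ((norm (f t))\<^sup>2)" for t
    using complex_norm_square[of "f t"] by (simp add: mult.commute)
  then have "L2_inner f f = (LINT t|\<mu>. complex_of_real ((norm (f t))\<^sup>2))"
    unfolding L2_inner_def by (simp only:)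
  also have "\<dots> = of_real (LINT t|\<mu>. (norm (f t))\<^sup>2)" by (rule integral_complex_of_real)
  finally show ?thesis .
qed

lemma L1_le_L2:
  assumes f: "f \<in> L2" and e: "e > 0" and le: "(LINT t|\<mu>. (norm (f t))\<^sup>2) < e\<^sup>2"
  shows "(LINT t|\<mu>. norm (f t)) < e"
proof -
  note i = L2_integrable_sq[OF f]
  \<comment> \<open>Arithmetic-geometric mean inequality; the total mass 1 turns the constant
    \<open>e\<close> into its own integral.\<close>
  have "norm (f t) \<le> ((norm (f t))\<^sup>2 / e + e) / 2" for t
    using sum_squares_bound[of "norm (f t)" e] e by (simp add: field_simps power2_eq_square)
  then have "(LINT t|\<mu>. norm (f t)) \<le> (LINT t|\<mu>. ((norm (f t))\<^sup>2 / e + e) / 2)"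
    using i L2_integrable[OF f] by (intro integral_mono) auto
  also have "\<dots> = ((LINT t|\<mu>. (norm (f t))\<^sup>2) / e + e) / 2"
    using i by simp
  also have "\<dots> < (e\<^sup>2 / e + e) / 2" using le e by (simp add: divide_strict_right_mono)
  also have "\<dots> = e" using e by (simp add: power2_eq_square)
  finally show ?thesis .
qed

text \<open>Riesz-Fischer. As the measure is finite, a Cauchy sequence in quadratic mean is Cauchy
  in mean and has an almost everywhere convergent subsequence; Fatou's lemma makes its limit a limit
  in quadratic mean.\<close>

theorem L2_complete:
  fixes X :: "nat \<Rightarrow> complex \<Rightarrow> complex"
  assumes X: "\<And>n. X n \<in> L2"
    and cau: "\<And>\<epsilon>. \<epsilon> > 0 \<Longrightarrow> \<exists>N. \<forall>i\<ge>N. \<forall>j\<ge>N. (LINT t|\<mu>. (norm (X i t - X j t))\<^sup>2) < \<epsilon>"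
  shows "\<exists>x\<in>L2. \<forall>\<epsilon>>0. \<exists>N. \<forall>i\<ge>N. (LINT t|\<mu>. (norm (X i t - x t))\<^sup>2) < \<epsilon>"
proof -
  have Xm [measurable]: "X n \<in> borel_measurable \<mu>" for n using X by (rule L2_measurable)
  have "\<exists>N. \<forall>i\<ge>N. \<forall>j\<ge>N. (LINT t|\<mu>. norm (X i t - X j t)) < e" if e: "e > 0" for e :: real
  proof -
    have "e\<^sup>2 > 0" using e by simp
    then obtain N where "\<forall>i\<ge>N. \<forall>j\<ge>N. (LINT t|\<mu>. (norm (X i t - X j t))\<^sup>2) < e\<^sup>2"
      using cau by blast
    then show ?thesis using L1_le_L2[OF L2_diff[OF X X] e] by blast
  qed
  then obtain r where r: "strict_mono r" "AE t in \<mu>. Cauchy (\<lambda>i. X (r i) t)"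
    using cauchy_L1_AE_cauchy_subseq[of \<mu> X] L2_integrable[OF X] by metis
  define x where "x t = lim (\<lambda>i. X (r i) t)" for t
  have xm [measurable]: "x \<in> borel_measurable \<mu>"
    unfolding x_def by (rule borel_measurable_lim_metric) measurable
  have lim: "AE t in \<mu>. (\<lambda>i. X (r i) t) \<longlonglongrightarrow> x t"
    using r(2) by eventually_elim (simp add: x_def Cauchy_convergent_iff convergent_LIMSEQ_iff)
  have Fatou: "(\<integral>\<^sup>+t. ennreal ((norm (X i t - x t))\<^sup>2) \<partial>\<mu>) \<le> ennreal \<epsilon>"
    if N: "\<forall>i\<ge>N. \<forall>j\<ge>N. (LINT t|\<mu>. (norm (X i t - X j t))\<^sup>2) < \<epsilon>" and i: "i \<ge> N" for N i \<epsilon>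
  proof -
    have "(\<integral>\<^sup>+t. ennreal ((norm (X i t - x t))\<^sup>2) \<partial>\<mu>)
        = (\<integral>\<^sup>+t. liminf (\<lambda>k. ennreal ((norm (X i t - X (r k) t))\<^sup>2)) \<partial>\<mu>)"
    proof (rule nn_integral_cong_AE)
      show "AE t in \<mu>. ennreal ((norm (X i t - x t))\<^sup>2)
          = liminf (\<lambda>k. ennreal ((norm (X i t - X (r k) t))\<^sup>2))"
        using lim
      proof eventually_elim
        case (elim t)
        have "(\<lambda>k. ennreal ((norm (X i t - X (r k) t))\<^sup>2)) \<longlonglongrightarrow> ennreal ((norm (X i t - x t))\<^sup>2)"
          by (intro tendsto_intros elim) 
        from lim_imp_Liminf[OF trivial_limit_sequentially this] show ?case by simp
      qed
    qed
    also have "\<dots> \<le> liminf (\<lambda>k. \<integral>\<^sup>+t. ennreal ((norm (X i t - X (r k) t))\<^sup>2) \<partial>\<mu>)"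
      by (rule nn_integral_liminf) measurable
    also have "\<dots> \<le> liminf (\<lambda>k. ennreal \<epsilon>)"
    proof (rule Liminf_mono, rule eventually_sequentiallyI[of N])
      fix k assume "N \<le> k"
      then have k: "N \<le> r k" using seq_suble[OF r(1), of k] by linarith
      have "(\<integral>\<^sup>+t. ennreal ((norm (X i t - X (r k) t))\<^sup>2) \<partial>\<mu>)
          = ennreal (LINT t|\<mu>. (norm (X i t - X (r k) t))\<^sup>2)"
        using L2_integrable_sq[OF L2_diff[OF X X]] by (intro nn_integral_eq_integral) auto
      also have "\<dots> \<le> ennreal \<epsilon>"
        using N i k by (intro ennreal_leI) (auto intro: less_imp_le)
      finally show "(\<integral>\<^sup>+t. ennreal ((norm (X i t - X (r k) t))\<^sup>2) \<partial>\<mu>) \<le> ennreal \<epsilon>" .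
    qed
    also have "\<dots> = ennreal \<epsilon>" by (simp add: Liminf_const)
    finally show ?thesis .
  qed
  have d_L2: "(\<lambda>t. X i t - x t) \<in> L2"
    if N: "\<forall>i\<ge>N. \<forall>j\<ge>N. (LINT t|\<mu>. (norm (X i t - X j t))\<^sup>2) < \<epsilon>" and i: "i \<ge> N" for N i \<epsilon>
  proof -
    have "integrable \<mu> (\<lambda>t. (norm (X i t - x t))\<^sup>2)"
    proof (rule integrableI_bounded)
      have "(\<integral>\<^sup>+t. ennreal (norm ((norm (X i t - x t))\<^sup>2)) \<partial>\<mu>) \<le> ennreal \<epsilon>"
        using Fatou[OF N i] by simp
      then show "(\<integral>\<^sup>+t. ennreal (norm ((norm (X i t - x t))\<^sup>2)) \<partial>\<mu>) < \<infinity>"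
        using ennreal_less_top le_less_trans by (metis infinity_ennreal_def)
    qed measurable
    then show ?thesis by (simp add: L2_def)
  qed
  obtain N1 where N1: "\<forall>i\<ge>N1. \<forall>j\<ge>N1. (LINT t|\<mu>. (norm (X i t - X j t))\<^sup>2) < 1"
    using cau[of 1] by auto
  have "x \<in> L2"
    using L2_diff[OF X d_L2[OF N1 order_refl], of N1] by simp
  moreover have "\<exists>N. \<forall>i\<ge>N. (LINT t|\<mu>. (norm (X i t - x t))\<^sup>2) < \<epsilon>" if e: "\<epsilon> > 0" for \<epsilon>
  proof -
    have "\<epsilon>/2 > 0" using e by simp
    then obtain N where N: "\<forall>i\<ge>N. \<forall>j\<ge>N. (LINT t|\<mu>. (norm (X i t - X j t))\<^sup>2) < \<epsilon>/2"
      using cau by blast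
    have "(LINT t|\<mu>. (norm (X i t - x t))\<^sup>2) < \<epsilon>" if i: "i \<ge> N" for i
    proof -
      have "ennreal (LINT t|\<mu>. (norm (X i t - x t))\<^sup>2) \<le> ennreal (\<epsilon>/2)"
        using Fatou[OF N i] L2_integrable_sq[OF d_L2[OF N i]] by (subst nn_integral_eq_integral[symmetric]) auto
      then have "(LINT t|\<mu>. (norm (X i t - x t))\<^sup>2) \<le> \<epsilon>/2" using e by simp
      then show ?thesis using e by simp
    qed
    then show ?thesis by blast
  qed
  ultimately show ?thesis by blast
qed

lemma vector_space_fun: "vector_space (\<lambda>c (f :: complex \<Rightarrow> complex) t. c * f t)"
  by standard (auto simp: fun_eq_iff algebra_simps)

global_interpretation L2: semi_hilbert "\<lambda>c f t. c * f t" L2 L2_inner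
proof (rule semi_hilbert.intro[OF vector_space_fun], rule semi_hilbert_axioms.intro)
  interpret vector_space "\<lambda>c (f :: complex \<Rightarrow> complex) t. c * f t" by (rule vector_space_fun)
  show "subspace L2"
  proof (rule subspaceI)
    show "0 \<in> L2" using L2_cmult[OF L2_powi[of 0], of 0] by (simp add: zero_fun_def)
  qed (auto simp: plus_fun_def L2_add L2_cmult)
  show "L2_inner (x + y) z = L2_inner x z + L2_inner y z" if "x \<in> L2" "y \<in> L2" "z \<in> L2" for x y z
    using that by (simp add: L2_inner_def distrib_left L2_integrable_inner)
  show "L2_inner (\<lambda>t. c * x t) y = c * L2_inner x y" if "x \<in> L2" "y \<in> L2" for x y c
    using that by (simp add: L2_inner_def mult.left_commute[of _ c])
  show "L2_inner y x = cnj (L2_inner x y)" for x y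
    unfolding L2_inner_def by (subst Bochner_Integration.integral_cnj[symmetric]) (simp add: mult.commute del: Bochner_Integration.integral_cnj)
  show "0 \<le> Re (L2_inner x x)" for x
    by (simp add: L2_inner_self)
  fix X :: "nat \<Rightarrow> complex \<Rightarrow> complex"
  assume X: "\<And>n. X n \<in> L2" and cau: "\<And>\<epsilon>. \<epsilon> > 0 \<Longrightarrow>
    \<exists>N. \<forall>i\<ge>N. \<forall>j\<ge>N. sqrt (Re (L2_inner (X i - X j) (X i - X j))) < \<epsilon>"
  have "\<exists>x\<in>L2. \<forall>\<epsilon>>0. \<exists>N. \<forall>i\<ge>N. (LINT t|\<mu>. (norm (X i t - x t))\<^sup>2) < \<epsilon>"
  proof (rule L2_complete[OF X])
    fix \<epsilon> :: real assume "\<epsilon> > 0"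
    then have "sqrt \<epsilon> > 0" by simp
    from cau[OF this] show "\<exists>N. \<forall>i\<ge>N. \<forall>j\<ge>N. (LINT t|\<mu>. (norm (X i t - X j t))\<^sup>2) < \<epsilon>"
      by (simp add: L2_inner_self)
  qed
  then obtain x where x: "x \<in> L2"
    "\<And>\<epsilon>. \<epsilon> > 0 \<Longrightarrow> \<exists>N. \<forall>i\<ge>N. (LINT t|\<mu>. (norm (X i t - x t))\<^sup>2) < \<epsilon>" by blast
  have "\<exists>N. \<forall>i\<ge>N. sqrt (Re (L2_inner (X i - x) (X i - x))) < \<epsilon>" if "\<epsilon> > 0" for \<epsilon>
  proof -
    have "\<epsilon>\<^sup>2 > 0" using that by simp
    from x(2)[OF this] obtain N where "\<forall>i\<ge>N. (LINT t|\<mu>. (norm (X i t - x t))\<^sup>2) < \<epsilon>\<^sup>2" by blast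
    then show ?thesis
      using that by (intro exI[of _ N]) (auto simp: L2_inner_self intro: real_less_lsqrt)
  qed
  then show "\<exists>x\<in>L2. \<forall>\<epsilon>>0. \<exists>N. \<forall>i\<ge>N. sqrt (Re (L2_inner (X i - x) (X i - x))) < \<epsilon>"
    using x(1) by blast
qed

lemma L2_nrm: "L2.nrm f = sqrt (LINT t|\<mu>. (norm (f t))\<^sup>2)"
  by (simp add: L2.nrm_def L2_inner_self)

lemma L2_nrm_0_AE: "f \<in> L2 \<Longrightarrow> L2.nrm f = 0 \<longleftrightarrow> (AE t in \<mu>. f t = 0)"
  using integral_nonneg_eq_0_iff_AE[OF L2_integrable_sq[of f]] by (simp add: L2_nrm)

lemma L2_inner_powi: "L2_inner f (\<lambda>t. t powi k) = (LINT t|\<mu>. t powi (- k) * f t)"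
  if "f \<in> borel_measurable \<mu>"
  unfolding L2_inner_def
proof (rule integral_cong_AE)
  have [measurable]: "(\<lambda>t. t powi k) \<in> borel_measurable \<mu>" for k
    by (rule borel_measurable_circle) simp
  note [measurable] = that
  show "AE t in \<mu>. cnj (t powi k) * f t = t powi (- k) * f t"
    using AE_circle_norm by eventually_elim (simp add: circle_cnj_powi flip: circle_cnj_powi)
  show "(\<lambda>t. cnj (t powi k) * f t) \<in> borel_measurable \<mu>"
    "(\<lambda>t. t powi (- k) * f t) \<in> borel_measurable \<mu>"
    by measurable
qed

lemma L2_fourier_null:
  assumes f: "f \<in> L2" and z: "\<And>k. L2_inner f (\<lambda>t. t powi k) = 0"
  shows "AE t in \<mu>. f t = 0"
proof (rule fourier_null_AE)
  have "(LINT t|\<mu>. t powi k * f t) = 0" for k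
    using L2_inner_powi[OF L2_measurable[OF f], of "- k"] z by simp
  then show "fourier_null f" using L2_integrable[OF f] by (simp add: fourier_null_def)
qed

lemma L2_inner_powi_powi: "L2_inner (\<lambda>t. t powi j) (\<lambda>t. t powi k) = (if j = k then 1 else 0)"
proof -
  have [measurable]: "(\<lambda>t. t powi k) \<in> borel_measurable \<mu>" for k
    by (rule borel_measurable_circle) simp
  have "L2_inner (\<lambda>t. t powi j) (\<lambda>t. t powi k) = (LINT t|\<mu>. t powi (j - k))"
  proof (subst L2_inner_powi, measurable, rule integral_cong_AE)
    show "AE t in \<mu>. t powi (- k) * t powi j = t powi (j - k)"
      using AE_circle_norm
    proof eventually_elim
      case (elim t)
      then have "t \<noteq> 0" by auto
      then show ?case by (simp flip: power_int_add)
    qed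
  qed measurable
  then show ?thesis by (simp add: integral_powi)
qed

text \<open>Both Hardy spaces are handled at once: \<open>J\<close> is a set of frequencies.\<close>

lemma L2_cl_span_powi:
  assumes f: "f \<in> L2" and z: "\<And>k. k \<notin> J \<Longrightarrow> L2_inner f (\<lambda>t. t powi k) = 0"
  shows "f \<in> L2.cl (L2.span ((\<lambda>k t. t powi k) ` J))"
proof -
  define S :: "(complex \<Rightarrow> complex) set" where "S = (\<lambda>k t. t powi k) ` J"
  have S: "S \<subseteq> L2" using L2_powi by (auto simp: S_def)
  obtain p where p: "p \<in> L2.cl (L2.span S)" "\<And>g. g \<in> L2.cl (L2.span S) \<Longrightarrow> L2_inner (f - p) g = 0"
    using L2.projection[OF L2.subspace_span L2.span_subset_V[OF S] f] by blast
  have pL: "p \<in> L2" using p(1) by (rule L2.cl_V)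
  have "L2_inner (f - p) (\<lambda>t. t powi k) = 0" for k
  proof (cases "k \<in> J")
    case True
    then have "(\<lambda>t. t powi k) \<in> L2.cl (L2.span S)" using L2.subset_cl_span[OF S] by (auto simp: S_def)
    then show ?thesis by (rule p(2))
  next
    case False
    have "L2_inner (\<lambda>t. t powi k) p = 0"
      by (rule L2.orthogonal_cl_span[OF L2_powi S _ p(1)])
        (use False in \<open>auto simp: S_def L2_inner_powi_powi\<close>)
    then have "L2_inner p (\<lambda>t. t powi k) = 0" using L2.ip_eq_0_sym L2_powi pL by blast
    then show ?thesis using L2.ip_diff_left[OF f pL L2_powi] z[OF False] by simp
  qed
  then have "AE t in \<mu>. (f - p) t = 0"
    using L2.V_diff[OF f pL] by (rule L2_fourier_null[rotated])
  then have "L2.nrm (f - p) = 0" using L2_nrm_0_AE f pL by blast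
  then show ?thesis using L2.cl_add_null[OF p(1) f] by (simp add: S_def)
qed

section \<open>Szego's inequality\<close>

text \<open>The mean value property of the harmonic function ln |1 - c t|, obtained by integrating
  the power series of the logarithm term by term.\<close>

lemma ln_norm_circle_integral:
  assumes c: "norm c < 1"
  shows "integrable \<mu> (\<lambda>t. ln (norm (1 - c * t)))"
    and "(LINT t|\<mu>. ln (norm (1 - c * t))) = 0"
proof -
  \<comment> \<open>The series runs from \<open>n = 0\<close>, where division by zero makes the term
    vanish, as in \<open>Ln_series'\<close>.\<close>
  define g where "g n t = - (c ^ n / of_nat n) * t powi int n" for n and t :: complex
  define f where "f n t = Re (g n t)" for n t
  have gi: "integrable \<mu> (g n)" for n
    unfolding g_def using L2_integrable[OF L2_powi] by (rule integrable_mult_right)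
  have fi: "integrable \<mu> (f n)" for n
    unfolding f_def using gi[of n] by simp
  have f0: "(LINT t|\<mu>. f n t) = 0" for n
  proof -
    have "(LINT t|\<mu>. g n t) = 0"
      using integral_powi[of "int n"] by (cases "n = 0") (simp_all add: g_def)
    then show ?thesis unfolding f_def using integral_Re[OF gi[of n]] by simp
  qed
  have bd: "norm (f n t) \<le> norm c ^ n" if "norm t = 1" for n t
  proof (cases "n = 0")
    case False
    have "norm (f n t) \<le> norm (g n t)" using abs_Re_le_cmod by (simp add: f_def)
    also have "norm (g n t) = norm c ^ n / real n"
      using that by (simp add: g_def norm_divide norm_power norm_mult)
    also have "\<dots> \<le> norm c ^ n / 1" using False by (intro divide_left_mono) auto
    finally show ?thesis by simp
  qed (simp add: f_def g_def)
  have sc: "summable (\<lambda>n. norm c ^ n)" using c by (simp add: summable_geometric)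
  have sn: "summable (\<lambda>n. norm (f n t))" if "norm t = 1" for t
    using bd[OF that] by (intro summable_comparison_test[OF _ sc]) auto
  have "(LINT t|\<mu>. norm (f n t)) \<le> norm c ^ n" for n
  proof -
    have "(LINT t|\<mu>. norm (f n t)) \<le> (LINT t|\<mu>. norm c ^ n)"
    proof (rule integral_mono_AE)
      show "AE t in \<mu>. norm (f n t) \<le> norm c ^ n"
        using AE_circle_norm by eventually_elim (rule bd)
    qed (use fi in auto)
    then show ?thesis by simp
  qed
  then have si: "summable (\<lambda>n. LINT t|\<mu>. norm (f n t))"
    by (intro summable_comparison_test[OF _ sc]) auto
  have sum: "AE t in \<mu>. summable (\<lambda>n. norm (f n t))"
    using AE_circle_norm by eventually_elim (rule sn)
  have eq: "AE t in \<mu>. ln (norm (1 - c * t)) = (\<Sum>n. f n t)"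
    using AE_circle_norm
  proof eventually_elim
    case (elim t)
    then have n: "norm (c * t) < 1" using c by (simp add: norm_mult)
    then have "1 - c * t \<noteq> 0" by auto
    moreover have "(\<lambda>n. g n t) sums Ln (1 + - (c * t))"
      using Ln_series'[of "- (c * t)"] n by (simp add: g_def power_mult_distrib)
    then have "(\<lambda>n. f n t) sums Re (Ln (1 - c * t))" unfolding f_def by (intro sums_Re) simp
    ultimately show ?case by (simp add: sums_iff)
  qed
  have m: "(\<lambda>t. ln (norm (1 - c * t))) \<in> borel_measurable \<mu>"
    by (rule borel_measurable_circle) measurable
  note S = integrable_suminf[OF fi sum si]
  show "integrable \<mu> (\<lambda>t. ln (norm (1 - c * t)))"
    using S integrable_cong_AE[OF m borel_measurable_integrable[OF S] eq] by simp
  have "(LINT t|\<mu>. ln (norm (1 - c * t))) = (LINT t|\<mu>. (\<Sum>n. f n t))"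
    by (rule integral_cong_AE[OF m borel_measurable_integrable[OF S] eq])
  also have "\<dots> = 0" using sums_integral[OF fi sum si] f0 by (simp add: sums_iff)
  finally show "(LINT t|\<mu>. ln (norm (1 - c * t))) = 0" .
qed

text \<open>The modulus of a polynomial with constant term 1 in factored form. Nonzero entries are
  reciprocals of its zeros, so \<open>norm c < 1\<close> keeps a zero outside the closed
  disk.\<close>

definition abs_prod :: "complex list \<Rightarrow> complex \<Rightarrow> real" where
  "abs_prod cs t = (\<Prod>c\<leftarrow>cs. norm (1 - c * t))"

lemma abs_prod_Nil [simp]: "abs_prod [] t = 1"
  and abs_prod_Cons [simp]: "abs_prod (c # cs) t = norm (1 - c * t) * abs_prod cs t"
  by (simp_all add: abs_prod_def)

lemma abs_prod_nonneg [simp]: "0 \<le> abs_prod cs t"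
  by (induction cs) auto

lemma abs_prod_measurable [measurable]: "abs_prod cs \<in> borel_measurable borel"
proof (induction cs)
  case (Cons c cs)
  note [measurable] = Cons
  have "(\<lambda>t. norm (1 - c * t) * abs_prod cs t) \<in> borel_measurable borel" by measurable
  then show ?case by (simp flip: abs_prod_Cons)
qed (simp add: abs_prod_def)

lemma abs_prod_bound:
  "\<forall>c\<in>set cs. norm c \<le> 1 \<Longrightarrow> norm t = 1 \<Longrightarrow> abs_prod cs t \<le> 2 ^ length cs"
proof (induction cs)
  case (Cons c cs)
  have "norm (1 - c * t) \<le> 1 + norm (c * t)" by (metis norm_one norm_triangle_ineq4)
  also have "\<dots> \<le> 2" using Cons by (simp add: norm_mult)
  finally show ?case using Cons by (simp add: mult_mono)
qed simp

lemma ln_abs_prod: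
  assumes "\<forall>c\<in>set cs. norm c < 1"
  shows "(AE t in \<mu>. 0 < abs_prod cs t) \<and>
    integrable \<mu> (\<lambda>t. ln (abs_prod cs t)) \<and>
    (LINT t|\<mu>. ln (abs_prod cs t)) = 0"
  using assms
proof (induction cs)
  case (Cons c cs)
  then have IH: "AE t in \<mu>. 0 < abs_prod cs t"
      "integrable \<mu> (\<lambda>t. ln (abs_prod cs t))"
      "(LINT t|\<mu>. ln (abs_prod cs t)) = 0" and c: "norm c < 1"
    by auto
  have nz: "AE t in \<mu>. 0 < norm (1 - c * t)"
    using AE_circle_norm
  proof eventually_elim
    case (elim t)
    then have "norm (c * t) < 1" using c by (simp add: norm_mult)
    then show ?case by auto
  qed
  note L = ln_norm_circle_integral[OF c]
  have eq: "AE t in \<mu>. ln (abs_prod (c # cs) t) = ln (norm (1 - c * t)) + ln (abs_prod cs t)"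
    using nz IH(1) by eventually_elim (simp add: ln_mult)
  have m: "(\<lambda>t. ln (abs_prod (c # cs) t)) \<in> borel_measurable \<mu>"
    by (rule borel_measurable_circle) (simp del: abs_prod_Cons)
  have i: "integrable \<mu> (\<lambda>t. ln (norm (1 - c * t)) + ln (abs_prod cs t))"
    using L(1) IH(2) by simp
  note m' = borel_measurable_integrable[OF i]
  have "AE t in \<mu>. 0 < abs_prod (c # cs) t"
    using nz IH(1) by eventually_elim simp
  moreover have "integrable \<mu> (\<lambda>t. ln (abs_prod (c # cs) t))"
    using i integrable_cong_AE[OF m m' eq] by simp
  moreover have "(LINT t|\<mu>. ln (abs_prod (c # cs) t)) = 0"
    using L IH integral_cong_AE[OF m m' eq] by simp
  ultimately show ?case by blast
qed simp

text \<open>Jensen's inequality, from the tangent of \<open>exp\<close> at the mean \<open>m\<close>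
  of the logarithm.\<close>

lemma exp_integral_ln_le:
  fixes g :: "complex \<Rightarrow> real"
  assumes g: "integrable \<mu> g" and pos: "AE t in \<mu>. 0 < g t"
    and l: "integrable \<mu> (\<lambda>t. ln (g t))"
  shows "exp (LINT t|\<mu>. ln (g t)) \<le> (LINT t|\<mu>. g t)"
proof -
  define m where "m = (LINT t|\<mu>. ln (g t))"
  have "(LINT t|\<mu>. exp m * (1 + (ln (g t) - m))) \<le> (LINT t|\<mu>. g t)"
  proof (rule integral_mono_AE)
    show "AE t in \<mu>. exp m * (1 + (ln (g t) - m)) \<le> g t"
      using pos
    proof eventually_elim
      case (elim t)
      have "exp m * (1 + (ln (g t) - m)) \<le> exp m * exp (ln (g t) - m)"
        by (intro mult_left_mono exp_ge_add_one_self) simp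
      also have "\<dots> = g t" using elim by (simp flip: exp_add)
      finally show ?case .
    qed
  qed (use g l in auto)
  moreover have "(LINT t|\<mu>. exp m * (1 + (ln (g t) - m))) = exp m"
    using l by (simp add: m_def)
  ultimately show ?thesis by (simp add: m_def)
qed

section \<open>Szego's lower bound for polynomials with constant term 1\<close>

context
  fixes w :: "complex \<Rightarrow> real"
  assumes w: "w \<in> borel_measurable \<mu>" and w_le: "AE t in \<mu>. w t \<le> 1"
    and log: "log_integrable w"
begin

lemma weight_pos: "AE t in \<mu>. 0 < w t"
  using log by (simp add: log_integrable_def)

lemma integrable_weight_mult:
  assumes g: "g \<in> borel_measurable \<mu>" and B: "AE t in \<mu>. norm (g t) \<le> B"
  shows "integrable \<mu> (\<lambda>t. w t * g t)"
proof (rule circle.integrable_const_bound)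
  show "AE t in \<mu>. norm (w t * g t) \<le> B"
    using B w_le weight_pos
  proof eventually_elim
    case (elim t)
    have "w t * norm (g t) \<le> 1 * norm (g t)" using elim by (intro mult_right_mono) auto
    then show ?case using elim by (simp add: abs_mult)
  qed
qed (use w g in measurable)

lemma integrable_abs_prod:
  assumes "\<forall>c\<in>set cs. norm c \<le> 1"
  shows "integrable \<mu> (\<lambda>t. w t * (abs_prod cs t)\<^sup>2)"
proof (rule integrable_weight_mult)
  show "(\<lambda>t. (abs_prod cs t)\<^sup>2) \<in> borel_measurable \<mu>"
    by (rule borel_measurable_circle) measurable
  show "AE t in \<mu>. norm ((abs_prod cs t)\<^sup>2) \<le> (2 ^ length cs)\<^sup>2"
    using AE_circle_norm by eventually_elim (simp add: power_mono abs_prod_bound[OF assms])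
qed

text \<open>With all zeros outside the closed disk the factors contribute nothing to the integral of
  the logarithm, so Jensen's inequality yields a bound independent of \<open>cs\<close>.\<close>

lemma szego_inside:
  assumes cs: "\<forall>c\<in>set cs. norm c < 1"
  shows "exp (LINT t|\<mu>. ln (w t)) \<le> (LINT t|\<mu>. w t * (abs_prod cs t)\<^sup>2)"
proof -
  note L = ln_abs_prod[OF cs]
  have li: "integrable \<mu> (\<lambda>t. ln (w t))" using log by (simp add: log_integrable_def)
  have eq: "AE t in \<mu>. ln (w t * (abs_prod cs t)\<^sup>2) = ln (w t) + 2 * ln (abs_prod cs t)"
    using weight_pos conjunct1[OF L] by eventually_elim (simp add: ln_mult ln_realpow)
  have i: "integrable \<mu> (\<lambda>t. ln (w t) + 2 * ln (abs_prod cs t))" using L li by simp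
  have gi: "integrable \<mu> (\<lambda>t. w t * (abs_prod cs t)\<^sup>2)"
    using cs by (intro integrable_abs_prod) (auto intro: less_imp_le)
  have m: "(\<lambda>t. ln (w t * (abs_prod cs t)\<^sup>2)) \<in> borel_measurable \<mu>"
    using borel_measurable_integrable[OF gi] by measurable
  have "exp (LINT t|\<mu>. ln (w t * (abs_prod cs t)\<^sup>2)) \<le> (LINT t|\<mu>. w t * (abs_prod cs t)\<^sup>2)"
  proof (rule exp_integral_ln_le[OF gi])
    show "AE t in \<mu>. 0 < w t * (abs_prod cs t)\<^sup>2"
      using weight_pos conjunct1[OF L] by eventually_elim simp
    show "integrable \<mu> (\<lambda>t. ln (w t * (abs_prod cs t)\<^sup>2))"
      using i integrable_cong_AE[OF m borel_measurable_integrable[OF i] eq] by simp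
  qed
  moreover have "(LINT t|\<mu>. ln (w t * (abs_prod cs t)\<^sup>2)) = (LINT t|\<mu>. ln (w t))"
    using integral_cong_AE[OF m borel_measurable_integrable[OF i] eq] L li by simp
  ultimately show ?thesis by simp
qed

text \<open>Zeros on the circle are moved outside by the scaling \<open>r n\<close>. The bound is
  the same for all \<open>n\<close> and passes to the limit by dominated convergence.\<close>

lemma szego_closed_disc:
  assumes cs: "\<forall>c\<in>set cs. norm c \<le> 1"
  shows "exp (LINT t|\<mu>. ln (w t)) \<le> (LINT t|\<mu>. w t * (abs_prod cs t)\<^sup>2)"
proof -
  define r where "r n = 1 - 1 / (real n + 2)" for n
  have r: "0 \<le> r n" "r n < 1" for n by (auto simp: r_def)
  have r_lim: "r \<longlonglongrightarrow> 1"
    unfolding r_def by real_asymp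
  define cs' where "cs' n = map (\<lambda>c. of_real (r n) * c) cs" for n
  have cs'1: "\<forall>c\<in>set (cs' n). norm c < 1" for n
  proof -
    have "r n * norm c < 1" if "norm c \<le> 1" for c :: complex
      using r[of n] that by (smt (verit) mult_left_le)
    then show ?thesis using cs r[of n] by (auto simp: cs'_def norm_mult)
  qed
  have lim: "(\<lambda>n. abs_prod (cs' n) t) \<longlonglongrightarrow> abs_prod cs t" for t
    unfolding cs'_def
  proof (induction cs)
    case (Cons c cs)
    have "(\<lambda>n. norm (1 - of_real (r n) * c * t)) \<longlonglongrightarrow> norm (1 - of_real 1 * c * t)"
      by (intro tendsto_intros r_lim)
    from tendsto_mult[OF this Cons] show ?case by simp
  qed simp
  have "(\<lambda>n. LINT t|\<mu>. w t * (abs_prod (cs' n) t)\<^sup>2) \<longlonglongrightarrow> (LINT t|\<mu>. w t * (abs_prod cs t)\<^sup>2)"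
  proof (rule integral_dominated_convergence[where w = "\<lambda>t. w t * (2 ^ length cs)\<^sup>2"])
    show "integrable \<mu> (\<lambda>t. w t * (2 ^ length cs)\<^sup>2)"
      by (rule integrable_weight_mult) auto
    show "AE t in \<mu>. (\<lambda>n. w t * (abs_prod (cs' n) t)\<^sup>2) \<longlonglongrightarrow> w t * (abs_prod cs t)\<^sup>2"
      by (intro AE_I2 tendsto_intros lim)
    show "AE t in \<mu>. norm (w t * (abs_prod (cs' n) t)\<^sup>2) \<le> w t * (2 ^ length cs)\<^sup>2" for n
      using weight_pos AE_circle_norm
    proof eventually_elim
      case (elim t)
      have "abs_prod (cs' n) t \<le> 2 ^ length (cs' n)"
        using cs'1[of n] elim by (intro abs_prod_bound) (auto intro: less_imp_le)
      then have "(abs_prod (cs' n) t)\<^sup>2 \<le> (2 ^ length cs)\<^sup>2"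
        by (intro power_mono) (auto simp: cs'_def)
      then show ?case using elim by (simp add: abs_mult mult_left_mono)
    qed
    show "(\<lambda>t. w t * (abs_prod (cs' n) t)\<^sup>2) \<in> borel_measurable \<mu>" for n
      using cs'1[of n] by (intro borel_measurable_integrable integrable_abs_prod) (auto intro: less_imp_le)
    show "(\<lambda>t. w t * (abs_prod cs t)\<^sup>2) \<in> borel_measurable \<mu>"
      by (intro borel_measurable_integrable integrable_abs_prod cs)
  qed
  then show ?thesis
    by (rule LIMSEQ_le_const) (use szego_inside cs'1 in blast)
qed

text \<open>A factor with its zero in the disk is reflected at the circle, which does not increase the
  modulus on the circle.\<close>

lemma abs_prod_reflect:
  assumes t: "norm t = 1"
  shows "abs_prod (map (\<lambda>c. if norm c > 1 then inverse (cnj c) else c) cs) t \<le> abs_prod cs t"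
proof (induction cs)
  case (Cons c cs)
  have "norm (1 - inverse (cnj c) * t) \<le> norm (1 - c * t)" if c: "norm c > 1"
  proof -
    have c0: "c \<noteq> 0" using c by auto
    have tt: "t * cnj t = 1" using t complex_norm_square[of t] by simp
    \<comment> \<open>On the circle, conjugation and multiplication by \<open>t\<close> show that
      the reflected factor has modulus \<open>norm (1 - c * t) / norm c\<close>.\<close>
    have "norm (1 - inverse (cnj c) * t) = norm (cnj (1 - inverse (cnj c) * t))" by (simp only: complex_mod_cnj)
    also have "\<dots> = norm (t * (1 - inverse c * cnj t))" using t by (simp add: norm_mult)
    also have "\<dots> = norm (t - inverse c * (t * cnj t))" by (simp add: algebra_simps)
    also have "t - inverse c * (t * cnj t) = inverse c * (c * t - 1)"
      using c0 by (simp add: tt field_simps)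
    also have "norm \<dots> = norm (inverse c) * norm (c * t - 1)" by (rule norm_mult)
    also have "\<dots> \<le> 1 * norm (c * t - 1)"
      using c by (intro mult_right_mono) (auto simp: norm_inverse inverse_le_1_iff)
    finally show ?thesis by (simp add: norm_minus_commute)
  qed
  then show ?case using Cons by (auto intro!: mult_mono)
qed simp

text \<open>The fundamental theorem of algebra, normalized at 0: as \<open>p\<close> does not vanish
  there, each linear factor and its cofactor can be scaled to constant term 1.\<close>

lemma poly_eq_prod_list:
  fixes p :: "complex poly"
  assumes "poly p 0 = 1"
  shows "\<exists>cs. \<forall>x. poly p x = (\<Prod>c\<leftarrow>cs. 1 - c * x)"
  using assms
proof (induction "degree p" arbitrary: p)
  case 0
  then obtain a where "p = [:a:]" using degree_eq_zeroE by metis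
  then show ?case using 0 by (intro exI[of _ "[]"]) auto
next
  case (Suc n)
  then have "\<not> constant (poly p)" by (simp add: constant_degree)
  then obtain z where z: "poly p z = 0" using fundamental_theorem_of_algebra by blast
  then have z0: "z \<noteq> 0" using Suc by auto
  obtain q where q: "p = [:- z, 1:] * q" using z poly_eq_0_iff_dvd by (metis dvdE)
  define q' where "q' = smult (- z) q"
  have pq: "poly p x = (1 - inverse z * x) * poly q' x" for x
    using z0 by (simp add: q q'_def field_simps)
  have "q \<noteq> 0" using Suc q by auto
  then have "degree p = 1 + degree q" unfolding q by (subst degree_mult_eq) auto
  then have "n = degree q'" using Suc z0 by (simp add: q'_def)
  moreover have "poly q' 0 = 1" using pq[of 0] Suc by simp
  ultimately obtain cs where "\<forall>x. poly q' x = (\<Prod>c\<leftarrow>cs. 1 - c * x)" using Suc by blast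
  then show ?case using pq by (intro exI[of _ "inverse z # cs"]) simp
qed

lemma norm_prod_list_abs_prod: "norm (\<Prod>c\<leftarrow>cs. 1 - c * t) = abs_prod cs t"
  by (induction cs) (auto simp: norm_mult)

text \<open>The reflected product keeps constant term 1 and has its reciprocal zeros in the closed
  disk, where the bound is known; on the circle it does not exceed
  \<open>norm (poly p t)\<close>.\<close>

theorem szego_inequality:
  assumes p: "poly p 0 = 1" and i: "integrable \<mu> (\<lambda>t. w t * (norm (poly p t))\<^sup>2)"
  shows "exp (LINT t|\<mu>. ln (w t)) \<le> (LINT t|\<mu>. w t * (norm (poly p t))\<^sup>2)"
proof -
  obtain cs where cs: "\<forall>x. poly p x = (\<Prod>c\<leftarrow>cs. 1 - c * x)" using poly_eq_prod_list[OF p] by blast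
  define cs' where "cs' = map (\<lambda>c. if norm c > 1 then inverse (cnj c) else c) cs"
  have 1: "\<forall>c\<in>set cs'. norm c \<le> 1"
    by (auto simp: cs'_def norm_inverse inverse_le_1_iff)
  have "exp (LINT t|\<mu>. ln (w t)) \<le> (LINT t|\<mu>. w t * (abs_prod cs' t)\<^sup>2)"
    by (rule szego_closed_disc[OF 1])
  also have "\<dots> \<le> (LINT t|\<mu>. w t * (norm (poly p t))\<^sup>2)"
  proof (rule integral_mono_AE[OF integrable_abs_prod[OF 1] i])
    show "AE t in \<mu>. w t * (abs_prod cs' t)\<^sup>2 \<le> w t * (norm (poly p t))\<^sup>2"
      using AE_circle_norm weight_pos
    proof eventually_elim
      case (elim t)
      have "abs_prod cs' t \<le> norm (poly p t)"
        using abs_prod_reflect[OF elim(1), of cs] by (simp add: cs cs'_def norm_prod_list_abs_prod)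
      then show ?case using elim by (intro mult_left_mono power_mono) auto
    qed
  qed
  finally show ?thesis .
qed

end

context
  fixes w :: "complex \<Rightarrow> real"
  assumes w: "w \<in> borel_measurable \<mu>" and w_le: "AE t in \<mu>. w t \<le> 1"
    and log: "log_integrable w"
begin

text \<open>The extremal function of Szego's problem: the normalized part \<open>u\<close> of \<open>sqrt w\<close> orthogonal to
  \<open>t sqrt w, t\<^sup>2 sqrt w, \<dots>\<close> is unimodular, because it is orthogonal to its own translates
  \<open>t u, t\<^sup>2 u, \<dots>\<close>.\<close>

theorem outer_function_ex:
  obtains \<phi> :: "complex \<Rightarrow> complex" where
    "\<phi> \<in> borel_measurable \<mu>" "AE t in \<mu>. (norm (\<phi> t))\<^sup>2 = w t"
    "\<And>k. k > 0 \<Longrightarrow> (LINT t|\<mu>. t powi k * \<phi> t) = 0"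
    "(LINT t|\<mu>. \<phi> t) \<noteq> 0"
proof -
  have w_pos: "AE t in \<mu>. 0 < w t" using log by (simp add: log_integrable_def)
  define s where "s t = complex_of_real (sqrt (w t))" for t
  have sm [measurable]: "s \<in> borel_measurable \<mu>"
    using w unfolding s_def by measurable
  have s1: "AE t in \<mu>. norm (s t) \<le> 1"
    using w_le w_pos by eventually_elim (simp add: s_def)
  define e where "e k t = s t * t powi k" for k :: int and t :: complex
  have e_L2: "e k \<in> L2" for k
    unfolding e_def by (rule L2_mult_bounded[OF L2_powi sm s1])
  have e0: "e 0 = s" by (simp add: e_def fun_eq_iff)
  have sL: "s \<in> L2" using e_L2[of 0] by (simp add: e0)
  define S where "S = e ` {1..}"
  have S: "S \<subseteq> L2" by (auto simp: S_def e_L2)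
  obtain p where p: "p \<in> L2.cl (L2.span S)" "\<And>g. g \<in> L2.cl (L2.span S) \<Longrightarrow> L2_inner (s - p) g = 0"
    using L2.projection[OF L2.subspace_span L2.span_subset_V[OF S] sL] by blast
  have pL: "p \<in> L2" using p(1) by (rule L2.cl_V)
  define d where "d = s - p"
  have dL: "d \<in> L2" using L2.V_diff[OF sL pL] by (simp only: d_def)
  note [measurable] = L2_measurable[OF dL]
  have d_e: "L2_inner d (e k) = 0" if "k \<ge> 1" for k
    unfolding d_def using that L2.subset_cl_span[OF S] by (intro p(2)) (auto simp: S_def)

  define G where "G = exp (LINT t|\<mu>. ln (w t))"
  \<comment> \<open>Elements of the span are \<open>s t * poly q t\<close> on the circle with
    \<open>q\<close> vanishing at 0, so their distance from \<open>s\<close> is governed by the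
    polynomial \<open>1 - q\<close>, to which Szego's inequality applies.\<close>
  have far: "sqrt G \<le> L2.nrm (s - g)" if g: "g \<in> L2.span S" for g
  proof -
    let ?P = "{y. \<exists>q. poly q 0 = 0 \<and> (\<forall>t. norm t = 1 \<longrightarrow> y t = s t * poly q t)}"
    have "L2.subspace ?P"
    proof (rule L2.subspaceI)
      show "0 \<in> ?P"
        by (auto intro!: exI[of _ 0])
    next
      fix x y
      assume "x \<in> ?P"
        "y \<in> ?P"
      then obtain q q' where "poly q 0 = 0" "\<forall>t. norm t = 1 \<longrightarrow> x t = s t * poly q t"
        "poly q' 0 = 0" "\<forall>t. norm t = 1 \<longrightarrow> y t = s t * poly q' t" by auto
      then show "x + y \<in> ?P"
        by (auto intro!: exI[of _ "q + q'"] simp: algebra_simps)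
    next
      fix c x
      assume "x \<in> ?P"
      then obtain q where "poly q 0 = 0" "\<forall>t. norm t = 1 \<longrightarrow> x t = s t * poly q t" by auto
      then show "(\<lambda>t. c * x t) \<in> ?P"
        by (auto intro!: exI[of _ "smult c q"] simp: algebra_simps)
    qed
    moreover have "S \<subseteq> ?P"
    proof -
      have "poly (monom 1 (nat k)) 0 = (0::complex)" "\<And>t::complex. e k t = s t * poly (monom 1 (nat k)) t" if "k \<ge> 1" for k
        using that by (auto simp: poly_monom e_def power_int_def)
      then show ?thesis unfolding S_def by blast
    qed
    ultimately have "L2.span S \<subseteq> ?P"
      by (rule L2.span_minimal[rotated])
    then obtain q where q: "poly q 0 = 0" "\<forall>t. norm t = 1 \<longrightarrow> g t = s t * poly q t"
      using g by blast
    have gL: "g \<in> L2" using g L2.span_subset_V[OF S] by blast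
    have sgL: "(\<lambda>t. s t - g t) \<in> L2" by (rule L2_diff[OF sL gL])
    have eq: "AE t in \<mu>. w t * (norm (poly (1 - q) t))\<^sup>2 = (norm (s t - g t))\<^sup>2"
      using AE_circle_norm w_pos
    proof eventually_elim
      case (elim t)
      have "s t - g t = s t * poly (1 - q) t" using q elim by (simp add: algebra_simps)
      moreover have "(norm (s t))\<^sup>2 = w t" using elim by (simp add: s_def)
      ultimately show ?case by (simp add: norm_mult power_mult_distrib)
    qed
    have pm: "(\<lambda>t. poly (1 - q) t) \<in> borel_measurable \<mu>"
      by (intro borel_measurable_circle borel_measurable_continuous_onI continuous_on_poly continuous_on_id)
    have m: "(\<lambda>t. w t * (norm (poly (1 - q) t))\<^sup>2) \<in> borel_measurable \<mu>"
      using w pm by measurable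
    have m': "(\<lambda>t. (norm (s t - g t))\<^sup>2) \<in> borel_measurable \<mu>"
      using L2_measurable[OF gL] by measurable
    have i: "integrable \<mu> (\<lambda>t. w t * (norm (poly (1 - q) t))\<^sup>2)"
      using integrable_cong_AE[OF m m' eq] L2_integrable_sq[OF sgL] by simp
    have "G \<le> (LINT t|\<mu>. w t * (norm (poly (1 - q) t))\<^sup>2)"
      unfolding G_def using q i by (intro szego_inequality[OF w w_le log]) auto
    also have "\<dots> = (LINT t|\<mu>. (norm (s t - g t))\<^sup>2)"
      by (rule integral_cong_AE[OF m m' eq])
    finally show ?thesis by (simp add: L2_nrm)
  qed
  have "sqrt G \<le> L2.nrm d + \<epsilon>" if "\<epsilon> > 0" for \<epsilon>
  proof -
    obtain g where g: "g \<in> L2.span S" "g \<in> L2" "L2.nrm (p - g) < \<epsilon>"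
      using L2.cl_obtain[OF p(1) \<open>\<epsilon> > 0\<close>] by blast
    have "sqrt G \<le> L2.nrm (s - g)" by (rule far[OF g(1)])
    also have "\<dots> \<le> L2.nrm (s - p) + L2.nrm (p - g)" by (rule L2.nrm_triangle_diff[OF sL pL g(2)])
    finally show ?thesis using g(3) unfolding d_def by linarith
  qed
  then have "sqrt G \<le> L2.nrm d" by (rule field_le_epsilon)
  moreover have "sqrt G > 0" by (simp add: G_def)
  ultimately have d_pos: "L2.nrm d > 0" by linarith
  define c where "c = L2.nrm d"
  have c: "c > 0" using d_pos by (simp add: c_def)

  \<comment> \<open>Moving the power of \<open>t\<close> to the other argument turns
    \<open>e j\<close> into \<open>e (j + k)\<close> with \<open>j + k \<ge> 1\<close>, which is
    orthogonal to \<open>d\<close>; and \<open>d\<close> lies in the closed span of the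
    \<open>e j\<close> with \<open>j \<ge> 0\<close>.\<close>
  have shift: "L2_inner (\<lambda>t. t powi (- k) * d t) d = 0" if k: "k \<ge> 1" for k
  proof (rule L2.orthogonal_cl_span[where S = "e ` {0..}"])
    show "(\<lambda>t. t powi (- k) * d t) \<in> L2" by (rule L2_powi_mult[OF dL])
    show "e ` {0..} \<subseteq> L2" using e_L2 by auto
    show "L2_inner (\<lambda>t. t powi (- k) * d t) g = 0" if g: "g \<in> e ` {0..}" for g
    proof -
      obtain j where j: "g = e j" "j \<ge> 0" using g by auto
      have [measurable]: "(\<lambda>t. t powi k) \<in> borel_measurable \<mu>" for k
        by (rule borel_measurable_circle) simp
      note [measurable] = L2_measurable[OF e_L2]
      have "L2_inner (\<lambda>t. t powi (- k) * d t) g = L2_inner d (e (j + k))"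
        unfolding L2_inner_def j
      proof (rule integral_cong_AE)
        show "AE t in \<mu>. cnj (e j t) * (t powi (- k) * d t) = cnj (e (j + k) t) * d t"
          using AE_circle_norm
        proof eventually_elim
          case (elim t)
          then have "t \<noteq> 0" by auto
          then have "e (j + k) t = e j t * t powi k" by (simp add: e_def power_int_add)
          then show ?case using elim by (simp flip: circle_cnj_powi)
        qed
      qed measurable
      then show ?thesis using d_e[of "j + k"] j k by simp
    qed
    have "p \<in> L2.cl (L2.span (e ` {0..}))"
    proof -
      have "S \<subseteq> e ` {0..}" unfolding S_def by (intro image_mono) auto
      then show ?thesis using p(1) L2.cl_span_mono by blast
    qed
    moreover have "e ` {0..} \<subseteq> L2.cl (L2.span (e ` {0..}))"
      using e_L2 by (intro L2.subset_cl_span) auto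
    then have "s \<in> L2.cl (L2.span (e ` {0..}))" using e0 by (metis atLeast_iff image_eqI order_refl subsetD)
    ultimately show "d \<in> L2.cl (L2.span (e ` {0..}))"
      unfolding d_def by (intro L2.subspace_diff[OF L2.subspace_cl_span])
  qed
  \<comment> \<open>\<open>shift\<close> kills the Fourier coefficients of the squared modulus of
    \<open>d\<close> on one side, conjugation those on the other, and \<open>c\<^sup>2\<close> is
    its mean; so \<open>d\<close> has constant modulus.\<close>
  define h where "h t = complex_of_real ((norm (d t))\<^sup>2 - c\<^sup>2)" for t
  have di: "integrable \<mu> (\<lambda>t. complex_of_real ((norm (d t))\<^sup>2))"
    by (rule iffD2[OF complex_of_real_integrable_eq L2_integrable_sq[OF dL]])
  have hi: "integrable \<mu> h"
    unfolding h_def using L2_integrable_sq[OF dL] by (intro iffD2[OF complex_of_real_integrable_eq]) simp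
  have neg: "(LINT t|\<mu>. t powi (- k) * complex_of_real ((norm (d t))\<^sup>2)) = 0" if "k \<ge> 1" for k
  proof -
    have "(\<lambda>t. cnj (d t) * (t powi (- k) * d t)) = (\<lambda>t. t powi (- k) * complex_of_real ((norm (d t))\<^sup>2))"
      by (rule ext) (simp only: complex_norm_square mult_ac)
    then show ?thesis using shift[OF that] by (simp only: L2_inner_def)
  qed
  have pos: "(LINT t|\<mu>. t powi k * complex_of_real ((norm (d t))\<^sup>2)) = 0" if "k \<ge> 1" for k
  proof -
    have [measurable]: "(\<lambda>t. t powi k) \<in> borel_measurable \<mu>" for k
      by (rule borel_measurable_circle) simp
    have "(LINT t|\<mu>. t powi k * complex_of_real ((norm (d t))\<^sup>2))
        = (LINT t|\<mu>. cnj (t powi (- k) * complex_of_real ((norm (d t))\<^sup>2)))"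
    proof (rule integral_cong_AE)
      show "AE t in \<mu>. t powi k * complex_of_real ((norm (d t))\<^sup>2)
          = cnj (t powi (- k) * complex_of_real ((norm (d t))\<^sup>2))"
        using AE_circle_norm by eventually_elim (simp add: circle_cnj_powi)
    qed measurable
    also have "\<dots> = 0" by (simp only: Bochner_Integration.integral_cnj neg[OF that] complex_cnj_zero)
    finally show ?thesis .
  qed
  have zero: "(LINT t|\<mu>. complex_of_real ((norm (d t))\<^sup>2)) = of_real (c\<^sup>2)"
    by (simp only: integral_complex_of_real c_def L2.nrm_sq[OF dL] L2_inner_self Re_complex_of_real)
  have "(LINT t|\<mu>. t powi k * h t) = 0" for k
  proof -
    have "(LINT t|\<mu>. t powi k * h t)
        = (LINT t|\<mu>. t powi k * complex_of_real ((norm (d t))\<^sup>2) - of_real (c\<^sup>2) * t powi k)"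
      by (simp add: h_def algebra_simps)
    also have "\<dots> = (LINT t|\<mu>. t powi k * complex_of_real ((norm (d t))\<^sup>2)) - of_real (c\<^sup>2) * (LINT t|\<mu>. t powi k)"
      using integrable_powi_mult[OF di] L2_integrable[OF L2_powi]
      by (subst Bochner_Integration.integral_diff) auto
    also have "\<dots> = 0"
    proof (cases k "0::int" rule: linorder_cases)
      case less
      then show ?thesis using neg[of "- k"] by (simp add: integral_powi)
    next
      case equal
      then show ?thesis using zero by (simp add: integral_powi)
    next
      case greater
      then show ?thesis using pos[of k] by (simp add: integral_powi)
    qed
    finally show ?thesis .
  qed
  then have "AE t in \<mu>. h t = 0" using hi by (intro fourier_null_AE) (simp add: fourier_null_def)
  then have d_norm: "AE t in \<mu>. norm (d t) = c"
  proof eventually_elim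
    case (elim t)
    then have "(norm (d t))\<^sup>2 = c\<^sup>2" unfolding h_def by (metis of_real_eq_0_iff right_minus_eq)
    then show ?case using c by (simp add: power2_eq_iff_nonneg)
  qed

  \<comment> \<open>The conjugate puts the vanishing coefficients on the Hardy space side: the
    integral against \<open>t powi k\<close> is \<open>L2_inner (e k) d / of_real c\<close>, which
    is 0 for \<open>k > 0\<close> and \<open>c\<close> for \<open>k = 0\<close>.\<close>
  define \<phi> where "\<phi> t = s t * cnj (d t) / of_real c" for t
  show ?thesis
  proof (rule that[of \<phi>])
    show "\<phi> \<in> borel_measurable \<mu>" unfolding \<phi>_def by measurable
    show "AE t in \<mu>. (norm (\<phi> t))\<^sup>2 = w t"
      using d_norm w_pos by eventually_elim (use c in \<open>simp add: \<phi>_def s_def norm_mult norm_divide\<close>)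
    have \<phi>: "(LINT t|\<mu>. t powi k * \<phi> t) = L2_inner (e k) d / of_real c" for k
    proof -
      have "(\<lambda>t. t powi k * \<phi> t) = (\<lambda>t. cnj (d t) * e k t / of_real c)"
        by (simp add: fun_eq_iff \<phi>_def e_def)
      then show ?thesis by (simp only: L2_inner_def integral_divide_zero)
    qed
    show "(LINT t|\<mu>. t powi k * \<phi> t) = 0" if "k > 0" for k
      using L2.ip_eq_0_sym[OF dL e_L2 d_e[of k]] that by (simp add: \<phi>)
    have "L2_inner p d = 0" using L2.ip_eq_0_sym[OF dL pL] p(2)[OF p(1)] by (simp add: d_def[symmetric] del: minus_apply)
    then have "L2_inner s d = L2_inner d d"
      using L2.ip_diff_left[OF sL pL dL] unfolding d_def[symmetric] by simp
    also have "\<dots> = of_real (c\<^sup>2)" using L2.ip_self[OF dL] by (simp only: c_def)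
    finally have "(LINT t|\<mu>. t powi 0 * \<phi> t) = of_real (c\<^sup>2) / of_real c"
      unfolding \<phi> e0 by simp
    then show "(LINT t|\<mu>. \<phi> t) \<noteq> 0" using c by simp
  qed
qed

end

section \<open>The space $L^R$ as a Hilbert space\<close>

text \<open>The inner product of \<open>LR\<close> contains \<open>matrix_inv\<close> of matrices
  that may be singular on a null set, where its value is unspecified; completeness of the measure
  takes care of measurability.\<close>

lemma circle_measurable_cong_AE:
  assumes f: "f \<in> borel_measurable \<mu>" and eq: "AE t in \<mu>. f t = g t"
  shows "g \<in> borel_measurable \<mu>"
proof -
  interpret complete_measure \<mu>
    unfolding circle_measure_def by (rule completion.complete_measure_axioms)
  show ?thesis
  proof (rule measurableI)
    fix A :: "'a set" assume "A \<in> sets borel"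
    then have "f -` A \<inter> space \<mu> \<in> sets \<mu>" using f by (rule measurable_sets[rotated])
    then show "g -` A \<inter> space \<mu> \<in> sets \<mu>"
      by (rule in_sets_AE[rotated]) (use eq in \<open>auto elim: eventually_mono\<close>)
  qed auto
qed

lemma circle_integral_cong_AE:
  fixes f g :: "complex \<Rightarrow> 'a::{banach, second_countable_topology}"
  assumes f: "f \<in> borel_measurable \<mu>" and eq: "AE t in \<mu>. f t = g t"
  shows "integrable \<mu> g \<longleftrightarrow> integrable \<mu> f"
    and "(LINT t|\<mu>. g t) = (LINT t|\<mu>. f t)"
proof -
  have g: "g \<in> borel_measurable \<mu>" by (rule circle_measurable_cong_AE[OF f eq])
  have eq': "AE t in \<mu>. g t = f t" using eq by eventually_elim simp
  show "integrable \<mu> g \<longleftrightarrow> integrable \<mu> f"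
    by (rule integrable_cong_AE[OF g f eq'])
  show "(LINT t|\<mu>. g t) = (LINT t|\<mu>. f t)"
    by (rule integral_cong_AE[OF g f eq'])
qed

lemma measurable_vec_nth: "f \<in> borel_measurable M \<Longrightarrow> (\<lambda>t. (f t :: complex^2) $ i) \<in> borel_measurable M"
  by (rule borel_measurable_continuous_on[where f = "\<lambda>x. x $ i"]) (auto intro: continuous_intros)

lemma measurable_vector_2:
  assumes "f \<in> borel_measurable M" "g \<in> borel_measurable M"
  shows "(\<lambda>t. vector [f t, g t] :: complex^2) \<in> borel_measurable M"
proof -
  have "(\<lambda>p::complex \<times> complex. vector [fst p, snd p] :: complex^2) = (\<lambda>p. \<chi> i. if i = 1 then fst p else snd p)"
    by (auto simp: fun_eq_iff vec_eq_iff forall_2)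
  moreover have "continuous_on UNIV (\<lambda>p::complex \<times> complex. \<chi> i::2. if i = 1 then fst p else snd p)"
  proof (rule continuous_on_vec_lambda)
    show "continuous_on UNIV (\<lambda>p::complex \<times> complex. if i = 1 then fst p else snd p)" for i :: 2
      by (cases "i = 1") (auto intro: continuous_intros)
  qed
  ultimately have "continuous_on UNIV (\<lambda>p::complex \<times> complex. vector [fst p, snd p] :: complex^2)"
    by (simp only:)
  from borel_measurable_continuous_on[OF this borel_measurable_Pair[OF assms]] show ?thesis by simp
qed

lemma one_minus_norm_sq:
  fixes z :: complex
  shows "complex_of_real (1 - (norm z)\<^sup>2) = 1 - z * cnj z"
  by (simp only: of_real_diff of_real_1 complex_norm_square)

lemma one_minus_norm_sq_ne:
  fixes z :: complex
  assumes "norm z < 1"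
  shows "complex_of_real (1 - (norm z)\<^sup>2) \<noteq> 0"
proof -
  have "(norm z)\<^sup>2 < 1" using assms by (simp add: abs_square_less_1)
  then have "1 - (norm z)\<^sup>2 \<noteq> 0" by simp
  then show ?thesis by (simp only: of_real_eq_0_iff not_False_eq_True)
qed

lemma weight_mult: "weight R t *v vector [a, b] = vector [a + cnj (R t) * b, R t * a + b]"
  by (simp add: vec_eq_iff forall_2 matrix_vector_mult_def sum_2 weight_def)

lemma matrix_inv_weight:
  assumes "norm (R t) < 1"
  shows "matrix_inv (weight R t) *v f =
    vector [(f $ 1 - cnj (R t) * f $ 2) / of_real (1 - (norm (R t))\<^sup>2),
            (f $ 2 - R t * f $ 1) / of_real (1 - (norm (R t))\<^sup>2)]"
proof -
  define D where "D = complex_of_real (1 - (norm (R t))\<^sup>2)"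
  have D: "D \<noteq> 0" "D = 1 - R t * cnj (R t)"
    unfolding D_def by (rule one_minus_norm_sq_ne[OF assms], rule one_minus_norm_sq)
  define B where "B = (vector [vector [1 / D, - cnj (R t) / D], vector [- R t / D, 1 / D]] :: complex^2^2)"
  have 1: "weight R t ** B = mat 1" "B ** weight R t = mat 1"
    using D(1) by (simp_all add: vec_eq_iff forall_2 matrix_matrix_mult_def sum_2 weight_def B_def mat_def
        field_simps) (simp_all add: D(2) algebra_simps)
  \<comment> \<open>\<open>matrix_inv\<close> is a choice, so an inverse is exhibited first and then
    identified with the chosen one by uniqueness.\<close>
  have "weight R t ** matrix_inv (weight R t) = mat 1 \<and> matrix_inv (weight R t) ** weight R t = mat 1"
    unfolding matrix_inv_def by (rule someI[of _ B]) (use 1 in auto)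
  then have "matrix_inv (weight R t) = B"
    by (metis 1(1) matrix_mul_assoc matrix_mul_lid matrix_mul_rid)
  then show ?thesis
    unfolding D_def[symmetric]
    by (simp only:) (use D(1) in \<open>simp add: vec_eq_iff forall_2 matrix_vector_mult_def sum_2 B_def field_simps\<close>)
qed

text \<open>Completing the square turns \<open>g\<^sup>* W\<^sup>-\<^sup>1 f\<close> into a sum of two scalar products, which identifies
  $L^R$ with two copies of $L^2$.\<close>

definition coord1 :: "(complex \<Rightarrow> complex^2) \<Rightarrow> complex \<Rightarrow> complex" where
  "coord1 f t = f t $ 1"

definition coord2 :: "(complex \<Rightarrow> complex) \<Rightarrow> (complex \<Rightarrow> complex^2) \<Rightarrow> complex \<Rightarrow> complex" where
  "coord2 R f t = (f t $ 2 - R t * f t $ 1) / of_real (sqrt (1 - (norm (R t))\<^sup>2))"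

lemma LR_form_coords:
  assumes "norm (R t) < 1"
  shows "LR_form R f g t = cnj (coord1 g t) * coord1 f t + cnj (coord2 R g t) * coord2 R f t"
proof -
  define D where "D = complex_of_real (1 - (norm (R t))\<^sup>2)"
  have lt: "(norm (R t))\<^sup>2 < 1" using assms by (simp add: abs_square_less_1)
  have D: "D \<noteq> 0" "D = 1 - R t * cnj (R t)"
    unfolding D_def by (rule one_minus_norm_sq_ne[OF assms], rule one_minus_norm_sq)
  have s: "complex_of_real (sqrt (1 - (norm (R t))\<^sup>2)) * of_real (sqrt (1 - (norm (R t))\<^sup>2)) = D"
    using lt unfolding D_def by (simp flip: of_real_mult)
  have "cnj (coord2 R g t) * coord2 R f t = cnj (g t $ 2 - R t * g t $ 1) * (f t $ 2 - R t * f t $ 1) / D"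
    by (simp add: coord2_def flip: s)
  then have sq: "cnj (g t $ 2 - R t * g t $ 1) * (f t $ 2 - R t * f t $ 1) / D = cnj (coord2 R g t) * coord2 R f t"
    by simp
  have form: "LR_form R f g t = cnj (g t $ 1) * ((f t $ 1 - cnj (R t) * f t $ 2) / D)
      + cnj (g t $ 2) * ((f t $ 2 - R t * f t $ 1) / D)"
    unfolding LR_form_def matrix_inv_weight[of R, OF assms] sum_2 D_def by simp
  \<comment> \<open>The determinant \<open>D\<close> splits off: the numerator is \<open>D\<close>
    times the product of the first entries plus the product that belongs to
    \<open>coord2\<close>.\<close>
  have alg: "cnj (g t $ 1) * (f t $ 1 - cnj (R t) * f t $ 2) + cnj (g t $ 2) * (f t $ 2 - R t * f t $ 1)
      = D * (cnj (g t $ 1) * f t $ 1) + cnj (g t $ 2 - R t * g t $ 1) * (f t $ 2 - R t * f t $ 1)"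
    unfolding D(2) by (simp add: algebra_simps)
  have "LR_form R f g t = (cnj (g t $ 1) * (f t $ 1 - cnj (R t) * f t $ 2)
      + cnj (g t $ 2) * (f t $ 2 - R t * f t $ 1)) / D"
    by (simp add: form add_divide_distrib)
  also have "\<dots> = cnj (g t $ 1) * f t $ 1 + cnj (g t $ 2 - R t * g t $ 1) * (f t $ 2 - R t * f t $ 1) / D"
    unfolding alg using D(1) by (simp add: add_divide_distrib)
  finally show ?thesis unfolding sq by (simp add: coord1_def)
qed

lemma coord1_add: "coord1 (\<lambda>t. f t + g t) = (\<lambda>t. coord1 f t + coord1 g t)"
  and coord2_add: "coord2 R (\<lambda>t. f t + g t) = (\<lambda>t. coord2 R f t + coord2 R g t)"
  and coord1_diff: "coord1 (\<lambda>t. f t - g t) = (\<lambda>t. coord1 f t - coord1 g t)"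
  and coord2_diff: "coord2 R (\<lambda>t. f t - g t) = (\<lambda>t. coord2 R f t - coord2 R g t)"
  and coord1_scale: "coord1 (\<lambda>t. c t *s f t) = (\<lambda>t. c t * coord1 f t)"
  and coord2_scale: "coord2 R (\<lambda>t. c t *s f t) = (\<lambda>t. c t * coord2 R f t)"
  by (auto simp: coord1_def coord2_def fun_eq_iff diff_divide_distrib add_divide_distrib algebra_simps)

lemma vector_space_fun2: "vector_space (\<lambda>c (f :: complex \<Rightarrow> complex^2) t. c *s f t)"
  by standard (auto simp: fun_eq_iff vec_eq_iff algebra_simps)

locale contractive_symbol =
  fixes R :: "complex \<Rightarrow> complex"
  assumes Rm: "R \<in> borel_measurable \<mu>"
    and R_log: "log_integrable (\<lambda>t. 1 - norm (R t))"
begin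

lemma R_lt: "AE t in \<mu>. norm (R t) < 1"
  using R_log by (simp add: log_integrable_def)

lemma coord_measurable:
  assumes "f \<in> borel_measurable \<mu>"
  shows "coord1 f \<in> borel_measurable \<mu>" "coord2 R f \<in> borel_measurable \<mu>"
  using measurable_vec_nth[OF assms] Rm unfolding coord1_def coord2_def by measurable

lemma AE_form: "AE t in \<mu>.
    cnj (coord1 g t) * coord1 f t + cnj (coord2 R g t) * coord2 R f t = LR_form R f g t"
  using R_lt by eventually_elim (simp add: LR_form_coords)

lemma LR_iff: "f \<in> LR R \<longleftrightarrow> f \<in> borel_measurable \<mu> \<and> coord1 f \<in> L2 \<and> coord2 R f \<in> L2"
proof (cases "f \<in> borel_measurable \<mu>")
  case True
  note m [measurable] = coord_measurable[OF True]
  have "integrable \<mu> (LR_form R f f) \<longleftrightarrow>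
      integrable \<mu> (\<lambda>t. cnj (coord1 f t) * coord1 f t + cnj (coord2 R f t) * coord2 R f t)"
    by (rule circle_integral_cong_AE(1)[OF _ AE_form]) measurable
  also have "(\<lambda>t. cnj (coord1 f t) * coord1 f t + cnj (coord2 R f t) * coord2 R f t)
      = (\<lambda>t. complex_of_real ((norm (coord1 f t))\<^sup>2 + (norm (coord2 R f t))\<^sup>2))"
    by (simp only: of_real_add complex_norm_square mult.commute)
  also have "integrable \<mu> \<dots> \<longleftrightarrow>
      integrable \<mu> (\<lambda>t. (norm (coord1 f t))\<^sup>2 + (norm (coord2 R f t))\<^sup>2)"
    by (rule complex_of_real_integrable_eq)
  also have "\<dots> \<longleftrightarrow> coord1 f \<in> L2 \<and> coord2 R f \<in> L2"
    using L2I[OF m(1), of "\<lambda>t. (norm (coord1 f t))\<^sup>2 + (norm (coord2 R f t))\<^sup>2"]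
      L2I[OF m(2), of "\<lambda>t. (norm (coord1 f t))\<^sup>2 + (norm (coord2 R f t))\<^sup>2"]
    by (auto intro: L2_integrable_sq)
  finally show ?thesis using True by (simp add: LR_def)
qed (simp add: LR_def)

lemma LRD: "f \<in> LR R \<Longrightarrow> f \<in> borel_measurable \<mu>"
  "f \<in> LR R \<Longrightarrow> coord1 f \<in> L2" "f \<in> LR R \<Longrightarrow> coord2 R f \<in> L2"
  by (simp_all add: LR_iff)

lemma LR_inner_coords:
  assumes f: "f \<in> LR R" and g: "g \<in> LR R"
  shows "LR_inner R f g = L2_inner (coord1 f) (coord1 g) + L2_inner (coord2 R f) (coord2 R g)"
proof -
  note [measurable] = coord_measurable[OF LRD(1)[OF f]] coord_measurable[OF LRD(1)[OF g]]
  have "LR_inner R f g = (LINT t|\<mu>. cnj (coord1 g t) * coord1 f t + cnj (coord2 R g t) * coord2 R f t)"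
    unfolding LR_inner_def by (rule circle_integral_cong_AE(2)[OF _ AE_form]) measurable
  also have "\<dots> = L2_inner (coord1 f) (coord1 g) + L2_inner (coord2 R f) (coord2 R g)"
    unfolding L2_inner_def
    by (rule Bochner_Integration.integral_add) (auto intro!: L2_integrable_inner LRD f g)
  finally show ?thesis .
qed

lemma LR_inner_self:
  assumes "f \<in> LR R"
  shows "Re (LR_inner R f f) = (LINT t|\<mu>. (norm (coord1 f t))\<^sup>2) + (LINT t|\<mu>. (norm (coord2 R f t))\<^sup>2)"
  using LR_inner_coords[OF assms assms] by (simp add: L2_inner_self)

definition radicand :: "complex \<Rightarrow> real" where
  "radicand t = 1 - (norm (R t))\<^sup>2"

lemma radicand_measurable: "radicand \<in> borel_measurable \<mu>"
  unfolding radicand_def using Rm by measurable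

lemma AE_radicand: "AE t in \<mu>. 0 < radicand t \<and> radicand t \<le> 1"
  using R_lt by eventually_elim (simp add: radicand_def abs_square_less_1)

lemma LR_add: "f \<in> LR R \<Longrightarrow> g \<in> LR R \<Longrightarrow> (\<lambda>t. f t + g t) \<in> LR R"
  by (simp add: LR_iff coord1_add coord2_add L2_add borel_measurable_add)

lemma LR_mult_bounded:
  assumes f: "f \<in> LR R" and c: "c \<in> borel_measurable \<mu>" "AE t in \<mu>. norm (c t) \<le> B"
  shows "(\<lambda>t. c t *s f t) \<in> LR R"
proof -
  have "(\<lambda>t. c t *s f t) = (\<lambda>t. vector [c t * f t $ 1, c t * f t $ 2])"
    by (auto simp: fun_eq_iff vec_eq_iff forall_2)
  moreover have "(\<lambda>t. vector [c t * f t $ 1, c t * f t $ 2] :: complex^2) \<in> borel_measurable \<mu>"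
    using measurable_vec_nth[OF LRD(1)[OF f]] c(1) by (intro measurable_vector_2 borel_measurable_times)
  ultimately have "(\<lambda>t. c t *s f t) \<in> borel_measurable \<mu>" by (simp only:)
  then show ?thesis
    using L2_mult_bounded[OF LRD(2)[OF f] c] L2_mult_bounded[OF LRD(3)[OF f] c]
    by (simp add: LR_iff coord1_scale coord2_scale)
qed

lemma LR_cmult: "f \<in> LR R \<Longrightarrow> (\<lambda>t. c *s f t) \<in> LR R"
  by (rule LR_mult_bounded[where B = "norm c"]) auto

text \<open>The inverse of the coordinate map, up to null sets; completeness is transported from
  \<open>L2\<close> along it.\<close>

lemma LR_from_coords:
  assumes a: "a \<in> L2" and b: "b \<in> L2"
  obtains x where "x \<in> LR R" "coord1 x = a" "AE t in \<mu>. coord2 R x t = b t"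
proof -
  define x where "x t = (vector [a t, R t * a t + of_real (sqrt (radicand t)) * b t] :: complex^2)" for t
  have xm: "x \<in> borel_measurable \<mu>"
  proof -
    note [measurable] = L2_measurable[OF a] L2_measurable[OF b] Rm radicand_measurable
    show ?thesis unfolding x_def by (intro measurable_vector_2) measurable
  qed
  have 1: "coord1 x = a" by (simp add: coord1_def x_def fun_eq_iff)
  have 2: "AE t in \<mu>. coord2 R x t = b t"
    using AE_radicand by eventually_elim (simp add: coord2_def x_def flip: radicand_def)
  have "x \<in> LR R"
    using L2_cong_AE[OF b coord_measurable(2)[OF xm] 2] xm a by (simp add: LR_iff 1)
  then show ?thesis using that 1 2 by blast
qed

sublocale LR: semi_hilbert "\<lambda>c f t. c *s f t" "LR R" "LR_inner R"
proof (rule semi_hilbert.intro[OF vector_space_fun2], rule semi_hilbert_axioms.intro)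
  interpret vector_space "\<lambda>c (f :: complex \<Rightarrow> complex^2) t. c *s f t" by (rule vector_space_fun2)
  show subspace: "subspace (LR R)"
  proof (rule subspaceI)
    have "(\<lambda>_. 0) \<in> L2" using L2_bounded[of "\<lambda>_. 0" 0] by simp
    then obtain x where "x \<in> LR R" using LR_from_coords by blast
    from LR_cmult[OF this, of 0] show "0 \<in> LR R" by (simp add: zero_fun_def)
  qed (auto simp: plus_fun_def LR_add LR_cmult)
  show "LR_inner R (x + y) z = LR_inner R x z + LR_inner R y z" if "x \<in> LR R" "y \<in> LR R" "z \<in> LR R" for x y z
  proof -
    have "x + y \<in> LR R" using that LR_add by (simp add: plus_fun_def)
    moreover have "coord1 (x + y) = coord1 x + coord1 y" "coord2 R (x + y) = coord2 R x + coord2 R y"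
      by (simp_all add: plus_fun_def coord1_add coord2_add)
    ultimately show ?thesis
      using that by (simp add: LR_inner_coords L2.ip_add_left LRD)
  qed
  show "LR_inner R (\<lambda>t. c *s x t) y = c * LR_inner R x y" if "x \<in> LR R" "y \<in> LR R" for x y c
    using that L2.ip_scale_left[OF LRD(2) LRD(2), of x y c] L2.ip_scale_left[OF LRD(3) LRD(3), of x y c]
    by (simp add: LR_inner_coords LR_cmult coord1_scale coord2_scale distrib_left)
  show "LR_inner R y x = cnj (LR_inner R x y)" if "x \<in> LR R" "y \<in> LR R" for x y
    using that L2.ip_cnj[OF LRD(2) LRD(2), of x y] L2.ip_cnj[OF LRD(3) LRD(3), of x y]
    by (simp add: LR_inner_coords)
  show "0 \<le> Re (LR_inner R x x)" if "x \<in> LR R" for x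
    using that by (simp add: LR_inner_self)
  have diff: "x - y \<in> LR R" "coord1 (x - y) = (\<lambda>t. coord1 x t - coord1 y t)"
      "coord2 R (x - y) = (\<lambda>t. coord2 R x t - coord2 R y t)" if "x \<in> LR R" "y \<in> LR R" for x y
    using that subspace_diff[OF subspace] coord1_diff[of x y] coord2_diff[of R x y]
    by (auto simp: fun_diff_def)
  fix X :: "nat \<Rightarrow> complex \<Rightarrow> complex^2"
  assume X: "\<And>n. X n \<in> LR R" and cau: "\<And>\<epsilon>. \<epsilon> > 0 \<Longrightarrow>
    \<exists>N. \<forall>i\<ge>N. \<forall>j\<ge>N. sqrt (Re (LR_inner R (X i - X j) (X i - X j))) < \<epsilon>"
  \<comment> \<open>Both coordinates contribute nonnegative summands to the squared norm, so each
    coordinate sequence is Cauchy.\<close>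
  have cau2: "\<exists>N. \<forall>i\<ge>N. \<forall>j\<ge>N. (LINT t|\<mu>. (norm (coord1 (X i) t - coord1 (X j) t))\<^sup>2) < \<epsilon> \<and>
      (LINT t|\<mu>. (norm (coord2 R (X i) t - coord2 R (X j) t))\<^sup>2) < \<epsilon>" if "\<epsilon> > 0" for \<epsilon> :: real
  proof -
    have "sqrt \<epsilon> > 0" using that by simp
    from cau[OF this] obtain N where N: "\<forall>i\<ge>N. \<forall>j\<ge>N. Re (LR_inner R (X i - X j) (X i - X j)) < \<epsilon>"
      by auto
    have "(LINT t|\<mu>. (norm (coord1 (X i) t - coord1 (X j) t))\<^sup>2) < \<epsilon> \<and>
      (LINT t|\<mu>. (norm (coord2 R (X i) t - coord2 R (X j) t))\<^sup>2) < \<epsilon>" if "i \<ge> N" "j \<ge> N" for i j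
    proof -
      have "Re (LR_inner R (X i - X j) (X i - X j)) < \<epsilon>" using N that by blast
      moreover have "0 \<le> (LINT t|\<mu>. (norm (coord1 (X i) t - coord1 (X j) t))\<^sup>2)"
        "0 \<le> (LINT t|\<mu>. (norm (coord2 R (X i) t - coord2 R (X j) t))\<^sup>2)" by auto
      ultimately show ?thesis
        unfolding LR_inner_self[OF diff(1)[OF X X]] diff(2,3)[OF X X] by linarith
    qed
    then show ?thesis by blast
  qed
  obtain a where a: "a \<in> L2" "\<forall>\<epsilon>>0. \<exists>N. \<forall>i\<ge>N. (LINT t|\<mu>. (norm (coord1 (X i) t - a t))\<^sup>2) < \<epsilon>"
  proof -
    have "\<exists>N. \<forall>i\<ge>N. \<forall>j\<ge>N. (LINT t|\<mu>. (norm (coord1 (X i) t - coord1 (X j) t))\<^sup>2) < \<epsilon>"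
      if "\<epsilon> > 0" for \<epsilon> :: real
      using cau2[OF that] by blast
    from L2_complete[OF LRD(2)[OF X] this] show ?thesis using that by blast
  qed
  obtain b where b: "b \<in> L2" "\<forall>\<epsilon>>0. \<exists>N. \<forall>i\<ge>N. (LINT t|\<mu>. (norm (coord2 R (X i) t - b t))\<^sup>2) < \<epsilon>"
  proof -
    have "\<exists>N. \<forall>i\<ge>N. \<forall>j\<ge>N. (LINT t|\<mu>. (norm (coord2 R (X i) t - coord2 R (X j) t))\<^sup>2) < \<epsilon>"
      if "\<epsilon> > 0" for \<epsilon> :: real
      using cau2[OF that] by blast
    from L2_complete[OF LRD(3)[OF X] this] show ?thesis using that by blast
  qed
  obtain x where x: "x \<in> LR R" "coord1 x = a" "AE t in \<mu>. coord2 R x t = b t"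
    using LR_from_coords[OF a(1) b(1)] by blast
  have "\<exists>N. \<forall>i\<ge>N. sqrt (Re (LR_inner R (X i - x) (X i - x))) < \<epsilon>" if e: "\<epsilon> > 0" for \<epsilon>
  proof -
    have "\<epsilon>\<^sup>2 / 2 > 0" using e by simp
    then obtain N1 N2 where N1: "\<forall>i\<ge>N1. (LINT t|\<mu>. (norm (coord1 (X i) t - a t))\<^sup>2) < \<epsilon>\<^sup>2 / 2"
      and N2: "\<forall>i\<ge>N2. (LINT t|\<mu>. (norm (coord2 R (X i) t - b t))\<^sup>2) < \<epsilon>\<^sup>2 / 2"
      using a(2) b(2) by blast
    have "sqrt (Re (LR_inner R (X i - x) (X i - x))) < \<epsilon>" if i: "i \<ge> max N1 N2" for i
    proof -
      note [measurable] = coord_measurable[OF LRD(1)[OF X]] coord_measurable[OF LRD(1)[OF x(1)]] L2_measurable[OF b(1)]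
      have "(LINT t|\<mu>. (norm (coord2 R (X i) t - coord2 R x t))\<^sup>2) = (LINT t|\<mu>. (norm (coord2 R (X i) t - b t))\<^sup>2)"
        by (rule integral_cong_AE) (measurable, use x(3) in \<open>auto elim: eventually_mono\<close>)
      then have "Re (LR_inner R (X i - x) (X i - x)) < \<epsilon>\<^sup>2 / 2 + \<epsilon>\<^sup>2 / 2"
        unfolding LR_inner_self[OF diff(1)[OF X x(1)]] diff(2,3)[OF X x(1)] x(2)
        using N1 N2 i by (intro add_strict_mono) auto
      then show ?thesis using e by (intro real_less_lsqrt) auto
    qed
    then show ?thesis by blast
  qed
  then show "\<exists>x\<in>LR R. \<forall>\<epsilon>>0. \<exists>N. \<forall>i\<ge>N. sqrt (Re (LR_inner R (X i - x) (X i - x))) < \<epsilon>"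
    using x(1) by blast
qed

lemma LR_norm_eq: "LR_norm R = LR.nrm"
  by (simp add: fun_eq_iff LR_norm_def LR.nrm_def)

lemma LR_closure_eq: "LR_closure R S = LR.cl S"
  by (simp add: LR_closure_def LR.cl_def LR_norm_eq fun_diff_def)

lemma coords_eq_0: "radicand t > 0 \<Longrightarrow> coord1 f t = 0 \<Longrightarrow> coord2 R f t = 0 \<Longrightarrow> f t = 0"
  unfolding coord1_def coord2_def by (simp add: vec_eq_iff forall_2 flip: radicand_def)

lemma LR_nrm_0_AE:
  assumes f: "f \<in> LR R"
  shows "LR.nrm f = 0 \<longleftrightarrow> (AE t in \<mu>. f t = 0)"
proof -
  note i = L2_integrable_sq[OF LRD(2)[OF f]] L2_integrable_sq[OF LRD(3)[OF f]]
  have "LR.nrm f = 0 \<longleftrightarrow> (LINT t|\<mu>. (norm (coord1 f t))\<^sup>2) = 0 \<and> (LINT t|\<mu>. (norm (coord2 R f t))\<^sup>2) = 0"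
    using LR_inner_self[OF f] by (simp add: LR.nrm_def add_nonneg_eq_0_iff)
  also have "\<dots> \<longleftrightarrow> (AE t in \<mu>. coord1 f t = 0) \<and> (AE t in \<mu>. coord2 R f t = 0)"
    using integral_nonneg_eq_0_iff_AE[OF i(1)] integral_nonneg_eq_0_iff_AE[OF i(2)] by simp
  also have "\<dots> \<longleftrightarrow> (AE t in \<mu>. f t = 0)"
  proof
    assume *: "(AE t in \<mu>. coord1 f t = 0) \<and> (AE t in \<mu>. coord2 R f t = 0)"
    show "AE t in \<mu>. f t = 0"
      using conjunct1[OF *] conjunct2[OF *] AE_radicand by eventually_elim (auto intro: coords_eq_0)
  next
    assume *: "AE t in \<mu>. f t = 0"
    have "AE t in \<mu>. coord1 f t = 0" "AE t in \<mu>. coord2 R f t = 0"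
      using * by (eventually_elim, simp add: coord1_def coord2_def)+
    then show "(AE t in \<mu>. coord1 f t = 0) \<and> (AE t in \<mu>. coord2 R f t = 0)" ..
  qed
  finally show ?thesis .
qed

lemma LR_nrm_diff_AE:
  assumes "f \<in> LR R" "g \<in> LR R"
  shows "LR.nrm (f - g) = 0 \<longleftrightarrow> (AE t in \<mu>. f t = g t)"
  using LR_nrm_0_AE[OF LR.V_diff[OF assms]] by (simp add: fun_diff_def)

section \<open>Vectors in the range of the weight and their pairings\<close>

definition weighted :: "(complex \<Rightarrow> complex) \<Rightarrow> (complex \<Rightarrow> complex) \<Rightarrow> complex \<Rightarrow> complex^2" where
  "weighted a b t = weight R t *v vector [a t, b t]"

text \<open>\<open>coord2\<close> divides by \<open>sqrt (radicand t)\<close>, but the weight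
  supplies the factor \<open>radicand t\<close>, so what remains is a bounded multiple of
  \<open>b t\<close>.\<close>

lemma weighted_V:
  assumes a: "a \<in> L2" and b: "b \<in> L2"
  shows "weighted a b \<in> LR R"
proof -
  have R1: "AE t in \<mu>. norm (R t) \<le> 1" using R_lt by eventually_elim simp
  have R1c: "AE t in \<mu>. norm (cnj (R t)) \<le> 1" using R1 by simp
  have Rc: "(\<lambda>t. cnj (R t)) \<in> borel_measurable \<mu>" using Rm by measurable
  have c1: "coord1 (weighted a b) = (\<lambda>t. a t + cnj (R t) * b t)"
    by (simp add: fun_eq_iff coord1_def weighted_def weight_mult)
  have m: "weighted a b \<in> borel_measurable \<mu>"
  proof -
    note [measurable] = L2_measurable[OF a] L2_measurable[OF b] Rm
    show ?thesis unfolding weighted_def weight_mult by (intro measurable_vector_2) measurable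
  qed
  have sm: "(\<lambda>t. complex_of_real (sqrt (radicand t))) \<in> borel_measurable \<mu>"
    using radicand_measurable by measurable
  have s1: "AE t in \<mu>. norm (complex_of_real (sqrt (radicand t))) \<le> 1"
    using AE_radicand by eventually_elim simp
  have eq: "AE t in \<mu>. coord2 R (weighted a b) t = of_real (sqrt (radicand t)) * b t"
    using AE_radicand
  proof eventually_elim
    case (elim t)
    have s: "complex_of_real (sqrt (radicand t)) * of_real (sqrt (radicand t)) = 1 - R t * cnj (R t)"
      using elim unfolding one_minus_norm_sq[symmetric] by (simp add: radicand_def flip: of_real_mult)
    have "coord2 R (weighted a b) t = (1 - R t * cnj (R t)) * b t / of_real (sqrt (radicand t))"
      unfolding coord2_def radicand_def[symmetric] by (simp add: weighted_def weight_mult algebra_simps)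
    then show ?case using elim by (simp flip: s)
  qed
  have "coord2 R (weighted a b) \<in> L2"
    by (rule L2_cong_AE[OF L2_mult_bounded[OF b sm s1] coord_measurable(2)[OF m] eq])
  then show ?thesis using m c1 L2_add[OF a L2_mult_bounded[OF b Rc R1c]] by (simp add: LR_iff)
qed

text \<open>The second component is recovered from the two coordinates with the bounded multipliers
  \<open>R\<close> and \<open>sqrt (radicand t)\<close>.\<close>

lemma component_L2:
  assumes x: "x \<in> LR R"
  shows "(\<lambda>t. x t $ i) \<in> L2"
proof -
  have 1: "(\<lambda>t. x t $ 1) \<in> L2" using LRD(2)[OF x] by (simp add: coord1_def[abs_def])
  have R1: "AE t in \<mu>. norm (R t) \<le> 1" using R_lt by eventually_elim simp
  have sm: "(\<lambda>t. complex_of_real (sqrt (radicand t))) \<in> borel_measurable \<mu>"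
    using radicand_measurable by measurable
  have s1: "AE t in \<mu>. norm (complex_of_real (sqrt (radicand t))) \<le> 1"
    using AE_radicand by eventually_elim simp
  have "(\<lambda>t. R t * x t $ 1 + of_real (sqrt (radicand t)) * coord2 R x t) \<in> L2"
    by (intro L2_add L2_mult_bounded[OF 1 Rm R1] L2_mult_bounded[OF LRD(3)[OF x] sm s1])
  moreover have "AE t in \<mu>. x t $ 2 = R t * x t $ 1 + of_real (sqrt (radicand t)) * coord2 R x t"
    using AE_radicand by eventually_elim (simp add: coord2_def flip: radicand_def)
  ultimately have 2: "(\<lambda>t. x t $ 2) \<in> L2"
    using L2_cong_AE measurable_vec_nth[OF LRD(1)[OF x]] by blast
  show ?thesis using 1 2 exhaust_2[of i] by auto
qed

text \<open>The self-adjoint weight cancels its inverse, which leaves the unweighted scalar products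
  of the components.\<close>

lemma ip_weighted:
  assumes x: "x \<in> LR R" and a: "a \<in> L2" and b: "b \<in> L2"
  shows "LR_inner R x (weighted a b) = L2_inner (\<lambda>t. x t $ 1) a + L2_inner (\<lambda>t. x t $ 2) b"
proof -
  note i = L2_integrable_inner[OF component_L2[OF x] a] L2_integrable_inner[OF component_L2[OF x] b]
  have "LR_inner R x (weighted a b) = (LINT t|\<mu>. cnj (a t) * x t $ 1 + cnj (b t) * x t $ 2)"
    unfolding LR_inner_def
  proof (rule circle_integral_cong_AE(2))
    show "(\<lambda>t. cnj (a t) * x t $ 1 + cnj (b t) * x t $ 2) \<in> borel_measurable \<mu>"
      using i by (intro borel_measurable_integrable) auto
    show "AE t in \<mu>. cnj (a t) * x t $ 1 + cnj (b t) * x t $ 2 = LR_form R x (weighted a b) t"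
      using R_lt
    proof eventually_elim
      case (elim t)
      define D where "D = 1 - R t * cnj (R t)"
      have D: "complex_of_real (1 - (norm (R t))\<^sup>2) = D" "D \<noteq> 0"
        using one_minus_norm_sq_ne[OF elim] unfolding D_def one_minus_norm_sq by auto
      have "LR_form R x (weighted a b) t =
          (cnj (a t) + R t * cnj (b t)) * ((x t $ 1 - cnj (R t) * x t $ 2) / D) +
          (cnj (R t) * cnj (a t) + cnj (b t)) * ((x t $ 2 - R t * x t $ 1) / D)"
        unfolding LR_form_def matrix_inv_weight[of R, OF elim] sum_2 D(1)
        by (simp add: weighted_def weight_mult)
      also have "\<dots> = ((cnj (a t) + R t * cnj (b t)) * (x t $ 1 - cnj (R t) * x t $ 2) +
          (cnj (R t) * cnj (a t) + cnj (b t)) * (x t $ 2 - R t * x t $ 1)) / D"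
        by (simp add: add_divide_distrib)
      also have "\<dots> = D * (cnj (a t) * x t $ 1 + cnj (b t) * x t $ 2) / D"
        unfolding D_def by (simp add: algebra_simps)
      finally show ?case using D(2) by simp
    qed
  qed
  also have "\<dots> = L2_inner (\<lambda>t. x t $ 1) a + L2_inner (\<lambda>t. x t $ 2) b"
    unfolding L2_inner_def using i by (intro Bochner_Integration.integral_add)
  finally show ?thesis .
qed

end

section \<open>The CMV basis of $L^R$\<close>

lemma L2_inner_cong_AE:
  assumes "f \<in> L2" "g \<in> L2" "f' \<in> L2" "g' \<in> L2"
    and "AE t in \<mu>. cnj (g t) * f t = cnj (g' t) * f' t"
  shows "L2_inner f g = L2_inner f' g'"
  unfolding L2_inner_def
  by (rule integral_cong_AE) (use assms in \<open>auto intro!: borel_measurable_integrable L2_integrable_inner\<close>)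

lemma L2_cnj_powi: "(\<lambda>t. cnj t powi k) \<in> L2"
  using L2_cnj[OF L2_powi[of k]] by simp

lemma L2_inner_cnj_powi: "f \<in> L2 \<Longrightarrow> L2_inner f (\<lambda>t. cnj t powi k) = L2_inner f (\<lambda>t. t powi (- k))"
proof (rule L2_inner_cong_AE)
  show "AE t in \<mu>. cnj (cnj t powi k) * f t = cnj (t powi (- k)) * f t"
    using AE_circle_norm by eventually_elim (simp add: circle_cnj_powi)
qed (auto simp: L2_powi L2_cnj_powi)

lemma L2_zero: "(\<lambda>_. 0) \<in> L2"
  using L2.V_zero by (simp add: zero_fun_def)

lemma L2_inner_zero [simp]: "L2_inner f (\<lambda>_. 0) = 0" "L2_inner (\<lambda>_. 0) f = 0"
  by (simp_all add: L2_inner_def)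

lemma H2_plus_powi: "k \<ge> 0 \<Longrightarrow> (\<lambda>t. t powi k) \<in> H2_plus"
  by (auto simp: H2_plus_def L2_powi L2_inner_powi_powi)

lemma H2_minus_powi: "k < 0 \<Longrightarrow> (\<lambda>t. t powi k) \<in> H2_minus"
  using L2.ip_eq_0_sym[OF _ L2_powi] by (auto simp: H2_minus_def H2_plus_def L2_powi)

lemma H2_plus_L2: "h \<in> H2_plus \<Longrightarrow> h \<in> L2" and H2_minus_L2: "h \<in> H2_minus \<Longrightarrow> h \<in> L2"
  by (auto simp: H2_plus_def H2_minus_def)

lemma H2_plus_cl: "h \<in> H2_plus \<Longrightarrow> h \<in> L2.cl (L2.span ((\<lambda>k t. t powi k) ` {0..}))"
  by (rule L2_cl_span_powi) (auto simp: H2_plus_def)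

lemma H2_minus_cl: "h \<in> H2_minus \<Longrightarrow> h \<in> L2.cl (L2.span ((\<lambda>k t. t powi k) ` {..<0}))"
proof (rule L2_cl_span_powi)
  assume h: "h \<in> H2_minus"
  show "L2_inner h (\<lambda>t. t powi k) = 0" if "k \<notin> {..<0}" for k
    using h H2_plus_powi[of k] that by (auto simp: H2_minus_def)
qed (rule H2_minus_L2)

lemma H2_plus_lincomb: "g \<in> H2_plus \<Longrightarrow> h \<in> H2_plus \<Longrightarrow> (\<lambda>t. g t + c * h t) \<in> H2_plus"
  using L2.ip_add_left[of g "\<lambda>t. c * h t"] L2.ip_scale_left[of h]
  by (auto simp: H2_plus_def L2_add L2_cmult L2_powi plus_fun_def)

lemma H2_minus_lincomb: "g \<in> H2_minus \<Longrightarrow> h \<in> H2_minus \<Longrightarrow> (\<lambda>t. g t + c * h t) \<in> H2_minus"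
  using L2.ip_add_left[of g "\<lambda>t. c * h t"] L2.ip_scale_left[of h]
  by (auto simp: H2_minus_def L2_add L2_cmult H2_plus_L2 plus_fun_def)

lemma zero_H2_plus: "(\<lambda>_. 0) \<in> H2_plus" and zero_H2_minus: "(\<lambda>_. 0) \<in> H2_minus"
  by (auto simp: H2_plus_def H2_minus_def L2_zero)

lemma vector_4: "(vector [a, b, c, d] :: 'a::zero^4) $ 1 = a" "(vector [a, b, c, d] :: 'a::zero^4) $ 2 = b"
    "(vector [a, b, c, d] :: 'a::zero^4) $ 3 = c" "(vector [a, b, c, d] :: 'a::zero^4) $ 4 = d"
  unfolding vector_def by simp_all

text \<open>\<open>\<phi>_pos\<close> says that the Fourier coefficients of negative index vanish,
  and \<open>\<phi>_0\<close> that the mean, which is the value at the origin, does not.\<close>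

locale symbol_with_outer = contractive_symbol +
  fixes \<phi> :: "complex \<Rightarrow> complex"
  assumes \<phi>m: "\<phi> \<in> borel_measurable \<mu>"
    and \<phi>_sq: "AE t in \<mu>. (norm (\<phi> t))\<^sup>2 = 1 - norm (R t)"
    and \<phi>_pos: "k > 0 \<Longrightarrow> (LINT t|\<mu>. t powi k * \<phi> t) = 0"
    and \<phi>_0: "(LINT t|\<mu>. \<phi> t) \<noteq> 0"
begin

definition gen_e :: "int \<Rightarrow> complex \<Rightarrow> complex^2" where
  "gen_e n = weighted (\<lambda>t. t powi n) (\<lambda>_. 0)"

text \<open>The exponent is \<open>m + 1\<close> because the highest frequency in
  \<open>H2_minus\<close> is -1.\<close>

definition gen_f :: "int \<Rightarrow> complex \<Rightarrow> complex^2" where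
  "gen_f m = weighted (\<lambda>_. 0) (\<lambda>t. cnj t powi (m + 1))"

text \<open>The conjugate here and its absence in \<open>dual_f\<close> are dictated by the
  pairings: up to conjugation, both families give the integral of
  \<open>t powi (l - n) * \<phi> t\<close> against their generators, which vanishes for
  \<open>l > n\<close>.\<close>

definition dual_e :: "int \<Rightarrow> complex \<Rightarrow> complex^2" where
  "dual_e n t = vector [cnj (\<phi> t) * t powi n, 0]"

definition dual_f :: "int \<Rightarrow> complex \<Rightarrow> complex^2" where
  "dual_f n t = vector [0, \<phi> t * cnj t powi (n + 1)]"

lemma gen_e_eq: "gen_e n = (\<lambda>t. (t powi n) *s vector [1, R t])"
  by (auto simp: gen_e_def weighted_def weight_mult fun_eq_iff vec_eq_iff forall_2)

lemma gen_f_eq: "gen_f m = (\<lambda>t. (cnj t powi (m + 1)) *s vector [cnj (R t), 1])"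
  by (auto simp: gen_f_def weighted_def weight_mult fun_eq_iff vec_eq_iff forall_2)

lemma gen_e_V: "gen_e n \<in> LR R" and gen_f_V: "gen_f n \<in> LR R"
  by (auto simp: gen_e_def gen_f_def intro!: weighted_V L2_powi L2_cnj_powi L2_zero)

lemma ip_gen_e: "x \<in> LR R \<Longrightarrow> LR_inner R x (gen_e n) = L2_inner (\<lambda>t. x t $ 1) (\<lambda>t. t powi n)"
  unfolding gen_e_def by (subst ip_weighted) (auto simp: L2_powi L2_zero)

lemma ip_gen_f: "x \<in> LR R \<Longrightarrow> LR_inner R x (gen_f m) = L2_inner (\<lambda>t. x t $ 2) (\<lambda>t. t powi (- m - 1))"
  unfolding gen_f_def using L2_inner_cnj_powi[OF component_L2[of x 2], of "m + 1"]
  by (subst ip_weighted) (auto simp: L2_cnj_powi L2_zero)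

text \<open>The factor \<open>1 + norm (R t)\<close> of the radicand is at least 1. This bound is
  what puts the dual vectors into \<open>LR R\<close>.\<close>

lemma \<phi>_le: "AE t in \<mu>. norm (\<phi> t) \<le> sqrt (radicand t)"
  using \<phi>_sq R_lt
proof eventually_elim
  case (elim t)
  have "1 - norm (R t) \<le> (1 - norm (R t)) * (1 + norm (R t))"
    using elim by (simp add: mult_le_cancel_left1)
  also have "\<dots> = radicand t" by (simp add: radicand_def power2_eq_square algebra_simps)
  finally show ?case using elim by (simp add: real_le_rsqrt)
qed

lemma \<phi>_le_1: "AE t in \<mu>. norm (\<phi> t) \<le> 1"
  using \<phi>_le AE_radicand by eventually_elim (meson order_trans real_sqrt_le_1_iff)

lemma \<phi>_ne: "AE t in \<mu>. \<phi> t \<noteq> 0"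
  using \<phi>_sq R_lt by eventually_elim auto

text \<open>The multiplier through which \<open>\<phi>\<close> enters the second coordinate of the
  dual vectors.\<close>

definition \<psi> :: "complex \<Rightarrow> complex" where
  "\<psi> t = \<phi> t / of_real (sqrt (radicand t))"

lemma \<psi>m: "\<psi> \<in> borel_measurable \<mu>"
  unfolding \<psi>_def using \<phi>m radicand_measurable by measurable

lemma \<psi>_le_1: "AE t in \<mu>. norm (\<psi> t) \<le> 1"
  using \<phi>_le AE_radicand by eventually_elim (simp add: \<psi>_def norm_divide)

lemma \<psi>R: "(\<lambda>t. \<psi> t * cnj (R t)) \<in> borel_measurable \<mu>"
    "AE t in \<mu>. norm (\<psi> t * cnj (R t)) \<le> 1"
proof -
  show "(\<lambda>t. \<psi> t * cnj (R t)) \<in> borel_measurable \<mu>"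
    using \<psi>m Rm by measurable
  show "AE t in \<mu>. norm (\<psi> t * cnj (R t)) \<le> 1"
    using \<psi>_le_1 R_lt by eventually_elim (simp add: norm_mult mult_le_one)
qed

lemma powi_measurable: "(\<lambda>t. t powi k) \<in> borel_measurable \<mu>"
    "(\<lambda>t. cnj t powi k) \<in> borel_measurable \<mu>"
  using L2_measurable[OF L2_powi] L2_measurable[OF L2_cnj_powi] by auto

lemma coord_dual:
  "coord1 (dual_e n) = (\<lambda>t. cnj (\<phi> t) * t powi n)"
  "coord2 R (dual_e n) = (\<lambda>t. - cnj (\<psi> t * cnj (R t)) * t powi n)"
  "coord1 (dual_f n) = (\<lambda>t. 0)"
  "coord2 R (dual_f n) = (\<lambda>t. \<psi> t * cnj t powi (n + 1))"
  by (auto simp: fun_eq_iff coord1_def coord2_def dual_e_def dual_f_def \<psi>_def radicand_def)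

lemma dual_e_V: "dual_e n \<in> LR R"
proof -
  note [measurable] = powi_measurable \<phi>m
  have "dual_e n \<in> borel_measurable \<mu>"
    unfolding dual_e_def by (intro measurable_vector_2) measurable
  moreover have "coord1 (dual_e n) \<in> L2"
    unfolding coord_dual using \<phi>_le_1 by (intro L2_mult_bounded[OF L2_powi, where B = 1]) auto
  moreover have "coord2 R (dual_e n) \<in> L2"
  proof -
    have [measurable]: "(\<lambda>t. cnj (\<psi> t * cnj (R t))) \<in> borel_measurable \<mu>"
      using \<psi>R(1) by (rule measurable_compose) measurable
    have "AE t in \<mu>. norm (- cnj (\<psi> t * cnj (R t))) \<le> 1"
      using \<psi>R(2) by eventually_elim (simp only: norm_minus_cancel complex_mod_cnj)
    then show ?thesis unfolding coord_dual by (intro L2_mult_bounded[OF L2_powi, where B = 1]) measurable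
  qed
  ultimately show ?thesis by (simp add: LR_iff)
qed

lemma dual_f_V: "dual_f n \<in> LR R"
proof -
  note [measurable] = powi_measurable \<phi>m
  have "dual_f n \<in> borel_measurable \<mu>"
    unfolding dual_f_def by (intro measurable_vector_2) measurable
  moreover have "coord1 (dual_f n) \<in> L2" unfolding coord_dual by (rule L2_zero)
  moreover have "coord2 R (dual_f n) \<in> L2"
    unfolding coord_dual by (rule L2_mult_bounded[OF L2_cnj_powi \<psi>m \<psi>_le_1])
  ultimately show ?thesis by (simp add: LR_iff)
qed

lemma ip_dual_e_gen_e: "LR_inner R (dual_e n) (gen_e l) = cnj (LINT t|\<mu>. t powi (l - n) * \<phi> t)"
proof -
  note [measurable] = powi_measurable \<phi>m
  have "LR_inner R (dual_e n) (gen_e l) = (LINT t|\<mu>. cnj (t powi l) * (cnj (\<phi> t) * t powi n))"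
    by (simp add: ip_gen_e[OF dual_e_V] L2_inner_def dual_e_def)
  also have "\<dots> = (LINT t|\<mu>. cnj (t powi (l - n) * \<phi> t))"
  proof (rule integral_cong_AE)
    show "AE t in \<mu>. cnj (t powi l) * (cnj (\<phi> t) * t powi n) = cnj (t powi (l - n) * \<phi> t)"
      using AE_circle_norm
    proof eventually_elim
      case (elim t)
      then have "t \<noteq> 0" by auto
      then show ?case using elim
        by (simp add: circle_cnj_powi power_int_diff field_simps flip: power_int_add)
    qed
  qed measurable
  finally show ?thesis by (simp only: Bochner_Integration.integral_cnj)
qed

lemma ip_dual_f_gen_f: "LR_inner R (dual_f n) (gen_f l) = (LINT t|\<mu>. t powi (l - n) * \<phi> t)"
proof -
  note [measurable] = powi_measurable \<phi>m
  have "LR_inner R (dual_f n) (gen_f l) = (LINT t|\<mu>. cnj (t powi (- l - 1)) * (\<phi> t * cnj t powi (n + 1)))"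
    by (simp add: ip_gen_f[OF dual_f_V] L2_inner_def dual_f_def)
  also have "\<dots> = (LINT t|\<mu>. t powi (l - n) * \<phi> t)"
  proof (rule integral_cong_AE)
    show "AE t in \<mu>. cnj (t powi (- l - 1)) * (\<phi> t * cnj t powi (n + 1)) = t powi (l - n) * \<phi> t"
      using AE_circle_norm
    proof eventually_elim
      case (elim t)
      then have t: "t \<noteq> 0" by auto
      have "cnj (t powi (- l - 1)) * (\<phi> t * cnj t powi (n + 1)) = \<phi> t * (t powi (l + 1) * t powi (- (n + 1)))"
        using circle_cnj_powi[OF elim, of "- l - 1"] circle_cnj_powi[OF elim, of "n + 1"] by (simp add: add.commute[of 1])
      also have "t powi (l + 1) * t powi (- (n + 1)) = t powi (l - n)"
        using t by (subst power_int_add[symmetric]) auto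
      finally show ?case by simp
    qed
  qed measurable
  finally show ?thesis .
qed

text \<open>The pairings with the two dual families are the Fourier coefficients of \<open>h\<close>
  and \<open>g\<close>. As the multipliers are nonzero almost everywhere, \<open>g = 0\<close> kills
  the second coordinate of \<open>x\<close>, and then \<open>h = 0\<close> the first.\<close>

lemma dual_total:
  assumes x: "x \<in> LR R" and v: "\<And>n. LR_inner R x (dual_e n) = 0" and w: "\<And>n. LR_inner R x (dual_f n) = 0"
  shows "LR.nrm x = 0"
proof -
  note L = LRD(2)[OF x] LRD(3)[OF x]
  define h where "h t = \<phi> t * coord1 x t - \<psi> t * cnj (R t) * coord2 R x t" for t
  have hL: "h \<in> L2"
    unfolding h_def
    by (intro L2_diff L2_mult_bounded[OF L(1) \<phi>m \<phi>_le_1] L2_mult_bounded[OF L(2) \<psi>R])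
  have "L2_inner h (\<lambda>t. t powi n) = 0" for n
  proof -
    have "L2_inner h (\<lambda>t. t powi n) = (LINT t|\<mu>. cnj (coord1 (dual_e n) t) * coord1 x t + cnj (coord2 R (dual_e n) t) * coord2 R x t)"
      unfolding L2_inner_def
      by (intro Bochner_Integration.integral_cong refl) (simp add: coord_dual h_def algebra_simps)
    also have "\<dots> = LR_inner R x (dual_e n)"
      unfolding LR_inner_coords[OF x dual_e_V] L2_inner_def
      by (intro Bochner_Integration.integral_add L2_integrable_inner L LRD dual_e_V)
    finally show ?thesis using v by simp
  qed
  then have h0: "AE t in \<mu>. h t = 0" by (rule L2_fourier_null[OF hL])
  define g where "g t = cnj (\<psi> t) * coord2 R x t" for t
  have gL: "g \<in> L2"
    unfolding g_def
  proof (rule L2_mult_bounded[OF L(2)])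
    show "(\<lambda>t. cnj (\<psi> t)) \<in> borel_measurable \<mu>" using \<psi>m by measurable
    show "AE t in \<mu>. norm (cnj (\<psi> t)) \<le> 1" using \<psi>_le_1 by simp
  qed
  have "L2_inner g (\<lambda>t. t powi n) = 0" for n
  proof -
    have "L2_inner g (\<lambda>t. cnj t powi (- n - 1 + 1)) = L2_inner (coord2 R x) (coord2 R (dual_f (- n - 1)))"
      unfolding L2_inner_def
      by (intro Bochner_Integration.integral_cong refl) (simp add: coord_dual g_def algebra_simps)
    also have "\<dots> = LR_inner R x (dual_f (- n - 1))"
      unfolding LR_inner_coords[OF x dual_f_V] by (simp add: coord_dual)
    finally show ?thesis using w L2_inner_cnj_powi[OF gL, of "- n"] by simp
  qed
  then have g0: "AE t in \<mu>. g t = 0" by (rule L2_fourier_null[OF gL])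
  have "AE t in \<mu>. x t = 0"
    using h0 g0 \<phi>_ne AE_radicand
  proof eventually_elim
    case (elim t)
    then have "coord2 R x t = 0" by (auto simp: g_def \<psi>_def)
    moreover from this have "coord1 x t = 0" using elim by (auto simp: h_def)
    ultimately show ?case using elim by (intro coords_eq_0) auto
  qed
  then show ?thesis using LR_nrm_0_AE[OF x] by blast
qed

lemma gen_total:
  assumes x: "x \<in> LR R" and e: "\<And>n. LR_inner R x (gen_e n) = 0" and f: "\<And>n. LR_inner R x (gen_f n) = 0"
  shows "LR.nrm x = 0"
proof -
  have "AE t in \<mu>. x t $ 1 = 0"
    by (rule L2_fourier_null[OF component_L2[OF x]]) (use e ip_gen_e[OF x] in simp)
  moreover have "L2_inner (\<lambda>t. x t $ 2) (\<lambda>t. t powi k) = 0" for k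
    using f[of "- k - 1"] ip_gen_f[OF x, of "- k - 1"] by simp
  then have "AE t in \<mu>. x t $ 2 = 0" by (rule L2_fourier_null[OF component_L2[OF x]])
  ultimately have "AE t in \<mu>. x t = 0"
    by eventually_elim (simp add: vec_eq_iff forall_2)
  then show ?thesis using LR_nrm_0_AE[OF x] by blast
qed

lemma U_R_V: "x \<in> LR R \<Longrightarrow> U_R x \<in> LR R"
  unfolding U_R_def using AE_circle_norm
  by (intro LR_mult_bounded[where B = 1] borel_measurable_circle) (auto elim: eventually_mono)

lemma U_R_ip:
  assumes x: "x \<in> LR R" and y: "y \<in> LR R"
  shows "LR_inner R (U_R x) (U_R y) = LR_inner R x y"
proof -
  have m: "(\<lambda>t. t * f t) \<in> L2" if "f \<in> L2" for f
    using L2_powi_mult[OF that, of 1] by simp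
  have "L2_inner (\<lambda>t. t * f t) (\<lambda>t. t * g t) = L2_inner f g" if fg: "f \<in> L2" "g \<in> L2" for f g
  proof (rule L2_inner_cong_AE)
    show "AE t in \<mu>. cnj (t * g t) * (t * f t) = cnj (g t) * f t"
      using AE_circle_norm
    proof eventually_elim
      case (elim t)
      then have "t * cnj t = 1" using complex_norm_square[of t] by simp
      moreover have "cnj (t * g t) * (t * f t) = (t * cnj t) * (cnj (g t) * f t)" by simp
      ultimately show ?case by simp
    qed
  qed (use fg m in auto)
  then show ?thesis
    unfolding LR_inner_coords[OF U_R_V[OF x] U_R_V[OF y]] LR_inner_coords[OF x y]
    by (simp add: U_R_def coord1_scale coord2_scale LRD x y)
qed

sublocale cmv_system "\<lambda>c f t. c *s f t" "LR R" "LR_inner R" gen_e gen_f dual_e dual_f U_R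
proof
  show "gen_e n \<in> LR R" "gen_f n \<in> LR R" "dual_e n \<in> LR R" "dual_f n \<in> LR R" for n
    by (fact gen_e_V gen_f_V dual_e_V dual_f_V)+
  have c1: "LR_inner R (gen_e l) (dual_e n) = (LINT t|\<mu>. t powi (l - n) * \<phi> t)" for l n
    using LR.ip_cnj[OF dual_e_V[of n] gen_e_V[of l]] by (simp add: ip_dual_e_gen_e)
  then show "LR_inner R (gen_e l) (dual_e n) = 0" if "l > n" for l n
    using that \<phi>_pos by simp
  show "LR_inner R (gen_e n) (dual_e n) \<noteq> 0" for n
    using c1[of n n] \<phi>_0 by simp
  have c2: "LR_inner R (gen_f l) (dual_f n) = cnj (LINT t|\<mu>. t powi (l - n) * \<phi> t)" for l n
    using LR.ip_cnj[OF dual_f_V[of n] gen_f_V[of l]] by (simp add: ip_dual_f_gen_f)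
  then show "LR_inner R (gen_f l) (dual_f n) = 0" if "l > n" for l n
    using that \<phi>_pos by simp
  show "LR_inner R (gen_f n) (dual_f n) \<noteq> 0" for n
    using c2[of n n] \<phi>_0 by simp
  show "LR_inner R (gen_f l) (dual_e n) = 0" for l n
    by (rule LR.ip_eq_0_sym[OF dual_e_V gen_f_V]) (simp add: ip_gen_f[OF dual_e_V] dual_e_def)
  show "LR_inner R (gen_e l) (dual_f n) = 0" for l n
    by (rule LR.ip_eq_0_sym[OF dual_f_V gen_e_V]) (simp add: ip_gen_e[OF dual_f_V] dual_f_def)
  show "LR.nrm x = 0" if "x \<in> LR R" "\<And>n. LR_inner R x (dual_e n) = 0" "\<And>n. LR_inner R x (dual_f n) = 0" for x
    using that by (rule dual_total)
  show "LR.nrm x = 0" if "x \<in> LR R" "\<And>n. LR_inner R x (gen_e n) = 0" "\<And>n. LR_inner R x (gen_f n) = 0" for x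
    using that by (rule gen_total)
  show "U_R x \<in> LR R" if "x \<in> LR R" for x using that by (rule U_R_V)
  show "U_R (x + y) = U_R x + U_R y" for x y
    by (simp add: U_R_def fun_eq_iff vec_eq_iff distrib_left)
  show "U_R (\<lambda>t. c *s x t) = (\<lambda>t. c *s U_R x t)" for c x
    by (simp add: U_R_def fun_eq_iff vec_eq_iff)
  show "LR_inner R (U_R x) (U_R y) = LR_inner R x y" if "x \<in> LR R" "y \<in> LR R" for x y
    using that by (rule U_R_ip)
  show "LR.nrm (U_R (gen_e n) - gen_e (n + 1)) = 0" for n
    unfolding LR_nrm_diff_AE[OF U_R_V[OF gen_e_V] gen_e_V]
    using AE_circle_norm
  proof eventually_elim
    case (elim t)
    then have "t \<noteq> 0" by auto
    then have "t powi (n + 1) = t * t powi n" by (simp add: power_int_add)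
    then show ?case by (simp add: gen_e_eq U_R_def vec_eq_iff)
  qed
  show "LR.nrm (U_R (gen_f n) - gen_f (n - 1)) = 0" for n
    unfolding LR_nrm_diff_AE[OF U_R_V[OF gen_f_V] gen_f_V]
    using AE_circle_norm
  proof eventually_elim
    case (elim t)
    then have t: "t \<noteq> 0" "t * cnj t = 1" using complex_norm_square[of t] by auto
    then have "cnj t powi (n + 1) = cnj t * cnj t powi n" by (simp add: power_int_add)
    then have "t * cnj t powi (n + 1) = cnj t powi n" using t by (simp flip: mult.assoc)
    then show ?case by (simp add: gen_f_eq U_R_def vec_eq_iff flip: mult.assoc)
  qed
qed

text \<open>Carries the description of the Hardy spaces as closed spans of monomials over to
  \<open>LR R\<close>, along multiplication by a power followed by the weight.\<close>

lemma isometry_cl_span: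
  assumes add: "\<And>x y. A (x + y) = A x + A y" and scale: "\<And>c x. A (\<lambda>t. c * x t) = (\<lambda>t. c *s A x t)"
    and V: "\<And>x. x \<in> L2 \<Longrightarrow> A x \<in> LR R" and nrm: "\<And>x. x \<in> L2 \<Longrightarrow> LR.nrm (A x) = L2.nrm x"
    and S: "\<And>s. s \<in> S \<Longrightarrow> A s \<in> LR.cl (LR.span T)" and x: "x \<in> L2.cl (L2.span S)"
  shows "A x \<in> LR.cl (LR.span T)"
proof -
  have diff: "A (x - y) = A x - A y" for x y
    using add[of "x - y" y] by (simp add: eq_diff_eq)
  have A0: "A 0 = 0" using diff[of 0 0] by simp
  have "L2.subspace {x. A x \<in> LR.cl (LR.span T)}"
  proof (rule L2.subspaceI)
    show "0 \<in> {x. A x \<in> LR.cl (LR.span T)}"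
      using A0 LR.subspace_0[OF LR.subspace_cl_span] by simp
    show "x + y \<in> {x. A x \<in> LR.cl (LR.span T)}"
      if "x \<in> {x. A x \<in> LR.cl (LR.span T)}" "y \<in> {x. A x \<in> LR.cl (LR.span T)}" for x y
      using that LR.subspace_add[OF LR.subspace_cl_span] by (simp only: add mem_Collect_eq)
    show "(\<lambda>t. c * x t) \<in> {x. A x \<in> LR.cl (LR.span T)}" if "x \<in> {x. A x \<in> LR.cl (LR.span T)}" for c x
      using that LR.subspace_scale[OF LR.subspace_cl_span] by (simp only: scale mem_Collect_eq)
  qed
  then have sp: "L2.span S \<subseteq> {x. A x \<in> LR.cl (LR.span T)}"
    using S by (intro L2.span_minimal) auto
  have xL: "x \<in> L2" using x by (rule L2.cl_V)
  have "A x \<in> LR.cl (LR.cl (LR.span T))"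
  proof (rule LR.clI)
    show "A x \<in> LR R" using xL by (rule V)
    fix \<epsilon> :: real assume e: "\<epsilon> > 0"
    obtain g where g: "g \<in> L2.span S" "g \<in> L2" "L2.nrm (x - g) < \<epsilon>"
      using L2.cl_obtain[OF x e] by blast
    have "LR.nrm (A x - A g) < \<epsilon>" using nrm[OF L2.V_diff[OF xL g(2)]] g(3) by (simp only: diff)
    then show "\<exists>g. g \<in> LR.cl (LR.span T) \<and> g \<in> LR R \<and> LR.nrm (A x - g) < \<epsilon>"
      using g(1,2) sp V by blast
  qed
  then show ?thesis using LR.cl_cl by blast
qed

lemma gen_mem_H: "k \<ge> n \<Longrightarrow> gen_e k \<in> H n m" "k \<ge> m \<Longrightarrow> gen_f k \<in> H n m"
  using LR.subset_cl_span[OF G_V, of n m] unfolding H_def G_def by auto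

lemma nrm_weighted:
  assumes "a \<in> L2"
  shows "LR.nrm (weighted a (\<lambda>_. 0)) = L2.nrm a" "LR.nrm (weighted (\<lambda>_. 0) a) = L2.nrm a"
proof -
  have c: "(\<lambda>t. weighted a (\<lambda>_. 0) t $ 1) = a" "(\<lambda>t. weighted (\<lambda>_. 0) a t $ 2) = a"
    by (auto simp: weighted_def weight_mult fun_eq_iff)
  show "LR.nrm (weighted a (\<lambda>_. 0)) = L2.nrm a" "LR.nrm (weighted (\<lambda>_. 0) a) = L2.nrm a"
    using ip_weighted[OF weighted_V[OF assms L2_zero] assms L2_zero]
      ip_weighted[OF weighted_V[OF L2_zero assms] L2_zero assms]
    by (simp_all add: LR.nrm_def L2.nrm_def c)
qed

lemma L2_nrm_mult_unimodular:
  assumes "AE t in \<mu>. norm (c t) = 1" "f \<in> L2" "(\<lambda>t. c t * f t) \<in> L2"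
  shows "L2.nrm (\<lambda>t. c t * f t) = L2.nrm f"
proof -
  have "(LINT t|\<mu>. (norm (c t * f t))\<^sup>2) = (LINT t|\<mu>. (norm (f t))\<^sup>2)"
  proof (rule integral_cong_AE)
    show "AE t in \<mu>. (norm (c t * f t))\<^sup>2 = (norm (f t))\<^sup>2"
      using assms(1) by eventually_elim (simp add: norm_mult)
  qed (use L2_integrable_sq[OF assms(2)] L2_integrable_sq[OF assms(3)] in auto)
  then show ?thesis by (simp add: L2_nrm)
qed

lemma weighted_plus_H:
  assumes h: "h \<in> H2_plus"
  shows "weighted (\<lambda>t. t powi n * h t) (\<lambda>_. 0) \<in> H n m"
  unfolding H_def
proof (rule isometry_cl_span[where A = "\<lambda>h. weighted (\<lambda>t. t powi n * h t) (\<lambda>_. 0)", OF _ _ _ _ _ H2_plus_cl[OF h]])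
  fix x :: "complex \<Rightarrow> complex" assume x: "x \<in> L2"
  show "weighted (\<lambda>t. t powi n * x t) (\<lambda>_. 0) \<in> LR R" by (intro weighted_V L2_zero L2_powi_mult x)
  show "LR.nrm (weighted (\<lambda>t. t powi n * x t) (\<lambda>_. 0)) = L2.nrm x"
    using nrm_weighted(1)[OF L2_powi_mult[OF x]] L2_nrm_mult_unimodular[OF AE_circle_powi x L2_powi_mult[OF x]] by simp
next
  fix s :: "complex \<Rightarrow> complex" assume "s \<in> (\<lambda>k t. t powi k) ` {0..}"
  then obtain k where k: "s = (\<lambda>t. t powi k)" "k \<ge> 0" by auto
  have V: "weighted (\<lambda>t. t powi n * s t) (\<lambda>_. 0) \<in> LR R"
    unfolding k by (intro weighted_V L2_zero L2_powi_mult L2_powi)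
  have "gen_e (n + k) \<in> LR.cl (LR.span (G n m))" using gen_mem_H(1)[of n "n + k" m] k by (simp add: H_def)
  then show "weighted (\<lambda>t. t powi n * s t) (\<lambda>_. 0) \<in> LR.cl (LR.span (G n m))"
  proof (rule LR.cl_add_null[OF _ V])
    \<comment> \<open>Combining the powers needs \<open>t \<noteq> 0\<close>, so the two functions
      are only shown to agree almost everywhere.\<close>
    show "LR.nrm (weighted (\<lambda>t. t powi n * s t) (\<lambda>_. 0) - gen_e (n + k)) = 0"
      unfolding LR_nrm_diff_AE[OF V gen_e_V]
      using AE_circle_norm
    proof eventually_elim
      case (elim t)
      then have "t \<noteq> 0" by auto
      then show ?case by (simp add: k gen_e_def weighted_def power_int_add)
    qed
  qed
qed (auto simp: weighted_def weight_mult fun_eq_iff vec_eq_iff forall_2 algebra_simps)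

lemma L2_cnj_powi_mult: "f \<in> L2 \<Longrightarrow> (\<lambda>t. cnj t powi k * f t) \<in> L2"
proof (rule L2_mult_bounded[where B = 1])
  show "AE t in \<mu>. norm (cnj t powi k) \<le> 1"
    using AE_circle_norm by eventually_elim (simp add: norm_power_int)
qed (auto intro: powi_measurable)

lemma weighted_minus_H:
  assumes h: "h \<in> H2_minus"
  shows "weighted (\<lambda>_. 0) (\<lambda>t. cnj t powi m * h t) \<in> H n m"
  unfolding H_def
proof (rule isometry_cl_span[where A = "\<lambda>h. weighted (\<lambda>_. 0) (\<lambda>t. cnj t powi m * h t)", OF _ _ _ _ _ H2_minus_cl[OF h]])
  fix x :: "complex \<Rightarrow> complex" assume x: "x \<in> L2"
  have u: "AE t in \<mu>. norm (cnj t powi m) = 1"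
    using AE_circle_norm by eventually_elim (simp add: norm_power_int)
  show "weighted (\<lambda>_. 0) (\<lambda>t. cnj t powi m * x t) \<in> LR R" by (intro weighted_V L2_zero L2_cnj_powi_mult x)
  show "LR.nrm (weighted (\<lambda>_. 0) (\<lambda>t. cnj t powi m * x t)) = L2.nrm x"
    using nrm_weighted(2)[OF L2_cnj_powi_mult[OF x]] L2_nrm_mult_unimodular[OF u x L2_cnj_powi_mult[OF x]] by simp
next
  fix s :: "complex \<Rightarrow> complex" assume "s \<in> (\<lambda>k t. t powi k) ` {..<0}"
  then obtain k where k: "s = (\<lambda>t. t powi k)" "k < 0" by auto
  have V: "weighted (\<lambda>_. 0) (\<lambda>t. cnj t powi m * s t) \<in> LR R"
    unfolding k by (intro weighted_V L2_zero L2_cnj_powi_mult L2_powi)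
  have "gen_f (m - k - 1) \<in> LR.cl (LR.span (G n m))"
    using gen_mem_H(2)[of m "m - k - 1" n] k by (simp add: H_def)
  then show "weighted (\<lambda>_. 0) (\<lambda>t. cnj t powi m * s t) \<in> LR.cl (LR.span (G n m))"
  proof (rule LR.cl_add_null[OF _ V])
    show "LR.nrm (weighted (\<lambda>_. 0) (\<lambda>t. cnj t powi m * s t) - gen_f (m - k - 1)) = 0"
      unfolding LR_nrm_diff_AE[OF V gen_f_V]
      using AE_circle_norm
    proof eventually_elim
      case (elim t)
      then have "t \<noteq> 0" by auto
      then have "cnj t powi m * t powi k = cnj t powi (m - k)"
        unfolding circle_cnj_powi[OF elim] by (subst power_int_add[symmetric]) auto
      then show ?case by (simp add: k gen_f_def weighted_def)
    qed
  qed
qed (auto simp: weighted_def weight_mult fun_eq_iff vec_eq_iff forall_2 algebra_simps)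

text \<open>Up to null sets the generators of \<open>H n m\<close> are the monomial cases of the
  defining set \<open>T\<close>; conversely, \<open>T\<close> lies in \<open>H n m\<close> because
  Hardy functions are limits of combinations of monomials.\<close>

lemma H_check_eq: "H_check R n m = H n m"
proof -
  define T where "T = {(\<lambda>t. weight R t *v vector [t powi n * hp t, cnj t powi m * hm t]) | hp hm.
      hp \<in> H2_plus \<and> hm \<in> H2_minus}"
  have T_eq: "T = {weighted (\<lambda>t. t powi n * hp t) (\<lambda>t. cnj t powi m * hm t) | hp hm. hp \<in> H2_plus \<and> hm \<in> H2_minus}"
    by (simp add: T_def weighted_def[abs_def])
  have "T \<subseteq> H n m"
  proof
    fix x assume "x \<in> T"
    then obtain hp hm where x: "x = weighted (\<lambda>t. t powi n * hp t) (\<lambda>t. cnj t powi m * hm t)"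
      and h: "hp \<in> H2_plus" "hm \<in> H2_minus" unfolding T_eq by blast
    have "x = weighted (\<lambda>t. t powi n * hp t) (\<lambda>_. 0) + weighted (\<lambda>_. 0) (\<lambda>t. cnj t powi m * hm t)"
      by (auto simp: x weighted_def weight_mult fun_eq_iff vec_eq_iff forall_2)
    then show "x \<in> H n m"
      using LR.subspace_add[OF subspace_H weighted_plus_H[OF h(1)] weighted_minus_H[OF h(2)]] by simp
  qed
  then have 1: "LR.cl T \<subseteq> H n m" unfolding H_def using LR.cl_mono LR.cl_cl by blast
  have sub: "LR.subspace T"
  proof (rule LR.subspaceI)
    show "0 \<in> T"
      unfolding T_eq using zero_H2_plus zero_H2_minus
      by (force simp: weighted_def weight_mult fun_eq_iff vec_eq_iff forall_2)
  next
    fix x y assume "x \<in> T" "y \<in> T"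
    then obtain hp hm gp gm where x: "x = weighted (\<lambda>t. t powi n * hp t) (\<lambda>t. cnj t powi m * hm t)"
      and y: "y = weighted (\<lambda>t. t powi n * gp t) (\<lambda>t. cnj t powi m * gm t)"
      and h: "hp \<in> H2_plus" "hm \<in> H2_minus" "gp \<in> H2_plus" "gm \<in> H2_minus" unfolding T_eq by blast
    \<comment> \<open>The factor 1 keeps the literal form of \<open>H2_plus_lincomb\<close> and
      \<open>H2_minus_lincomb\<close>; in the scaling case below the summand 0 does the
      same.\<close>
    define p q where "p = (\<lambda>t. hp t + 1 * gp t)" and "q = (\<lambda>t. hm t + 1 * gm t)"
    have "x + y = weighted (\<lambda>t. t powi n * p t) (\<lambda>t. cnj t powi m * q t)"
      by (auto simp: x y p_def q_def weighted_def weight_mult fun_eq_iff vec_eq_iff forall_2 algebra_simps)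
    moreover have "p \<in> H2_plus" "q \<in> H2_minus"
      unfolding p_def q_def by (rule H2_plus_lincomb[OF h(1,3)], rule H2_minus_lincomb[OF h(2,4)])
    ultimately show "x + y \<in> T" unfolding T_eq by blast
  next
    fix c x assume "x \<in> T"
    then obtain hp hm where x: "x = weighted (\<lambda>t. t powi n * hp t) (\<lambda>t. cnj t powi m * hm t)"
      and h: "hp \<in> H2_plus" "hm \<in> H2_minus" unfolding T_eq by blast
    define p q where "p = (\<lambda>t. 0 + c * hp t)" and "q = (\<lambda>t. 0 + c * hm t)"
    have "(\<lambda>t. c *s x t) = weighted (\<lambda>t. t powi n * p t) (\<lambda>t. cnj t powi m * q t)"
      by (auto simp: x p_def q_def weighted_def weight_mult fun_eq_iff vec_eq_iff forall_2 algebra_simps)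
    moreover have "p \<in> H2_plus" "q \<in> H2_minus"
      unfolding p_def q_def by (rule H2_plus_lincomb[OF zero_H2_plus h(1)], rule H2_minus_lincomb[OF zero_H2_minus h(2)])
    ultimately show "(\<lambda>t. c *s x t) \<in> T" unfolding T_eq by blast
  qed
  have "T \<subseteq> LR R"
    unfolding T_eq using H2_plus_L2 H2_minus_L2 by (auto intro!: weighted_V L2_powi_mult L2_cnj_powi_mult)
  then have Tcl: "T \<subseteq> LR.cl T" by (rule LR.cl_subset)
  have "gen_e k \<in> LR.cl T" if k: "k \<ge> n" for k
  proof -
    define y where "y = weighted (\<lambda>t. t powi n * t powi (k - n)) (\<lambda>t. cnj t powi m * 0)"
    have "y \<in> T" unfolding T_eq y_def using H2_plus_powi[of "k - n"] zero_H2_minus k by fastforce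
    then have y: "y \<in> LR.cl T" using Tcl by blast
    show ?thesis
    proof (rule LR.cl_add_null[OF y gen_e_V], subst LR_nrm_diff_AE[OF gen_e_V LR.cl_V[OF y]])
      show "AE t in \<mu>. gen_e k t = y t"
        using AE_circle_norm
      proof eventually_elim
        case (elim t)
        then have "t \<noteq> 0" by auto
        then have "t powi n * t powi (k - n) = t powi k" by (subst power_int_add[symmetric]) auto
        then show ?case by (simp add: gen_e_def y_def weighted_def)
      qed
    qed
  qed
  moreover have "gen_f k \<in> LR.cl T" if k: "k \<ge> m" for k
  proof -
    \<comment> \<open>The frequency \<open>m - k - 1\<close> is negative because of
      \<open>k \<ge> m\<close>, and on the circle it combines with \<open>cnj t powi m\<close> to
      \<open>cnj t powi (k + 1)\<close>.\<close>
    define y where "y = weighted (\<lambda>t. t powi n * 0) (\<lambda>t. cnj t powi m * t powi (m - k - 1))"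
    have "y \<in> T" unfolding T_eq y_def using H2_minus_powi[of "m - k - 1"] zero_H2_plus k by fastforce
    then have y: "y \<in> LR.cl T" using Tcl by blast
    show ?thesis
    proof (rule LR.cl_add_null[OF y gen_f_V], subst LR_nrm_diff_AE[OF gen_f_V LR.cl_V[OF y]])
      show "AE t in \<mu>. gen_f k t = y t"
        using AE_circle_norm
      proof eventually_elim
        case (elim t)
        then have "t \<noteq> 0" by auto
        then have "cnj t powi m * t powi (m - k - 1) = cnj t powi (k + 1)"
          unfolding circle_cnj_powi[OF elim] by (subst power_int_add[symmetric]) auto
        then show ?case by (simp add: gen_f_def y_def weighted_def)
      qed
    qed
  qed
  ultimately have "G n m \<subseteq> LR.cl T" by (auto simp: G_def)
  then have "LR.span (G n m) \<subseteq> LR.cl T" by (intro LR.span_minimal LR.subspace_cl sub)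
  then have 2: "H n m \<subseteq> LR.cl T" unfolding H_def using LR.cl_mono LR.cl_cl by blast
  show ?thesis using 1 2 unfolding H_check_def LR_closure_eq T_def by blast
qed

text \<open>The predicate under \<open>SOME\<close> in \<open>K_check\<close> is
  \<open>unit_defect\<close>, whose solvability is already known, so the chosen vector satisfies
  it.\<close>

lemma unit_defect_K_check: "LR.unit_defect (gen_e n) (G (n + 1) m) (K_check R n m)"
proof -
  have "LR.unit_defect (gen_e n) (G (n + 1) m) k \<longleftrightarrow>
      k \<in> LR_ominus R (H_check R n m) (H_check R (n + 1) m) \<and> LR_norm R k = 1 \<and>
      LR_inner R (\<lambda>t. (t powi n) *s vector [1, R t]) k > 0" for k
    using G_e[of n m]
    by (auto simp: LR.unit_defect_def LR_ominus_def H_check_eq H_def LR_norm_eq gen_e_eq)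
  then show ?thesis
    unfolding K_check_def using someI_ex[OF e_ex[of n m]] by presburger
qed

lemma unit_defect_K_check_tilde: "LR.unit_defect (gen_f m) (G n (m + 1)) (K_check_tilde R n m)"
proof -
  have "LR.unit_defect (gen_f m) (G n (m + 1)) k \<longleftrightarrow>
      k \<in> LR_ominus R (H_check R n m) (H_check R n (m + 1)) \<and> LR_norm R k = 1 \<and>
      LR_inner R k (\<lambda>t. (cnj t powi (m + 1)) *s vector [cnj (R t), 1]) > 0" for k
  proof -
    \<comment> \<open>The normalization of the tilde family has its arguments in the opposite order;
      conjugation preserves positive reals.\<close>
    have pos: "0 < LR_inner R (gen_f m) k \<longleftrightarrow> 0 < LR_inner R k (gen_f m)" if "k \<in> H n m"
      using LR.ip_cnj[OF H_V[OF that] gen_f_V, of m] by (simp add: LR.complex_pos_iff)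
    have "LR.cl (LR.span (insert (gen_f m) (G n (m + 1)))) = H n m"
      unfolding H_def by (simp only: G_f[of n m])
    then show ?thesis
      unfolding LR.unit_defect_def LR_ominus_def H_check_eq LR_norm_eq gen_f_eq[symmetric] mem_Collect_eq
        H_def[of n "m + 1", symmetric] using pos by auto
  qed
  then show ?thesis
    unfolding K_check_tilde_def using someI_ex[OF f_ex[of m n]] by presburger
qed

sublocale cmv_basis "\<lambda>c f t. c *s f t" "LR R" "LR_inner R" gen_e gen_f dual_e dual_f U_R
    "K_check R" "K_check_tilde R"
  by standard (fact unit_defect_K_check unit_defect_K_check_tilde)+

lemma alpha_check_eq: "alpha_check R = \<alpha>"
proof
  fix j
  show "alpha_check R j = \<alpha> j"
    unfolding alpha_check_def
  proof (rule the_equality)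
    show "\<forall>n m. n + m = j \<longrightarrow> LR_inner R (K_check R n m) (K_check_tilde R n m) = \<alpha> j"
      using ip_K_L by blast
    show "a = \<alpha> j" if "\<forall>n m. n + m = j \<longrightarrow> LR_inner R (K_check R n m) (K_check_tilde R n m) = a" for a
      using that ip_K_L[of j 0] by auto
  qed
qed

lemma rho_check_eq: "rho_check R = \<rho>"
  by (simp add: fun_eq_iff rho_check_def \<rho>_def alpha_check_eq)

lemma cmv_sequence_eq: "cmv_sequence R = b"
  by (simp add: fun_eq_iff cmv_sequence_def b_def Let_def)

lemma orthonormal_basis: "LR_orthonormal_basis R (cmv_sequence R)"
  unfolding LR_orthonormal_basis_def
proof (intro conjI allI)
  show "cmv_sequence R j \<in> LR R" for j by (simp add: cmv_sequence_eq)
  show "LR_inner R (cmv_sequence R i) (cmv_sequence R j) = (if i = j then 1 else 0)" for i j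
    by (simp add: cmv_sequence_eq b_orthonormal)
  \<comment> \<open>As a subspace containing every \<open>b j\<close>, \<open>LR_span b\<close>
    contains the abstract span, whose density is known.\<close>
  have "LR.subspace (LR_span b)"
  proof (rule LR.subspaceI)
    show "0 \<in> LR_span b"
      unfolding LR_span_def by (auto intro!: exI[of _ "{}"] simp: fun_eq_iff)
  next
    fix x y assume "x \<in> LR_span b" "y \<in> LR_span b"
    then obtain F c F' c' where x: "x = (\<lambda>t. \<Sum>j\<in>F. c j *s b j t)" "finite F"
      and y: "y = (\<lambda>t. \<Sum>j\<in>F'. c' j *s b j t)" "finite F'" unfolding LR_span_def by blast
    \<comment> \<open>Both coefficient families are extended by zero to the union of the index
      sets.\<close>
    define d where "d j = (if j \<in> F then c j else 0) + (if j \<in> F' then c' j else 0)" for j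
    have "(\<Sum>j\<in>F. c j *s b j t) = (\<Sum>j\<in>F \<union> F'. (if j \<in> F then c j else 0) *s b j t)" for t
      using x(2) y(2) by (intro sum.mono_neutral_cong_left) auto
    moreover have "(\<Sum>j\<in>F'. c' j *s b j t) = (\<Sum>j\<in>F \<union> F'. (if j \<in> F' then c' j else 0) *s b j t)" for t
      using x(2) y(2) by (intro sum.mono_neutral_cong_left) auto
    ultimately have "x + y = (\<lambda>t. \<Sum>j\<in>F \<union> F'. d j *s b j t)"
      by (simp add: x(1) y(1) fun_eq_iff d_def vector_sadd_rdistrib sum.distrib)
    then show "x + y \<in> LR_span b" unfolding LR_span_def using x(2) y(2) by blast
  next
    fix c x assume "x \<in> LR_span b"
    then obtain F a where x: "x = (\<lambda>t. \<Sum>j\<in>F. a j *s b j t)" "finite F" unfolding LR_span_def by blast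
    define d where "d j = c * a j" for j
    have "(\<lambda>t. c *s x t) = (\<lambda>t. \<Sum>j\<in>F. d j *s b j t)"
      by (simp add: x(1) d_def fun_eq_iff vec_eq_iff sum_distrib_left mult.assoc)
    then show "(\<lambda>t. c *s x t) \<in> LR_span b" unfolding LR_span_def using x(2) by blast
  qed
  moreover have "b j \<in> LR_span b" for j
    unfolding LR_span_def
    by (auto intro!: exI[of _ "{j}"] exI[of _ "\<lambda>_. 1"] simp: fun_eq_iff)
  ultimately have "LR.span (range b) \<subseteq> LR_span b" by (intro LR.span_minimal) auto
  then have "LR R \<subseteq> LR.cl (LR_span b)" using b_total LR.cl_mono by blast
  then show "LR_closure R (LR_span (cmv_sequence R)) = LR R"
    unfolding LR_closure_eq cmv_sequence_eq using LR.cl_V by blast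
qed

section \<open>The pointwise recurrences and the matrix of multiplication by
  \<open>t\<close>\<close>

lemma K_rec_AE: "AE t in \<mu>. K_check R n m t =
    \<alpha> (n + m) *s K_check_tilde R n m t + of_real (\<rho> (n + m)) *s K_check R n (m + 1) t"
proof -
  define y where "y = (\<lambda>t. \<alpha> (n + m) *s K_check_tilde R n m t) + (\<lambda>t. of_real (\<rho> (n + m)) *s K_check R n (m + 1) t)"
  have "y \<in> LR R" unfolding y_def by (intro LR.V_add LR.V_scale K_V L_V)
  then have "AE t in \<mu>. K_check R n m t = y t"
    using K_rec[of n m] LR_nrm_diff_AE[OF K_V] unfolding y_def by blast
  then show ?thesis by (simp add: y_def)
qed

lemma L_rec_AE: "AE t in \<mu>. K_check_tilde R n m t =
    cnj (\<alpha> (n + m)) *s K_check R n m t + of_real (\<rho> (n + m)) *s K_check_tilde R (n + 1) m t"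
proof -
  define y where "y = (\<lambda>t. cnj (\<alpha> (n + m)) *s K_check R n m t) + (\<lambda>t. of_real (\<rho> (n + m)) *s K_check_tilde R (n + 1) m t)"
  have "y \<in> LR R" unfolding y_def by (intro LR.V_add LR.V_scale K_V L_V)
  then have "AE t in \<mu>. K_check_tilde R n m t = y t"
    using L_rec[of n m] LR_nrm_diff_AE[OF L_V] unfolding y_def by blast
  then show ?thesis by (simp add: y_def)
qed

text \<open>\<open>K_check R n m\<close> is eliminated from the two recurrences; the identity
  \<rho>^2 = 1 - |\<alpha>|^2 and division by \<rho> > 0 give the second column of the unitary 2 by
  2 factor.\<close>

lemma L_Suc_AE: "AE t in \<mu>. K_check_tilde R (n + 1) m t =
    of_real (\<rho> (n + m)) *s K_check_tilde R n m t - cnj (\<alpha> (n + m)) *s K_check R n (m + 1) t"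
  using K_rec_AE[of n m] L_rec_AE[of n m]
proof eventually_elim
  case (elim t)
  define a r where "a = \<alpha> (n + m)" and "r = complex_of_real (\<rho> (n + m))"
  have "norm a < 1" unfolding a_def by (rule norm_\<alpha>)
  then have "(norm a)\<^sup>2 \<le> 1" by (simp add: abs_square_le_1)
  then have "(\<rho> (n + m))\<^sup>2 = 1 - (norm a)\<^sup>2" by (simp add: \<rho>_def a_def)
  then have "r\<^sup>2 = complex_of_real (1 - (norm a)\<^sup>2)" unfolding r_def by (metis of_real_power)
  then have ra: "r * r = 1 - a * cnj a" unfolding one_minus_norm_sq by (simp add: power2_eq_square)
  have r0: "r \<noteq> 0" using \<rho>_pos[of "n + m"] by (simp add: r_def)
  have "K_check_tilde R (n + 1) m t $ i = r * K_check_tilde R n m t $ i - cnj a * K_check R n (m + 1) t $ i" for i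
  proof -
    define k l k' l' where "k = K_check R n m t $ i" and "l = K_check_tilde R n m t $ i"
      and "k' = K_check R n (m + 1) t $ i" and "l' = K_check_tilde R (n + 1) m t $ i"
    have 1: "k = a * l + r * k'" and 2: "l = cnj a * k + r * l'"
      using arg_cong[OF elim(1), of "\<lambda>v. v $ i"] arg_cong[OF elim(2), of "\<lambda>v. v $ i"]
      by (simp_all add: k_def l_def k'_def l'_def a_def r_def)
    have "r * l' = l - cnj a * k" using 2 by (simp add: algebra_simps)
    also have "\<dots> = (1 - a * cnj a) * l - cnj a * (r * k')" unfolding 1 by (simp add: algebra_simps)
    also have "\<dots> = r * (r * l - cnj a * k')" by (simp add: algebra_simps flip: ra)
    finally have "l' = r * l - cnj a * k'" using r0 by simp
    then show ?thesis by (simp add: k_def l_def k'_def l'_def)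
  qed
  then show ?case by (simp add: vec_eq_iff a_def r_def)
qed

text \<open>Multiplication by \<open>t\<close> gives \<open>K_check R (n + 1) (n - 1)\<close> and
  \<open>K_check_tilde R (n + 2) (n - 1)\<close>. The right factor, of index \<open>2 * n\<close>,
  expresses them through \<open>K_check_tilde R (n + 1) (n - 1)\<close> and
  \<open>K_check R (n + 1) n\<close>; the left factor, of indices \<open>2 * n - 1\<close> and
  \<open>2 * n + 1\<close>, resolves these two in the basis.\<close>

lemma cmv_matrix: "AE t in \<mu>.
    (vector [U_R (K_check R n n) t, U_R (K_check_tilde R (n + 1) n) t] :: (complex^2)^2) =
    row_times_matrix
      (vector [K_check_tilde R n (n - 1) t, K_check R n n t,
               K_check_tilde R (n + 1) n t, K_check R (n + 1) (n + 1) t] :: (complex^2)^4)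
      (cmv_left R n ** cmv_right R n)"
proof -
  have UK: "AE t in \<mu>. U_R (K_check R n n) t = K_check R (n + 1) (n - 1) t"
    using U_K[of n n] LR_nrm_diff_AE[OF U_R_V[OF K_V] K_V] by blast
  have UL: "AE t in \<mu>. U_R (K_check_tilde R (n + 1) n) t = K_check_tilde R (n + 2) (n - 1) t"
  proof -
    have "n + 1 + 1 = n + 2" by simp
    with iffD1[OF LR_nrm_diff_AE[OF U_R_V[OF L_V] L_V] U_L[of "n + 1" n]] show ?thesis by (simp only:)
  qed
  have X1: "AE t in \<mu>. K_check_tilde R (n + 1) (n - 1) t =
      of_real (\<rho> (2 * n - 1)) *s K_check_tilde R n (n - 1) t - cnj (\<alpha> (2 * n - 1)) *s K_check R n n t"
  proof -
    have "n + (n - 1) = 2 * n - 1" "n - 1 + 1 = n" by auto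
    then show ?thesis using L_Suc_AE[of n "n - 1"] by (simp only:)
  qed
  have X2: "AE t in \<mu>. K_check R (n + 1) n t =
      \<alpha> (2 * n + 1) *s K_check_tilde R (n + 1) n t + of_real (\<rho> (2 * n + 1)) *s K_check R (n + 1) (n + 1) t"
  proof -
    have "n + 1 + n = 2 * n + 1" by auto
    then show ?thesis using K_rec_AE[of "n + 1" n] by (simp only:)
  qed
  have j: "n + 1 + (n - 1) = 2 * n" "n - 1 + 1 = n" "n + 1 + 1 = n + 2" by auto
  have Y1: "AE t in \<mu>. K_check R (n + 1) (n - 1) t =
      \<alpha> (2 * n) *s K_check_tilde R (n + 1) (n - 1) t + of_real (\<rho> (2 * n)) *s K_check R (n + 1) n t"
    using K_rec_AE[of "n + 1" "n - 1"] by (simp only: j)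
  have Y2: "AE t in \<mu>. K_check_tilde R (n + 2) (n - 1) t =
      of_real (\<rho> (2 * n)) *s K_check_tilde R (n + 1) (n - 1) t - cnj (\<alpha> (2 * n)) *s K_check R (n + 1) n t"
    using L_Suc_AE[of "n + 1" "n - 1"] by (simp only: j)
  show ?thesis
    using UK UL X1 X2 Y1 Y2
  proof eventually_elim
    case (elim t)
    \<comment> \<open>The second unfolding acts on the intermediate vectors that the first one
      introduces.\<close>
    show ?case
      unfolding elim(1,2,5,6) unfolding elim(3,4)
      by (simp add: vec_eq_iff forall_2 row_times_matrix_def matrix_matrix_mult_def sum_4 sum_2
          vector_4 cmv_left_def cmv_right_def alpha_check_eq rho_check_eq algebra_simps)
  qed
qed

end

theorem mainTheorem1:
  fixes R :: "complex \<Rightarrow> complex"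
  assumes "R \<in> borel_measurable circle_measure"
    and "AE t in circle_measure. norm (R t) \<le> 1"
    and "log_integrable (\<lambda>t. 1 - norm (R t))"
  shows "LR_orthonormal_basis R (cmv_sequence R) \<and>
    (\<forall>n. AE t in circle_measure.
      (vector [U_R (K_check R n n) t, U_R (K_check_tilde R (n + 1) n) t] :: (complex^2)^2) =
      row_times_matrix
        (vector [K_check_tilde R n (n - 1) t, K_check R n n t,
                 K_check_tilde R (n + 1) n t, K_check R (n + 1) (n + 1) t] :: (complex^2)^4)
        (cmv_left R n ** cmv_right R n)) \<and>
    (\<forall>j. norm (alpha_check R j) < 1 \<and> rho_check R j > 0)"
proof -
  \<comment> \<open>Szego's problem is posed for the weight \<open>1 - norm (R t)\<close>, whose
    logarithm is integrable by assumption.\<close>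
  have "(\<lambda>t. 1 - norm (R t)) \<in> borel_measurable \<mu>" using assms(1) by measurable
  then obtain \<phi> where \<phi>: "\<phi> \<in> borel_measurable \<mu>"
    "AE t in \<mu>. (norm (\<phi> t))\<^sup>2 = 1 - norm (R t)"
    "\<And>k. k > 0 \<Longrightarrow> (LINT t|\<mu>. t powi k * \<phi> t) = 0"
    "(LINT t|\<mu>. \<phi> t) \<noteq> 0"
    using outer_function_ex[of "\<lambda>t. 1 - norm (R t)"] assms(3) by auto
  interpret symbol_with_outer R \<phi>
    by standard (use assms \<phi> in auto)
  show ?thesis
    using orthonormal_basis cmv_matrix norm_\<alpha> \<rho>_pos by (simp add: alpha_check_eq rho_check_eq)
qed

end
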